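(* Let $\lambda,\mu\in\Omega^*$ and let $\overline{E}=\overline{E}_{\lambda,\mu}$ be the product system over $P$ described in the context. The following are equivalent. (1) The product system $\overline{E}$ has a unit. (2) There exists $c>0$ such that $\lambda=c\mu$.
   Context: $P\subset\mathbb{R}^d$ is a closed convex cone with $P-P=\mathbb{R}^d$ and $P\cap-P=\{0\}$. $\Omega^*=\{\lambda\in\mathbb{R}^d:\langle\lambda|x\rangle>0\ \forall x\in P\setminus\{0\}\}$ is the interior of the dual cone of $P$. Inner products are linear in the first variable. Let $\{S_t\}_{t\ge0}$ be the shift semigroup on $L^2(0,\infty)$ ($S_tf(x)=f(x-t)$ for $x>t$ and $0$ otherwise). Given $\lambda,\mu\in\Omega^*$, put for $a,b\in P$: $\chi(a)=\langle\lambda|a\rangle$, $h_b=1_{(0,\langle\mu|b\rangle)}\in L^2(0,\infty)$, $V_a=S_{\langle\mu|a\rangle}$. Then $V=\{V_a\}_{a\in P}$ is a strongly continuous semigroup of isometries on $L^2(0,\infty)$. On the symmetric Fock space $\Gamma=\Gamma(L^2(0,\infty))$ with exponential vectors $e(\eta)$, the Weyl operators are $W(\xi)e(\eta)=e^{-\frac{\|\xi\|^2}{2}-\langle\eta|\xi\rangle}e(\xi+\eta)$. The CCR flow $\alpha^V=\{\alpha_x\}_{x\in P}$ is the unique semigroup of unital normal $*$-endomorphisms of $B(\Gamma)$, with $x\mapsto\langle\alpha_x(A)\xi|\eta\rangle$ continuous for all $A,\xi,\eta$, such that $\alpha_x(W(\xi))=W(V_x\xi)$. Its product system $E$ has fibres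 $E(x)=\{T\in B(\Gamma):\alpha_x(A)T=TA\ \forall A\in B(\Gamma)\}$, with inner product $\langle S|T\rangle1=T^*S$. $\overline{E}$ has the same fibres, Hilbert space structure and measurable structure as $E$ ($\overline{E}(x)=E(x)$), but with the (well defined, associative) product $$S.T=S\,W(\chi(a)h_b)\,T\in\overline{E}(a+b)\qquad(S\in\overline{E}(a),\ T\in\overline{E}(b),\ a,b\in P).$$ A unit of $\overline{E}$ is a family $(u_a)_{a\in P}$ with $0\ne u_a\in\overline{E}(a)$, $u_a.u_b=u_{a+b}$ for all $a,b\in P$, and measurable in the sense that $a\mapsto\langle u_a\xi|\eta\rangle$ is measurable for all $\xi,\eta\in\Gamma$. *)

theory Defs
  imports "HOL-Analysis.Analysis"
begin

section \<open>Complex inner product spaces\<close>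

text \<open>The distribution has no complex inner products. The complex inner product is linear in its
  first argument; its real part is the real inner product.\<close>

class complex_inner = real_inner +
  fixes scaleC :: "complex \<Rightarrow> 'a \<Rightarrow> 'a" (infixr "*\<^sub>C" 75)
    and cinner :: "'a \<Rightarrow> 'a \<Rightarrow> complex"
  assumes scaleC_of_real: "of_real r *\<^sub>C x = r *\<^sub>R x"
    and scaleC_add_right: "c *\<^sub>C (x + y) = c *\<^sub>C x + c *\<^sub>C y"
    and scaleC_add_left: "(c + d) *\<^sub>C x = c *\<^sub>C x + d *\<^sub>C x"
    and scaleC_scaleC: "c *\<^sub>C d *\<^sub>C x = (c * d) *\<^sub>C x"
    and cinner_commute: "cinner x y = cnj (cinner y x)"
    and cinner_add_left: "cinner (x + y) z = cinner x z + cinner y z"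
    and cinner_scaleC_left: "cinner (c *\<^sub>C x) y = c * cinner x y"
    and inner_eq_Re_cinner: "inner x y = Re (cinner x y)"

section \<open>Square-integrable functions\<close>

definition sqint :: "'a measure \<Rightarrow> ('a \<Rightarrow> complex) \<Rightarrow> bool" where
  "sqint M f \<longleftrightarrow> f \<in> borel_measurable M \<and> integrable M (\<lambda>x. (cmod (f x))\<^sup>2)"

lemma sqint_zero [simp]: "sqint M (\<lambda>x. 0)"
  by (simp add: sqint_def)

lemma cmod_add_sq_le: "(cmod (a + b))\<^sup>2 \<le> 2 * (cmod a)\<^sup>2 + 2 * (cmod b)\<^sup>2"
proof -
  have "(cmod (a + b))\<^sup>2 \<le> (cmod a + cmod b)\<^sup>2"
    by (intro power_mono norm_triangle_ineq) auto
  also have "\<dots> \<le> 2 * (cmod a)\<^sup>2 + 2 * (cmod b)\<^sup>2"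
    using sum_squares_bound[of "cmod a" "cmod b"] by (simp add: power2_sum)
  finally show ?thesis .
qed

lemma cmod_mult_cnj_le: "cmod (a * cnj b) \<le> (cmod a)\<^sup>2 + (cmod b)\<^sup>2"
proof -
  have "0 \<le> cmod a * cmod b" by simp
  then have "cmod a * cmod b \<le> (cmod a)\<^sup>2 + (cmod b)\<^sup>2"
    using sum_squares_bound[of "cmod a" "cmod b"] by linarith
  then show ?thesis by (simp add: norm_mult)
qed

lemma sqint_add [intro]:
  assumes "sqint M f" "sqint M g"
  shows "sqint M (\<lambda>x. f x + g x)"
proof -
  have [measurable]: "f \<in> borel_measurable M" "g \<in> borel_measurable M"
    using assms by (auto simp: sqint_def)
  have "integrable M (\<lambda>x. (cmod (f x + g x))\<^sup>2)"
  proof (rule Bochner_Integration.integrable_bound)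
    show "integrable M (\<lambda>x. 2 * (cmod (f x))\<^sup>2 + 2 * (cmod (g x))\<^sup>2)"
      using assms by (auto simp: sqint_def)
  qed (use cmod_add_sq_le in auto)
  then show ?thesis by (simp add: sqint_def)
qed

lemma sqint_cmult [intro]:
  assumes "sqint M f"
  shows "sqint M (\<lambda>x. c * f x)"
  using assms by (auto simp: sqint_def norm_mult power_mult_distrib)

lemma sqint_uminus [intro]: "sqint M f \<Longrightarrow> sqint M (\<lambda>x. - f x)"
  by (auto simp: sqint_def)

lemma sqint_diff [intro]: "sqint M f \<Longrightarrow> sqint M g \<Longrightarrow> sqint M (\<lambda>x. f x - g x)"
  using sqint_add[of M f "\<lambda>x. - g x"] by auto

lemma sqint_mult_integrable:
  assumes "sqint M f" "sqint M g"
  shows "integrable M (\<lambda>x. f x * cnj (g x))"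
proof (rule Bochner_Integration.integrable_bound)
  show "integrable M (\<lambda>x. (cmod (f x))\<^sup>2 + (cmod (g x))\<^sup>2)"
    using assms by (auto simp: sqint_def)
  have [measurable]: "f \<in> borel_measurable M" "g \<in> borel_measurable M"
    using assms by (auto simp: sqint_def)
  have "(\<lambda>x. cnj (g x)) \<in> borel_measurable M"
    by (rule borel_measurable_continuous_on[of cnj]) (auto intro: continuous_intros)
  then show "(\<lambda>x. f x * cnj (g x)) \<in> borel_measurable M" by simp
qed (use cmod_mult_cnj_le in auto)

lemma sqint_mult_integral_le:
  assumes "sqint M f" "sqint M g"
  shows "cmod (LINT x|M. f x * cnj (g x)) \<le> (LINT x|M. (cmod (f x))\<^sup>2) + (LINT x|M. (cmod (g x))\<^sup>2)"
proof -
  have "cmod (LINT x|M. f x * cnj (g x)) \<le> (LINT x|M. cmod (f x * cnj (g x)))"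
    by (rule integral_norm_bound)
  also have "\<dots> \<le> (LINT x|M. (cmod (f x))\<^sup>2 + (cmod (g x))\<^sup>2)"
    using assms sqint_mult_integrable[OF assms]
    by (intro integral_mono cmod_mult_cnj_le) (auto simp: sqint_def)
  also have "\<dots> = (LINT x|M. (cmod (f x))\<^sup>2) + (LINT x|M. (cmod (g x))\<^sup>2)"
    using assms by (intro Bochner_Integration.integral_add) (auto simp: sqint_def)
  finally show ?thesis .
qed

lemma cinner_integral_self: "(LINT x|M. f x * cnj (f x)) = of_real (LINT x|M. (cmod (f x))\<^sup>2)"
  unfolding complex_norm_square[symmetric] by (rule integral_complex_of_real)

lemma cinner_integral_commute: "(LINT x|M. f x * cnj (g x)) = cnj (LINT x|M. g x * cnj (f x))"
  by (subst Bochner_Integration.integral_cnj[symmetric]) (simp add: mult.commute)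

lemma sqint_integral_zero_iff:
  assumes "sqint M f"
  shows "(LINT x|M. (cmod (f x))\<^sup>2) = 0 \<longleftrightarrow> (AE x in M. f x = 0)"
  using integral_nonneg_eq_0_iff_AE[of M "\<lambda>x. (cmod (f x))\<^sup>2"] assms by (simp add: sqint_def)

lemma sqint_integral_cong_AE:
  assumes "sqint M f" "sqint M f'" "sqint M g" "sqint M g'"
    and "AE x in M. f x = f' x" "AE x in M. g x = g' x"
  shows "(LINT x|M. f x * cnj (g x)) = (LINT x|M. f' x * cnj (g' x))"
proof (rule integral_cong_AE)
  show "(\<lambda>x. f x * cnj (g x)) \<in> borel_measurable M" "(\<lambda>x. f' x * cnj (g' x)) \<in> borel_measurable M"
    by (rule borel_measurable_integrable, rule sqint_mult_integrable, fact, fact)+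
  show "AE x in M. f x * cnj (g x) = f' x * cnj (g' x)"
    using assms(5,6) by eventually_elim simp
qed

section \<open>The Hilbert space $L^2(0,\infty)$\<close>

abbreviation halfline :: "real measure" where
  "halfline \<equiv> restrict_space lborel {0<..}"

definition l2_eq :: "(real \<Rightarrow> complex) \<Rightarrow> (real \<Rightarrow> complex) \<Rightarrow> bool" where
  "l2_eq f g \<longleftrightarrow> sqint halfline f \<and> sqint halfline g \<and> (AE x in halfline. f x = g x)"

quotient_type l2 = "real \<Rightarrow> complex" / partial: l2_eq
proof (rule part_equivpI)
  show "\<exists>f. l2_eq f f"
    by (rule exI[of _ "\<lambda>_. 0"]) (simp add: l2_eq_def)
  show "symp l2_eq"
    by (rule sympI) (auto simp: l2_eq_def elim: eventually_mono)
  show "transp l2_eq"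
  proof (rule transpI)
    fix f g h assume *: "l2_eq f g" "l2_eq g h"
    then have "AE x in halfline. f x = g x" "AE x in halfline. g x = h x"
      by (auto simp: l2_eq_def)
    then have "AE x in halfline. f x = h x" by eventually_elim simp
    then show "l2_eq f h" using * by (simp add: l2_eq_def)
  qed
qed

instantiation l2 :: complex_inner
begin

lift_definition zero_l2 :: l2 is "\<lambda>_. 0"
  by (simp add: l2_eq_def)

lift_definition plus_l2 :: "l2 \<Rightarrow> l2 \<Rightarrow> l2" is "\<lambda>f g x. f x + g x"
proof -
  fix f f' g g' assume *: "l2_eq f f'" "l2_eq g g'"
  then have "AE x in halfline. f x = f' x" "AE x in halfline. g x = g' x"
    by (auto simp: l2_eq_def)
  then have "AE x in halfline. f x + g x = f' x + g' x" by eventually_elim simp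
  then show "l2_eq (\<lambda>x. f x + g x) (\<lambda>x. f' x + g' x)"
    using * by (simp add: l2_eq_def sqint_add)
qed

lift_definition minus_l2 :: "l2 \<Rightarrow> l2 \<Rightarrow> l2" is "\<lambda>f g x. f x - g x"
proof -
  fix f f' g g' assume *: "l2_eq f f'" "l2_eq g g'"
  then have "AE x in halfline. f x = f' x" "AE x in halfline. g x = g' x"
    by (auto simp: l2_eq_def)
  then have "AE x in halfline. f x - g x = f' x - g' x" by eventually_elim simp
  then show "l2_eq (\<lambda>x. f x - g x) (\<lambda>x. f' x - g' x)"
    using * by (simp add: l2_eq_def sqint_diff)
qed

lift_definition uminus_l2 :: "l2 \<Rightarrow> l2" is "\<lambda>f x. - f x"
  by (auto simp: l2_eq_def elim: eventually_mono)

lift_definition scaleC_l2 :: "complex \<Rightarrow> l2 \<Rightarrow> l2" is "\<lambda>c f x. c * f x"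
  by (auto simp: l2_eq_def elim: eventually_mono)

lift_definition cinner_l2 :: "l2 \<Rightarrow> l2 \<Rightarrow> complex" is "\<lambda>f g. LINT x|halfline. f x * cnj (g x)"
  by (auto simp: l2_eq_def intro: sqint_integral_cong_AE)

definition scaleR_l2 :: "real \<Rightarrow> l2 \<Rightarrow> l2" where "scaleR_l2 r f = of_real r *\<^sub>C f"

definition inner_l2 :: "l2 \<Rightarrow> l2 \<Rightarrow> real" where "inner_l2 f g = Re (cinner f g)"

definition norm_l2 :: "l2 \<Rightarrow> real" where "norm_l2 f = sqrt (inner f f)"

definition sgn_l2 :: "l2 \<Rightarrow> l2" where "sgn_l2 f = inverse (norm f) *\<^sub>R f"

definition dist_l2 :: "l2 \<Rightarrow> l2 \<Rightarrow> real" where "dist_l2 f g = norm (f - g)"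

definition uniformity_l2 :: "(l2 \<times> l2) filter" where
  "uniformity_l2 = (INF e\<in>{0<..}. principal {(f, g). dist f g < e})"

definition open_l2 :: "l2 set \<Rightarrow> bool" where
  "open_l2 U \<longleftrightarrow> (\<forall>x\<in>U. \<forall>\<^sub>F (x', y) in uniformity. x' = x \<longrightarrow> y \<in> U)"

instance
proof
  fix f g h :: l2 and c d :: complex and r s :: real
  show "f + g + h = f + (g + h)"
    by transfer (auto simp: l2_eq_def add.assoc)
  show "f + g = g + f"
    by transfer (auto simp: l2_eq_def add.commute)
  show "0 + f = f"
    by transfer (auto simp: l2_eq_def)
  show "- f + f = 0"
    by transfer (auto simp: l2_eq_def)
  show "f - g = f + - g"
    by transfer (auto simp: l2_eq_def)
  show addr: "c *\<^sub>C (f + g) = c *\<^sub>C f + c *\<^sub>C g" for c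
    by transfer (auto simp: l2_eq_def ring_distribs)
  show addl: "(c + d) *\<^sub>C f = c *\<^sub>C f + d *\<^sub>C f" for c d
    by transfer (auto simp: l2_eq_def ring_distribs)
  show mul: "c *\<^sub>C d *\<^sub>C f = (c * d) *\<^sub>C f" for c d
    by transfer (auto simp: l2_eq_def mult.assoc)
  have one: "1 *\<^sub>C f = f"
    by transfer (auto simp: l2_eq_def)
  show "r *\<^sub>R (f + g) = r *\<^sub>R f + r *\<^sub>R g" by (simp add: scaleR_l2_def addr)
  show "(r + s) *\<^sub>R f = r *\<^sub>R f + s *\<^sub>R f" by (simp add: scaleR_l2_def addl)
  show "r *\<^sub>R s *\<^sub>R f = (r * s) *\<^sub>R f" by (simp add: scaleR_l2_def mul)
  show "1 *\<^sub>R f = f" by (simp add: scaleR_l2_def one)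
  show "of_real r *\<^sub>C f = r *\<^sub>R f" by (simp add: scaleR_l2_def)
  show comm: "cinner f g = cnj (cinner g f)"
    by transfer (rule cinner_integral_commute)
  show addi: "cinner (f + g) h = cinner f h + cinner g h"
    by transfer (auto simp: l2_eq_def ring_distribs sqint_mult_integrable
        intro!: Bochner_Integration.integral_add)
  show scal: "cinner (c *\<^sub>C f) g = c * cinner f g" for c
    by transfer (auto simp: l2_eq_def mult.assoc)
  show "inner f g = Re (cinner f g)" by (simp add: inner_l2_def)
  show "inner f g = inner g f" unfolding inner_l2_def by (subst comm) simp
  show "inner (f + g) h = inner f h + inner g h" by (simp add: inner_l2_def addi)
  show "inner (r *\<^sub>R f) g = r * inner f g" by (simp add: inner_l2_def scaleR_l2_def scal)
  show "0 \<le> inner f f"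
    unfolding inner_l2_def by transfer (simp add: cinner_integral_self)
  show "inner f f = 0 \<longleftrightarrow> f = 0"
    unfolding inner_l2_def
    by transfer (auto simp: cinner_integral_self sqint_integral_zero_iff l2_eq_def)
  show "norm f = sqrt (inner f f)" by (simp add: norm_l2_def)
  show "sgn f = inverse (norm f) *\<^sub>R f" by (simp add: sgn_l2_def)
  show "dist f g = norm (f - g)" by (simp add: dist_l2_def)
qed (simp_all add: uniformity_l2_def open_l2_def)

end

lemma sqint_halfline_iff:
  "sqint halfline f \<longleftrightarrow> sqint lborel (\<lambda>x. if 0 < x then f x else 0)"
proof -
  have 1: "(\<lambda>x. indicator {0<..} x *\<^sub>R f x) = (\<lambda>x. if 0 < x then f x else 0)"
    by (auto simp: indicator_def)
  have 2: "(\<lambda>x. indicator {0<..} x *\<^sub>R (cmod (f x))\<^sup>2) = (\<lambda>x. (cmod (if 0 < x then f x else 0))\<^sup>2)"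
    by (auto simp: indicator_def)
  show ?thesis
    unfolding sqint_def
    by (subst borel_measurable_restrict_space_iff, simp, subst integrable_restrict_space, simp,
        unfold 1 2, simp)
qed

lemma AE_halfline_iff: "(AE x in halfline. Q x) \<longleftrightarrow> (AE x in lborel. 0 < x \<longrightarrow> Q x)"
  by (subst AE_restrict_space_iff) auto

lemma AE_lborel_shift:
  assumes "AE x in lborel. Q x"
  shows "AE x in lborel. Q (x - t :: real)"
proof -
  obtain N where N: "N \<in> null_sets lborel" "{x. \<not> Q x} \<subseteq> N"
    using assms by (auto simp: eventually_ae_filter)
  have "AE x in lborel. x \<notin> N" using N(1) by (rule AE_not_in)
  moreover have "Measurable.pred borel (\<lambda>x. x \<notin> N)"
    using N(1) by (auto simp: null_sets_def)
  ultimately have "AE x in lborel. - t + 1 * x \<notin> N"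
    by (intro AE_borel_affine) auto
  then show ?thesis
    by eventually_elim (use N(2) in \<open>auto simp: algebra_simps\<close>)
qed

lemma sqint_shift:
  assumes "sqint halfline f"
  shows "sqint halfline (\<lambda>x. if t < x then f (x - t) else 0)"
proof -
  define F where "F = (\<lambda>x::real. if 0 < x then f x else 0)"
  have F: "sqint lborel F" using assms by (simp add: sqint_halfline_iff F_def)
  then have [measurable]: "F \<in> borel_measurable borel" by (simp add: sqint_def)
  have "integrable lborel (\<lambda>x. (cmod (F (- t + 1 * x)))\<^sup>2)"
    using F by (intro lborel_integrable_real_affine) (auto simp: sqint_def)
  then have int: "integrable lborel (\<lambda>x. (cmod (F (x - t)))\<^sup>2)" by (simp add: algebra_simps)
  have "integrable lborel (\<lambda>x. (cmod (if 0 < x then F (x - t) else 0))\<^sup>2)"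
    by (rule Bochner_Integration.integrable_bound[OF int]) auto
  then have "sqint lborel (\<lambda>x. if 0 < x then F (x - t) else 0)"
    by (simp add: sqint_def)
  also have "(\<lambda>x. if 0 < x then F (x - t) else 0) =
      (\<lambda>x. if 0 < x then if t < x then f (x - t) else 0 else 0)"
    by (auto simp: F_def)
  finally show ?thesis by (simp only: sqint_halfline_iff)
qed

lift_definition shift :: "real \<Rightarrow> l2 \<Rightarrow> l2" is "\<lambda>t f x. if t < x then f (x - t) else 0"
proof -
  fix t f g assume "l2_eq f g"
  then have fg: "sqint halfline f" "sqint halfline g" "AE x in lborel. 0 < x \<longrightarrow> f x = g x"
    by (auto simp: l2_eq_def AE_halfline_iff)
  have "AE x in halfline. (if t < x then f (x - t) else 0) = (if t < x then g (x - t) else 0)"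
    unfolding AE_halfline_iff using AE_lborel_shift[OF fg(3), of t]
    by eventually_elim auto
  with fg show "l2_eq (\<lambda>x. if t < x then f (x - t) else 0) (\<lambda>x. if t < x then g (x - t) else 0)"
    by (simp add: l2_eq_def sqint_shift)
qed

lift_definition interval_ind :: "real \<Rightarrow> l2" is "\<lambda>t. indicator {0<..<t}"
proof -
  fix t :: real
  have "(\<lambda>x. if 0 < x then indicator {0<..<t} x else 0 :: complex) = indicator {0<..<t}"
    by (auto simp: indicator_def)
  moreover have "(\<lambda>x. (cmod (indicator {0<..<t} x))\<^sup>2) = (indicator {0<..<t} :: real \<Rightarrow> real)"
    by (auto simp: indicator_def)
  moreover have "integrable lborel (indicator {0<..<t} :: real \<Rightarrow> real)"
    using emeasure_bounded_finite[of "{0<..<t}"]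
    by (intro integrable_real_indicator) (simp_all add: less_top)
  ultimately have "sqint halfline (indicator {0<..<t})"
    unfolding sqint_halfline_iff by (simp add: sqint_def)
  then show "l2_eq (indicator {0<..<t}) (indicator {0<..<t})"
    by (simp add: l2_eq_def)
qed

section \<open>The symmetric Fock space\<close>

text \<open>The Fock space is the Hilbert sum over \<open>n\<close> of the $n$-particle spaces of symmetric
  square-integrable functions on $(0,\infty)^n$; a vector is represented by the sequence of its
  $n$-particle components.\<close>

abbreviation particles :: "nat \<Rightarrow> (nat \<Rightarrow> real) measure" where
  "particles n \<equiv> PiM {..<n} (\<lambda>_. halfline)"

definition fock_rep :: "(nat \<Rightarrow> (nat \<Rightarrow> real) \<Rightarrow> complex) \<Rightarrow> bool" where
  "fock_rep F \<longleftrightarrow> (\<forall>n. sqint (particles n) (F n))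
     \<and> (\<forall>n p. p permutes {..<n} \<longrightarrow> (AE x in particles n. F n (x \<circ> p) = F n x))
     \<and> summable (\<lambda>n. LINT x|particles n. (cmod (F n x))\<^sup>2)"

definition fock_eq ::
  "(nat \<Rightarrow> (nat \<Rightarrow> real) \<Rightarrow> complex) \<Rightarrow> (nat \<Rightarrow> (nat \<Rightarrow> real) \<Rightarrow> complex) \<Rightarrow> bool" where
  "fock_eq F G \<longleftrightarrow> fock_rep F \<and> fock_rep G \<and> (\<forall>n. AE x in particles n. F n x = G n x)"

lemma fock_rep_sqint: "fock_rep F \<Longrightarrow> sqint (particles n) (F n)"
  by (simp add: fock_rep_def)

lemma fock_rep_zero: "fock_rep (\<lambda>n x. 0)"
  by (simp add: fock_rep_def)

lemma fock_rep_add: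
  assumes "fock_rep F" "fock_rep G"
  shows "fock_rep (\<lambda>n x. F n x + G n x)"
proof -
  have sum: "summable (\<lambda>n. LINT x|particles n. (cmod (F n x + G n x))\<^sup>2)"
  proof (rule summable_comparison_test)
    show "summable (\<lambda>n. 2 * (LINT x|particles n. (cmod (F n x))\<^sup>2)
                      + 2 * (LINT x|particles n. (cmod (G n x))\<^sup>2))"
      using assms by (intro summable_add summable_mult) (auto simp: fock_rep_def)
    have "(LINT x|particles n. (cmod (F n x + G n x))\<^sup>2)
        \<le> 2 * (LINT x|particles n. (cmod (F n x))\<^sup>2) + 2 * (LINT x|particles n. (cmod (G n x))\<^sup>2)" for n
    proof -
      have i: "integrable (particles n) (\<lambda>x. (cmod (F n x))\<^sup>2)"
          "integrable (particles n) (\<lambda>x. (cmod (G n x))\<^sup>2)"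
          "integrable (particles n) (\<lambda>x. (cmod (F n x + G n x))\<^sup>2)"
        using fock_rep_sqint[OF assms(1), of n] fock_rep_sqint[OF assms(2), of n]
          sqint_add[of "particles n" "F n" "G n"] by (auto simp: sqint_def)
      have "(LINT x|particles n. (cmod (F n x + G n x))\<^sup>2)
        \<le> (LINT x|particles n. 2 * (cmod (F n x))\<^sup>2 + 2 * (cmod (G n x))\<^sup>2)"
        using i by (intro integral_mono cmod_add_sq_le) auto
      then show ?thesis using i by simp
    qed
    then show "\<exists>N. \<forall>n\<ge>N. norm (LINT x|particles n. (cmod (F n x + G n x))\<^sup>2)
        \<le> 2 * (LINT x|particles n. (cmod (F n x))\<^sup>2) + 2 * (LINT x|particles n. (cmod (G n x))\<^sup>2)"
      by (auto simp: Bochner_Integration.integral_nonneg)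
  qed
  have sym: "AE x in particles n. F n (x \<circ> p) + G n (x \<circ> p) = F n x + G n x"
    if p: "p permutes {..<n}" for n p
  proof -
    have "AE x in particles n. F n (x \<circ> p) = F n x" "AE x in particles n. G n (x \<circ> p) = G n x"
      using assms p by (auto simp: fock_rep_def)
    then show ?thesis by eventually_elim simp
  qed
  show ?thesis
    using assms sum sym unfolding fock_rep_def by blast
qed

lemma fock_rep_scale:
  assumes "fock_rep F"
  shows "fock_rep (\<lambda>n x. c * F n x)"
proof -
  have "AE x in particles n. c * F n (x \<circ> p) = c * F n x" if p: "p permutes {..<n}" for n p
  proof -
    have "AE x in particles n. F n (x \<circ> p) = F n x"
      using assms p by (auto simp: fock_rep_def)
    then show ?thesis by eventually_elim simp
  qed
  moreover have "summable (\<lambda>n. LINT x|particles n. (cmod (c * F n x))\<^sup>2)"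
    using assms by (auto simp: fock_rep_def norm_mult power_mult_distrib intro: summable_mult)
  ultimately show ?thesis
    using assms unfolding fock_rep_def by blast
qed

lemma fock_rep_uminus: "fock_rep F \<Longrightarrow> fock_rep (\<lambda>n x. - F n x)"
  using fock_rep_scale[of F "-1"] by simp

lemma fock_rep_diff: "fock_rep F \<Longrightarrow> fock_rep G \<Longrightarrow> fock_rep (\<lambda>n x. F n x - G n x)"
  using fock_rep_add[OF _ fock_rep_uminus, of F G] by simp

lemma fock_rep_summable_cinner:
  assumes "fock_rep F" "fock_rep G"
  shows "summable (\<lambda>n. LINT x|particles n. F n x * cnj (G n x))"
proof (rule summable_comparison_test)
  show "summable (\<lambda>n. (LINT x|particles n. (cmod (F n x))\<^sup>2) + (LINT x|particles n. (cmod (G n x))\<^sup>2))"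
    using assms by (intro summable_add) (auto simp: fock_rep_def)
  show "\<exists>N. \<forall>n\<ge>N. norm (LINT x|particles n. F n x * cnj (G n x))
      \<le> (LINT x|particles n. (cmod (F n x))\<^sup>2) + (LINT x|particles n. (cmod (G n x))\<^sup>2)"
    using assms by (auto simp: fock_rep_def intro!: sqint_mult_integral_le)
qed

lemma fock_eq_refl [simp]: "fock_eq F F \<longleftrightarrow> fock_rep F"
  by (simp add: fock_eq_def)

quotient_type fock = "nat \<Rightarrow> (nat \<Rightarrow> real) \<Rightarrow> complex" / partial: fock_eq
proof (rule part_equivpI)
  show "\<exists>F. fock_eq F F"
    using fock_rep_zero by (intro exI[of _ "\<lambda>_ _. 0"]) simp
  show "symp fock_eq"
  proof (rule sympI)
    fix F G assume FG: "fock_eq F G"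
    have "AE x in particles n. G n x = F n x" for n
    proof -
      have "AE x in particles n. F n x = G n x" using FG by (simp add: fock_eq_def)
      then show ?thesis by eventually_elim simp
    qed
    then show "fock_eq G F" using FG by (simp add: fock_eq_def)
  qed
  show "transp fock_eq"
  proof (rule transpI)
    fix F G H assume FG: "fock_eq F G" and GH: "fock_eq G H"
    have "AE x in particles n. F n x = H n x" for n
    proof -
      have "AE x in particles n. F n x = G n x" "AE x in particles n. G n x = H n x"
        using FG GH by (auto simp: fock_eq_def)
      then show ?thesis by eventually_elim simp
    qed
    then show "fock_eq F H" using FG GH by (simp add: fock_eq_def)
  qed
qed

instantiation fock :: complex_inner
begin

lift_definition zero_fock :: fock is "\<lambda>_ _. 0"
  by (simp add: fock_rep_zero)

lift_definition plus_fock :: "fock \<Rightarrow> fock \<Rightarrow> fock" is "\<lambda>F G n x. F n x + G n x"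
proof -
  fix F F' G G' assume *: "fock_eq F F'" "fock_eq G G'"
  have "AE x in particles n. F n x + G n x = F' n x + G' n x" for n
  proof -
    have "AE x in particles n. F n x = F' n x" "AE x in particles n. G n x = G' n x"
      using * by (auto simp: fock_eq_def)
    then show ?thesis by eventually_elim simp
  qed
  then show "fock_eq (\<lambda>n x. F n x + G n x) (\<lambda>n x. F' n x + G' n x)"
    using * by (simp add: fock_eq_def fock_rep_add)
qed

lift_definition minus_fock :: "fock \<Rightarrow> fock \<Rightarrow> fock" is "\<lambda>F G n x. F n x - G n x"
proof -
  fix F F' G G' assume *: "fock_eq F F'" "fock_eq G G'"
  have "AE x in particles n. F n x - G n x = F' n x - G' n x" for n
  proof -
    have "AE x in particles n. F n x = F' n x" "AE x in particles n. G n x = G' n x"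
      using * by (auto simp: fock_eq_def)
    then show ?thesis by eventually_elim simp
  qed
  then show "fock_eq (\<lambda>n x. F n x - G n x) (\<lambda>n x. F' n x - G' n x)"
    using * by (simp add: fock_eq_def fock_rep_diff)
qed

lift_definition uminus_fock :: "fock \<Rightarrow> fock" is "\<lambda>F n x. - F n x"
  by (auto simp: fock_eq_def fock_rep_uminus)

lift_definition scaleC_fock :: "complex \<Rightarrow> fock \<Rightarrow> fock" is "\<lambda>c F n x. c * F n x"
proof -
  fix c :: complex and F G assume *: "fock_eq F G"
  have "AE x in particles n. c * F n x = c * G n x" for n
  proof -
    have "AE x in particles n. F n x = G n x" using * by (auto simp: fock_eq_def)
    then show ?thesis by eventually_elim simp
  qed
  then show "fock_eq (\<lambda>n x. c * F n x) (\<lambda>n x. c * G n x)"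
    using * by (simp add: fock_eq_def fock_rep_scale)
qed

lift_definition cinner_fock :: "fock \<Rightarrow> fock \<Rightarrow> complex" is
  "\<lambda>F G. \<Sum>n. LINT x|particles n. F n x * cnj (G n x)"
  by (auto simp: fock_eq_def fock_rep_sqint intro!: suminf_cong sqint_integral_cong_AE)

definition scaleR_fock :: "real \<Rightarrow> fock \<Rightarrow> fock" where "scaleR_fock r f = of_real r *\<^sub>C f"

definition inner_fock :: "fock \<Rightarrow> fock \<Rightarrow> real" where "inner_fock f g = Re (cinner f g)"

definition norm_fock :: "fock \<Rightarrow> real" where "norm_fock f = sqrt (inner f f)"

definition sgn_fock :: "fock \<Rightarrow> fock" where "sgn_fock f = inverse (norm f) *\<^sub>R f"

definition dist_fock :: "fock \<Rightarrow> fock \<Rightarrow> real" where "dist_fock f g = norm (f - g)"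

definition uniformity_fock :: "(fock \<times> fock) filter" where
  "uniformity_fock = (INF e\<in>{0<..}. principal {(f, g). dist f g < e})"

definition open_fock :: "fock set \<Rightarrow> bool" where
  "open_fock U \<longleftrightarrow> (\<forall>x\<in>U. \<forall>\<^sub>F (x', y) in uniformity. x' = x \<longrightarrow> y \<in> U)"

instance
proof
  fix f g h :: fock and c d :: complex and r s :: real
  show "f + g + h = f + (g + h)"
    by transfer (simp add: fock_rep_add add.assoc)
  show "f + g = g + f"
    by transfer (simp add: fock_rep_add add.commute)
  show "0 + f = f"
    by transfer simp
  show "- f + f = 0"
    by transfer (simp add: fock_rep_zero)
  show "f - g = f + - g"
    by transfer (simp add: fock_rep_diff)
  show addr: "c *\<^sub>C (f + g) = c *\<^sub>C f + c *\<^sub>C g" for c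
    by transfer (simp add: distrib_left fock_rep_add fock_rep_scale)
  show addl: "(c + d) *\<^sub>C f = c *\<^sub>C f + d *\<^sub>C f" for c d
    by transfer (simp add: distrib_right fock_rep_add fock_rep_scale)
  show mul: "c *\<^sub>C d *\<^sub>C f = (c * d) *\<^sub>C f" for c d
    by transfer (simp add: mult.assoc fock_rep_scale flip: mult.assoc)
  have one: "1 *\<^sub>C f = f"
    by transfer simp
  show "r *\<^sub>R (f + g) = r *\<^sub>R f + r *\<^sub>R g" by (simp add: scaleR_fock_def addr)
  show "(r + s) *\<^sub>R f = r *\<^sub>R f + s *\<^sub>R f" by (simp add: scaleR_fock_def addl)
  show "r *\<^sub>R s *\<^sub>R f = (r * s) *\<^sub>R f" by (simp add: scaleR_fock_def mul)
  show "1 *\<^sub>R f = f" by (simp add: scaleR_fock_def one)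
  show "of_real r *\<^sub>C f = r *\<^sub>R f" by (simp add: scaleR_fock_def)
  show comm: "cinner f g = cnj (cinner g f)"
  proof transfer
    fix F G assume "fock_eq F F" "fock_eq G G"
    then have "summable (\<lambda>n. LINT x|particles n. G n x * cnj (F n x))"
      by (simp add: fock_rep_summable_cinner)
    then have "(\<lambda>n. LINT x|particles n. G n x * cnj (F n x)) sums
        (\<Sum>n. LINT x|particles n. G n x * cnj (F n x))"
      by (rule summable_sums)
    then have "(\<lambda>n. cnj (LINT x|particles n. G n x * cnj (F n x))) sums
        cnj (\<Sum>n. LINT x|particles n. G n x * cnj (F n x))"
      by (simp only: sums_cnj)
    then show "(\<Sum>n. LINT x|particles n. F n x * cnj (G n x)) =
        cnj (\<Sum>n. LINT x|particles n. G n x * cnj (F n x))"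
      by (simp add: sums_iff flip: cinner_integral_commute)
  qed
  show addi: "cinner (f + g) h = cinner f h + cinner g h"
  proof transfer
    fix F G H assume "fock_eq F F" "fock_eq G G" "fock_eq H H"
    then have rep: "fock_rep F" "fock_rep G" "fock_rep H" by simp_all
    have "(LINT x|particles n. (F n x + G n x) * cnj (H n x)) =
        (LINT x|particles n. F n x * cnj (H n x)) + (LINT x|particles n. G n x * cnj (H n x))" for n
      using rep by (simp add: distrib_right sqint_mult_integrable fock_rep_sqint)
    then show "(\<Sum>n. LINT x|particles n. (F n x + G n x) * cnj (H n x)) =
        (\<Sum>n. LINT x|particles n. F n x * cnj (H n x)) + (\<Sum>n. LINT x|particles n. G n x * cnj (H n x))"
      using rep by (simp add: suminf_add fock_rep_summable_cinner)
  qed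
  show scal: "cinner (c *\<^sub>C f) g = c * cinner f g" for c
    by transfer (simp add: mult.assoc suminf_mult fock_rep_summable_cinner)
  show "inner f g = Re (cinner f g)" by (simp add: inner_fock_def)
  show "inner f g = inner g f" unfolding inner_fock_def by (subst comm) simp
  show "inner (f + g) h = inner f h + inner g h" by (simp add: inner_fock_def addi)
  show "inner (r *\<^sub>R f) g = r * inner f g" by (simp add: inner_fock_def scaleR_fock_def scal)
  have self: "(\<Sum>n. LINT x|particles n. F n x * cnj (F n x)) =
      of_real (\<Sum>n. LINT x|particles n. (cmod (F n x))\<^sup>2)" if "fock_rep F" for F
    using that unfolding cinner_integral_self
    by (intro suminf_of_real[symmetric]) (simp add: fock_rep_def)
  show "0 \<le> inner f f"
    unfolding inner_fock_def
    by transfer (simp add: self fock_rep_def suminf_nonneg Bochner_Integration.integral_nonneg)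
  show "inner f f = 0 \<longleftrightarrow> f = 0"
    unfolding inner_fock_def
  proof transfer
    fix F assume "fock_eq F F"
    then have F: "fock_rep F" by simp
    then have "(\<Sum>n. LINT x|particles n. (cmod (F n x))\<^sup>2) = 0 \<longleftrightarrow>
        (\<forall>n. (LINT x|particles n. (cmod (F n x))\<^sup>2) = 0)"
      by (intro suminf_eq_zero_iff) (auto simp: fock_rep_def Bochner_Integration.integral_nonneg)
    then show "Re (\<Sum>n. LINT x|particles n. F n x * cnj (F n x)) = 0 \<longleftrightarrow> fock_eq F (\<lambda>_ _. 0)"
      using F by (simp add: self fock_eq_def fock_rep_zero sqint_integral_zero_iff fock_rep_sqint)
  qed
  show "norm f = sqrt (inner f f)" by (simp add: norm_fock_def)
  show "sgn f = inverse (norm f) *\<^sub>R f" by (simp add: sgn_fock_def)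
  show "dist f g = norm (f - g)" by (simp add: dist_fock_def)
qed (simp_all add: uniformity_fock_def open_fock_def)

end

interpretation particles: product_sigma_finite "\<lambda>_ :: nat. halfline"
  by (rule product_sigma_finite.intro, rule sigma_finite_measure_restrict_space)
    (auto simp: lborel.sigma_finite_measure_axioms)

lemma AE_particles:
  assumes "AE y in halfline. Q y" "i < n"
  shows "AE x in particles n. Q (x i)"
proof -
  obtain N where N: "N \<in> null_sets halfline" "{y \<in> space halfline. \<not> Q y} \<subseteq> N"
    using assms(1) by (auto simp: eventually_ae_filter)
  define X where "X = (\<lambda>j. if j = i then N else space halfline)"
  have X: "X j \<in> sets halfline" for j
    using N(1) sets.top[of halfline] by (simp add: X_def null_sets_def)
  have "emeasure (particles n) (Pi\<^sub>E {..<n} X) = (\<Prod>j<n. emeasure halfline (X j))"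
    by (rule particles.emeasure_PiM) (auto simp: X)
  also have "\<dots> = 0"
    using N(1) assms(2) by (intro prod_zero) (auto simp: X_def null_sets_def)
  finally have "Pi\<^sub>E {..<n} X \<in> null_sets (particles n)"
    using sets_PiM_I_finite[of "{..<n}" X "\<lambda>_. halfline"] X by (simp add: null_sets_def)
  moreover have "{x \<in> space (particles n). \<not> Q (x i)} \<subseteq> Pi\<^sub>E {..<n} X"
  proof
    fix x assume x: "x \<in> {x \<in> space (particles n). \<not> Q (x i)}"
    then have sp: "x j \<in> space halfline" if "j < n" for j
      using that by (auto simp: space_PiM PiE_iff simp del: space_restrict_space2)
    then have "x i \<in> N" using x N(2) assms(2) by blast
    then show "x \<in> Pi\<^sub>E {..<n} X"
      using x sp unfolding X_def by (auto simp: space_PiM PiE_iff)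
  qed
  ultimately show ?thesis by (subst eventually_ae_filter) blast
qed

text \<open>Normalised by \<open>sqrt (fact n)\<close>, so that the inner product of the exponential vectors of
  \<open>\<xi>\<close> and \<open>\<eta>\<close> is \<open>exp (cinner \<xi> \<eta>)\<close>.\<close>

definition exp_rep :: "(real \<Rightarrow> complex) \<Rightarrow> nat \<Rightarrow> (nat \<Rightarrow> real) \<Rightarrow> complex" where
  "exp_rep f n x = (\<Prod>i<n. f (x i)) / of_real (sqrt (fact n))"

lemma fock_rep_exp:
  assumes f: "sqint halfline f"
  shows "fock_rep (exp_rep f)"
proof -
  have [measurable]: "f \<in> borel_measurable halfline" using f by (simp add: sqint_def)
  have sq: "(cmod (exp_rep f n x))\<^sup>2 = (\<Prod>i<n. (cmod (f (x i)))\<^sup>2) / fact n" for n x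
    by (simp add: exp_rep_def norm_divide power_divide prod_norm[symmetric] prod_power_distrib)
  have i: "integrable (particles n) (\<lambda>x. \<Prod>i<n. (cmod (f (x i)))\<^sup>2)" for n
    using f by (intro particles.product_integrable_prod) (auto simp: sqint_def)
  have I: "(LINT x|particles n. (\<Prod>i<n. (cmod (f (x i)))\<^sup>2)) = (LINT x|halfline. (cmod (f x))\<^sup>2) ^ n" for n
    using f by (subst particles.product_integral_prod) (auto simp: sqint_def)
  have meas: "exp_rep f n \<in> borel_measurable (particles n)" for n
    unfolding exp_rep_def by measurable
  have "summable (\<lambda>n. LINT x|particles n. (cmod (exp_rep f n x))\<^sup>2)"
    unfolding sq using summable_exp[of "LINT x|halfline. (cmod (f x))\<^sup>2"]
    by (simp add: I field_simps)
  moreover have "exp_rep f n (x \<circ> p) = exp_rep f n x" if "p permutes {..<n}" for n p x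
    unfolding exp_rep_def using prod.permute[OF that, of "\<lambda>i. f (x i)"] by (simp add: comp_def)
  moreover have "sqint (particles n) (exp_rep f n)" for n
    unfolding sqint_def sq using meas i by auto
  ultimately show ?thesis by (simp add: fock_rep_def)
qed

lift_definition expvec :: "l2 \<Rightarrow> fock" is exp_rep
proof -
  fix f g assume "l2_eq f g"
  then have fg: "sqint halfline f" "sqint halfline g" "AE x in halfline. f x = g x"
    by (auto simp: l2_eq_def)
  have "AE x in particles n. exp_rep f n x = exp_rep g n x" for n
  proof -
    have "AE x in particles n. \<forall>i\<in>{..<n}. f (x i) = g (x i)"
      using AE_particles[OF fg(3)] by (intro AE_finite_allI) auto
    then show ?thesis by eventually_elim (simp add: exp_rep_def)
  qed
  then show "fock_eq (exp_rep f) (exp_rep g)"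
    using fg by (simp add: fock_eq_def fock_rep_exp)
qed

lemma cinner_expvec: "cinner (expvec \<xi>) (expvec \<eta>) = exp (cinner \<xi> \<eta>)"
proof transfer
  fix f g assume "l2_eq f f" "l2_eq g g"
  then have fg: "sqint halfline f" "sqint halfline g" by (auto simp: l2_eq_def)
  define I where "I = (LINT x|halfline. f x * cnj (g x))"
  have r: "of_real (sqrt (fact n)) * of_real (sqrt (fact n)) = (fact n :: complex)" for n
    unfolding of_real_mult[symmetric] by simp
  have "(LINT x|particles n. exp_rep f n x * cnj (exp_rep g n x)) = I ^ n /\<^sub>R fact n" for n
  proof -
    have "exp_rep f n x * cnj (exp_rep g n x) = (\<Prod>i<n. f (x i) * cnj (g (x i))) / fact n" for x
      by (simp add: exp_rep_def prod.distrib cnj_prod r)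
    then have "(LINT x|particles n. exp_rep f n x * cnj (exp_rep g n x)) =
        (LINT x|particles n. (\<Prod>i<n. f (x i) * cnj (g (x i)))) / fact n"
      by simp
    also have "(LINT x|particles n. (\<Prod>i<n. f (x i) * cnj (g (x i)))) = I ^ n"
      using sqint_mult_integrable[OF fg] by (subst particles.product_integral_prod) (auto simp: I_def)
    finally show ?thesis by (simp add: scaleR_conv_of_real field_simps)
  qed
  then show "(\<Sum>n. LINT x|particles n. exp_rep f n x * cnj (exp_rep g n x)) =
      exp (LINT x|halfline. f x * cnj (g x))"
    by (simp add: exp_def I_def)
qed

section \<open>Bounded operators and Weyl operators\<close>

definition bop :: "('a::complex_inner \<Rightarrow> 'a) set" where
  "bop = {T. bounded_linear T \<and> (\<forall>c v. T (c *\<^sub>C v) = c *\<^sub>C T v)}"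

definition adj :: "('a::complex_inner \<Rightarrow> 'a) \<Rightarrow> 'a \<Rightarrow> 'a" where
  "adj T = (THE T'. T' \<in> bop \<and> (\<forall>v w. cinner (T v) w = cinner v (T' w)))"

text \<open>The $\sigma$-weak topology on the bounded operators is generated by the functionals
  $A \mapsto \sum_n \langle A v_n | w_n \rangle$ with square-summable \<open>v\<close>, \<open>w\<close>.\<close>

definition sigma_weak_topology :: "('a::complex_inner \<Rightarrow> 'a) topology" where
  "sigma_weak_topology = topology_generated_by
     {{A \<in> bop. (\<Sum>n. cinner (A (v n)) (w n)) \<in> U} | v w U.
        summable (\<lambda>n. (norm (v n))\<^sup>2) \<and> summable (\<lambda>n. (norm (w n))\<^sup>2) \<and> open U}"

definition unital_normal_star_endomorphism ::
  "(('a::complex_inner \<Rightarrow> 'a) \<Rightarrow> ('a \<Rightarrow> 'a)) \<Rightarrow> bool" where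
  "unital_normal_star_endomorphism \<theta> \<longleftrightarrow>
     (\<forall>A\<in>bop. \<theta> A \<in> bop)
   \<and> (\<forall>A\<in>bop. \<forall>B\<in>bop. \<theta> (\<lambda>v. A v + B v) = (\<lambda>v. \<theta> A v + \<theta> B v))
   \<and> (\<forall>c. \<forall>A\<in>bop. \<theta> (\<lambda>v. c *\<^sub>C A v) = (\<lambda>v. c *\<^sub>C \<theta> A v))
   \<and> (\<forall>A\<in>bop. \<forall>B\<in>bop. \<theta> (A \<circ> B) = \<theta> A \<circ> \<theta> B)
   \<and> (\<forall>A\<in>bop. \<theta> (adj A) = adj (\<theta> A))
   \<and> \<theta> id = id
   \<and> continuous_map sigma_weak_topology sigma_weak_topology \<theta>"

definition weyl :: "l2 \<Rightarrow> fock \<Rightarrow> fock" where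
  "weyl \<xi> = (THE T. T \<in> bop \<and> (\<forall>\<eta>. T (expvec \<eta>) =
     exp (- of_real ((norm \<xi>)\<^sup>2 / 2) - cinner \<eta> \<xi>) *\<^sub>C expvec (\<xi> + \<eta>)))"

section \<open>The CCR flow and its product system\<close>

text \<open>Only the values of \<open>\<alpha>\<close> at points of the cone \<open>P\<close> and at operators in \<^const>\<open>bop\<close> are
  relevant; there the conditions determine \<open>\<alpha>\<close> uniquely.\<close>

definition ccr_flow ::
  "(real^'d) set \<Rightarrow> (real^'d \<Rightarrow> l2 \<Rightarrow> l2) \<Rightarrow> (real^'d \<Rightarrow> (fock \<Rightarrow> fock) \<Rightarrow> (fock \<Rightarrow> fock)) \<Rightarrow> bool" where
  "ccr_flow P V \<alpha> \<longleftrightarrow>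
     (\<forall>x\<in>P. unital_normal_star_endomorphism (\<alpha> x))
   \<and> (\<forall>A\<in>bop. \<alpha> 0 A = A)
   \<and> (\<forall>x\<in>P. \<forall>y\<in>P. \<forall>A\<in>bop. \<alpha> (x + y) A = \<alpha> x (\<alpha> y A))
   \<and> (\<forall>A\<in>bop. \<forall>\<xi> \<eta>. continuous_on P (\<lambda>x. cinner (\<alpha> x A \<xi>) \<eta>))
   \<and> (\<forall>x\<in>P. \<forall>\<xi>. \<alpha> x (weyl \<xi>) = weyl (V x \<xi>))"

definition fibre ::
  "(real^'d \<Rightarrow> (fock \<Rightarrow> fock) \<Rightarrow> (fock \<Rightarrow> fock)) \<Rightarrow> real^'d \<Rightarrow> (fock \<Rightarrow> fock) set" where
  "fibre \<alpha> x = {T \<in> bop. \<forall>A\<in>bop. \<alpha> x A \<circ> T = T \<circ> A}"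

text \<open>\<open>twisted_mult l m a b S T\<close> is the product $S.T$ of \<open>S\<close> in the fibre over \<open>a\<close> and \<open>T\<close>
  in the fibre over \<open>b\<close>.\<close>

definition twisted_mult ::
  "real^'d \<Rightarrow> real^'d \<Rightarrow> real^'d \<Rightarrow> real^'d \<Rightarrow> (fock \<Rightarrow> fock) \<Rightarrow> (fock \<Rightarrow> fock) \<Rightarrow> (fock \<Rightarrow> fock)" where
  "twisted_mult l m a b S T = S \<circ> weyl ((l \<bullet> a) *\<^sub>R interval_ind (m \<bullet> b)) \<circ> T"

definition system_unit ::
  "(real^'d) set \<Rightarrow> (real^'d \<Rightarrow> (fock \<Rightarrow> fock) set)
   \<Rightarrow> (real^'d \<Rightarrow> real^'d \<Rightarrow> (fock \<Rightarrow> fock) \<Rightarrow> (fock \<Rightarrow> fock) \<Rightarrow> (fock \<Rightarrow> fock))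
   \<Rightarrow> (real^'d \<Rightarrow> fock \<Rightarrow> fock) \<Rightarrow> bool" where
  "system_unit P E pr u \<longleftrightarrow>
     (\<forall>a\<in>P. u a \<in> E a \<and> u a \<noteq> (\<lambda>_. 0))
   \<and> (\<forall>a\<in>P. \<forall>b\<in>P. pr a b (u a) (u b) = u (a + b))
   \<and> (\<forall>\<xi> \<eta>. (\<lambda>a. cinner (u a \<xi>) \<eta>) \<in> borel_measurable (restrict_space borel P))"

definition dual_interior :: "(real^'d) set \<Rightarrow> (real^'d) set" where
  "dual_interior P = {l. \<forall>x\<in>P - {0}. l \<bullet> x > 0}"

end

theory Submission
  imports Defs
begin

text \<open>
  An element of the fibre over \<open>a\<close> intertwines \<open>weyl \<xi>\<close> with \<open>weyl (shift t \<xi>)\<close>, where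
  \<open>t = m \<bullet> a\<close>. Two such intertwiners \<open>S\<close>, \<open>T\<close> have \<open>S\<^sup>* T\<close> in the commutant of the Weyl operators, so
  \<open>S\<^sup>* T\<close> is a scalar (\<open>weyl_invariant_form\<close>). By normality of the endomorphism, this implies that every
  bounded intertwiner lies in the fibre (\<open>weyl_intertwiner_in_fibre\<close>).

  Suppose that \<open>u\<close> is a unit and that \<open>a\<close>, \<open>b\<close> are nonzero points of the cone with \<open>m \<bullet> a = m \<bullet> b\<close>. Then
  \<open>u a\<close> and \<open>u b\<close> intertwine the same shift, and \<open>u a . u b = u (a + b) = u b . u a\<close>. Hence
  \<open>u a\<close> and \<open>u b\<close> are proportional and \<open>weyl ((l \<bullet> a) h)\<close> and \<open>weyl ((l \<bullet> b) h)\<close> agree on the range of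
  \<open>u b\<close>, where \<open>h\<close> is the indicator function of \<open>(0, m \<bullet> a)\<close> (\<open>twisted_commuting_intertwiners\<close>). Since
  \<open>weyl (n \<beta> h)\<close> tends weakly to \<open>0\<close> for \<open>\<beta> \<noteq> 0\<close>, a Weyl operator other than the identity fixes no
  nonzero vector (\<open>weyl_no_fixed_vector\<close>); hence \<open>l \<bullet> a = l \<bullet> b\<close>. So \<open>l\<close> is constant on the level sets
  of \<open>m\<close> in the cone, which forces \<open>l = c m\<close>.

  Conversely, if \<open>l = c m\<close>, the twist is undone by the ramp \<open>r t x = c x\<close> on \<open>(0, t)\<close>: it satisfies
  \<open>r (s + t) = r s + shift s (c s 1 + r t)\<close> with \<open>1\<close> the indicator function of \<open>(0, t)\<close> (\<open>ramp_add\<close>), so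
  the isometries \<open>expvec \<eta> \<mapsto> exp (- (norm (r t))\<^sup>2 / 2) expvec (r t + shift t \<eta>)\<close> with \<open>t = m \<bullet> a\<close> form
  a unit (\<open>ramp_unit_mult\<close>).

  The analytic foundation is that the Fock space is complete and that the exponential vectors span a
  dense subspace (\<open>span_dense_expvec\<close>), so that Weyl operators and other isometries can be defined by
  their values on exponential vectors.
\<close>

section \<open>Complex inner product spaces\<close>

lemma cinner_add_right: "cinner x (y + z) = cinner x y + cinner x (z :: 'a::complex_inner)"
  by (subst (1 2 3) cinner_commute) (simp add: cinner_add_left)

lemma cinner_scaleC_right: "cinner x (c *\<^sub>C y) = cnj c * cinner x (y :: 'a::complex_inner)"
  by (subst (1 2) cinner_commute) (simp add: cinner_scaleC_left)

lemma scaleR_scaleC: "r *\<^sub>R x = of_real r *\<^sub>C (x :: 'a::complex_inner)"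
  by (simp add: scaleC_of_real)

lemma scaleC_one [simp]: "1 *\<^sub>C x = (x :: 'a::complex_inner)"
  using scaleC_of_real[of 1 x] by simp

lemma scaleC_zero_left [simp]: "0 *\<^sub>C x = (0 :: 'a::complex_inner)"
  using scaleC_of_real[of 0 x] by simp

lemma scaleC_zero_right [simp]: "c *\<^sub>C 0 = (0 :: 'a::complex_inner)"
  using scaleC_add_right[of c 0 "0 :: 'a"] by simp

lemma scaleC_minus1: "(- 1) *\<^sub>C x = - (x :: 'a::complex_inner)"
  using scaleC_of_real[of "-1" x] by simp

lemma scaleC_minus_right: "c *\<^sub>C (- x) = - (c *\<^sub>C (x :: 'a::complex_inner))"
  by (simp add: scaleC_scaleC flip: scaleC_minus1)

lemma cinner_minus_left: "cinner (- x) y = - cinner x (y :: 'a::complex_inner)"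
  by (simp add: cinner_scaleC_left flip: scaleC_minus1)

lemma cinner_minus_right: "cinner x (- y) = - cinner x (y :: 'a::complex_inner)"
  by (simp add: cinner_scaleC_right flip: scaleC_minus1)

lemma cinner_diff_left: "cinner (x - y) z = cinner x z - cinner y (z :: 'a::complex_inner)"
  using cinner_add_left[of x "-y" z] by (simp add: cinner_minus_left)

lemma cinner_diff_right: "cinner z (x - y) = cinner z x - cinner z (y :: 'a::complex_inner)"
  using cinner_add_right[of z x "-y"] by (simp add: cinner_minus_right)

lemma cinner_zero_left [simp]: "cinner 0 x = 0" for x :: "'a::complex_inner"
  using cinner_scaleC_left[of 0 0 x] by simp

lemma cinner_zero_right [simp]: "cinner x 0 = 0" for x :: "'a::complex_inner"
  using cinner_scaleC_right[of x 0 0] by simp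

lemma cinner_scaleR_left: "cinner (r *\<^sub>R x) y = of_real r * cinner x (y :: 'a::complex_inner)"
  by (simp add: scaleR_scaleC cinner_scaleC_left)

lemma cinner_scaleR_right: "cinner x (r *\<^sub>R y) = of_real r * cinner x (y :: 'a::complex_inner)"
  by (simp add: scaleR_scaleC cinner_scaleC_right)

lemma cinner_sum_left: "cinner (\<Sum>i\<in>A. f i) y = (\<Sum>i\<in>A. cinner (f i) (y :: 'a::complex_inner))"
  by (induction A rule: infinite_finite_induct) (auto simp: cinner_add_left)

lemma cinner_sum_right: "cinner y (\<Sum>i\<in>A. f i) = (\<Sum>i\<in>A. cinner (y :: 'a::complex_inner) (f i))"
  by (induction A rule: infinite_finite_induct) (auto simp: cinner_add_right)

lemma cinner_self: "cinner x x = of_real ((norm x)\<^sup>2)" for x :: "'a::complex_inner"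
proof (rule complex_eqI)
  show "Re (cinner x x) = Re (of_real ((norm x)\<^sup>2))"
    using inner_eq_Re_cinner[of x x] by (simp add: power2_norm_eq_inner)
  have "Im (cinner x x) = - Im (cinner x x)"
    using arg_cong[OF cinner_commute[of x x], of Im] by simp
  then show "Im (cinner x x) = Im (of_real ((norm x)\<^sup>2))" by simp
qed

lemma cinner_self_eq_0 [simp]: "cinner x x = 0 \<longleftrightarrow> x = 0" for x :: "'a::complex_inner"
  by (simp add: cinner_self)

lemma norm_scaleC: "norm (c *\<^sub>C x) = cmod c * norm x" for x :: "'a::complex_inner"
proof -
  have "cinner (c *\<^sub>C x) (c *\<^sub>C x) = (c * cnj c) * cinner x x"
    by (simp add: cinner_scaleC_left cinner_scaleC_right)
  then have "complex_of_real ((norm (c *\<^sub>C x))\<^sup>2) = of_real ((cmod c * norm x)\<^sup>2)"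
    by (simp add: cinner_self power_mult_distrib flip: complex_norm_square)
  then have "(norm (c *\<^sub>C x))\<^sup>2 = (cmod c * norm x)\<^sup>2" by (simp only: of_real_eq_iff)
  then show ?thesis by (simp add: power2_eq_iff_nonneg)
qed

text \<open>Rotating \<open>x\<close> by the phase of \<open>cinner x y\<close> makes the complex inner product real, so the
  real Cauchy--Schwarz inequality applies.\<close>

lemma norm_cinner_le: "cmod (cinner x y) \<le> norm x * norm y" for x :: "'a::complex_inner"
proof (cases "cinner x y = 0")
  case False
  define c where "c = cnj (sgn (cinner x y))"
  have c: "cmod c = 1" using False by (simp add: c_def norm_sgn)
  have "c * cinner x y = of_real (cmod (cinner x y))"
    using False unfolding c_def sgn_eq
    by (simp add: complex_norm_square[symmetric] field_simps power2_eq_square mult.commute)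
  then have "cmod (cinner x y) = inner (c *\<^sub>C x) y"
    by (simp add: inner_eq_Re_cinner cinner_scaleC_left)
  also have "\<dots> \<le> norm (c *\<^sub>C x) * norm y" by (rule norm_cauchy_schwarz)
  finally show ?thesis by (simp add: norm_scaleC c)
qed simp

lemma bounded_bilinear_cinner: "bounded_bilinear (cinner :: 'a::complex_inner \<Rightarrow> 'a \<Rightarrow> complex)"
proof
  show "\<exists>K. \<forall>x y :: 'a. cmod (cinner x y) \<le> norm x * norm y * K"
    using norm_cinner_le by (intro exI[of _ 1]) auto
qed (auto simp: cinner_add_left cinner_add_right cinner_scaleR_left cinner_scaleR_right
       scaleR_conv_of_real)

lemmas tendsto_cinner = bounded_bilinear.tendsto[OF bounded_bilinear_cinner]

lemma cinner_eqI:
  assumes "\<And>z. cinner x z = cinner y z"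
  shows "x = (y :: 'a::complex_inner)"
  using assms[of "x - y"] cinner_self_eq_0[of "x - y"] by (simp add: cinner_diff_left)

subsection \<open>Bounded operators\<close>

lemma bopI:
  assumes "\<And>v w. T (v + w) = T v + T w" and "\<And>c v. T (c *\<^sub>C v) = c *\<^sub>C T v"
    and "\<And>v. norm (T v) \<le> norm v * K"
  shows "T \<in> (bop :: ('a::complex_inner \<Rightarrow> 'a) set)"
  unfolding bop_def using assms
  by (auto intro!: bounded_linear_intro[of T K] simp: scaleR_scaleC)

lemma
  assumes "T \<in> (bop :: ('a::complex_inner \<Rightarrow> 'a) set)"
  shows bop_bounded_linear: "bounded_linear T"
    and bop_add: "T (v + w) = T v + T w"
    and bop_diff: "T (v - w) = T v - T w"
    and bop_zero: "T 0 = 0"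
    and bop_scaleC: "T (c *\<^sub>C v) = c *\<^sub>C T v"
proof -
  show b: "bounded_linear T" and "T (c *\<^sub>C v) = c *\<^sub>C T v" using assms by (auto simp: bop_def)
  interpret bounded_linear T by (rule b)
  show "T (v + w) = T v + T w" "T (v - w) = T v - T w" "T 0 = 0" by (fact add diff zero)+
qed

lemma id_bop: "id \<in> (bop :: ('a::complex_inner \<Rightarrow> 'a) set)"
  by (rule bopI[of _ 1]) auto

lemma comp_bop: "S \<in> bop \<Longrightarrow> T \<in> bop \<Longrightarrow> S \<circ> T \<in> bop"
  unfolding bop_def using bounded_linear_compose[of S T] by (auto simp: comp_def)

lemma add_bop: "S \<in> bop \<Longrightarrow> T \<in> bop \<Longrightarrow> (\<lambda>v. S v + T v) \<in> bop"
  unfolding bop_def by (auto intro: bounded_linear_add simp: scaleC_add_right)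

lemma isometry_cinner:
  assumes T: "T \<in> bop" and n: "\<And>v. norm (T v) = norm (v :: 'a::complex_inner)"
  shows "cinner (T v) (T w) = cinner v w"
proof -
  have i: "inner (T v) (T w) = inner v w" for v w
    by (simp add: dot_norm bop_add[OF T, symmetric] n)
  have R: "Re (cinner (T v) (T w)) = Re (cinner v w)" for v w
    using i[of v w] by (simp add: inner_eq_Re_cinner)
  have "Re (cinner (\<i> *\<^sub>C T v) (T w)) = Re (cinner (\<i> *\<^sub>C v) w)"
    using R[of "\<i> *\<^sub>C v" w] by (simp add: bop_scaleC[OF T])
  with R[of v w] show ?thesis by (simp add: complex_eq_iff cinner_scaleC_left)
qed

definition csubspace :: "'a::complex_inner set \<Rightarrow> bool" where
  "csubspace Z \<longleftrightarrow> 0 \<in> Z \<and> (\<forall>v\<in>Z. \<forall>w\<in>Z. v + w \<in> Z) \<and> (\<forall>c. \<forall>v\<in>Z. c *\<^sub>C v \<in> Z)"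

subsection \<open>Adjoints\<close>

text \<open>A sequence in \<open>S\<close> that minimises the distance to \<open>v\<close> is Cauchy by the parallelogram law, and
  the difference of \<open>v\<close> and its limit is orthogonal to \<open>S\<close>.\<close>

lemma closed_subspace_orthogonal:
  fixes S :: "'a::{real_inner,complete_space} set"
  assumes S: "subspace S" "closed S" and v: "v \<notin> S"
  shows "\<exists>w. w \<noteq> 0 \<and> (\<forall>z\<in>S. inner w z = 0)"
proof -
  define q where "q x = (norm (v - x))\<^sup>2" for x
  define d where "d = Inf (q ` S)"
  have bdd: "bdd_below (q ` S)" by (auto intro: bdd_belowI[of _ 0] simp: q_def)
  have dq: "d \<le> q x" if "x \<in> S" for x unfolding d_def using bdd that by (auto intro: cInf_lower)
  have "\<exists>x\<in>S. q x < d + 1 / real (Suc n)" for n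
  proof -
    have "Inf (q ` S) < d + 1 / real (Suc n)" by (simp add: d_def)
    then show ?thesis
      using subspace_0[OF S(1)] by (subst (asm) cInf_less_iff) (use bdd in auto)
  qed
  then obtain x where xS: "\<And>n. x n \<in> S" and x: "\<And>n. q (x n) < d + 1 / real (Suc n)" by metis
  have par: "(norm (u - u'))\<^sup>2 \<le> 2 * (q u - d) + 2 * (q u' - d)" if u: "u \<in> S" "u' \<in> S" for u u'
  proof -
    have "(norm (u - u'))\<^sup>2 + 4 * q ((1/2) *\<^sub>R (u + u')) = 2 * q u + 2 * q u'"
      by (simp add: q_def power2_norm_eq_inner inner_add_left inner_add_right
          inner_diff_left inner_diff_right inner_commute algebra_simps)
    moreover have "(1/2) *\<^sub>R (u + u') \<in> S" using S(1) u by (intro subspace_scale subspace_add)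
    ultimately show ?thesis using dq[of "(1/2) *\<^sub>R (u + u')"] by simp
  qed
  have "Cauchy x"
  proof (rule metric_CauchyI)
    fix e :: real assume e: "0 < e"
    obtain N where N: "1 / real (Suc N) < e\<^sup>2 / 4"
      using nat_approx_posE[of "e\<^sup>2 / 4"] e by auto
    have "dist (x i) (x j) < e" if "i \<ge> N" "j \<ge> N" for i j
    proof -
      have "1 / real (Suc i) \<le> 1 / real (Suc N)" "1 / real (Suc j) \<le> 1 / real (Suc N)"
        using that by (auto simp: frac_le)
      then have "(norm (x i - x j))\<^sup>2 < e\<^sup>2"
        using par[OF xS xS, of i j] x[of i] x[of j] N by argo
      then show ?thesis using e by (simp add: dist_norm power_less_imp_less_base)
    qed
    then show "\<exists>N. \<forall>i\<ge>N. \<forall>j\<ge>N. dist (x i) (x j) < e" by blast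
  qed
  then obtain y where y: "x \<longlonglongrightarrow> y" using Cauchy_convergent convergent_def by blast
  have yS: "y \<in> S" using S(2) xS y unfolding closed_sequential_limits by blast
  have "(\<lambda>n. q (x n)) \<longlonglongrightarrow> q y"
    unfolding q_def by (intro tendsto_intros y)
  moreover have "(\<lambda>n. d + 1 / real (Suc n)) \<longlonglongrightarrow> d"
    using LIMSEQ_inverse_real_of_nat_add[of d] by (simp add: inverse_eq_divide)
  ultimately have qy: "q y \<le> d"
    by (rule LIMSEQ_le) (use x less_imp_le in blast)
  have "inner (v - y) z = 0" if z: "z \<in> S" for z
  proof -
    define b where "b = inner (v - y) z"
    have quad: "0 \<le> - 2 * r * b + r\<^sup>2 * (norm z)\<^sup>2" for r
    proof -
      have "y + r *\<^sub>R z \<in> S" using S(1) yS z by (intro subspace_scale subspace_add)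
      then have "(norm (v - y))\<^sup>2 \<le> (norm ((v - y) - r *\<^sub>R z))\<^sup>2"
        using order_trans[OF qy dq] by (simp add: q_def diff_diff_eq)
      also have "\<dots> = (norm (v - y))\<^sup>2 - 2 * r * b + r\<^sup>2 * (norm z)\<^sup>2"
        unfolding power2_norm_eq_inner power2_eq_square[of r] b_def
        by (simp add: inner_diff_left inner_diff_right inner_commute algebra_simps)
      finally show ?thesis by simp
    qed
    \<comment> \<open>a quadratic with no constant term that is nonnegative has no linear term\<close>
    define s where "s = 1 / (1 + (norm z)\<^sup>2)"
    have s: "0 < s" "s * (norm z)\<^sup>2 \<le> 1"
      unfolding s_def by (auto simp: field_simps add_pos_nonneg)
    have "0 \<le> - 2 * (s * b) * b + (s * b)\<^sup>2 * (norm z)\<^sup>2" by (rule quad)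
    also have "\<dots> = s * b\<^sup>2 * (s * (norm z)\<^sup>2 - 2)" by (simp add: algebra_simps power2_eq_square)
    also have "\<dots> \<le> s * b\<^sup>2 * (- 1)"
      using s by (intro mult_left_mono) auto
    finally have "b = 0" using s by (simp add: mult_le_0_iff zero_le_mult_iff)
    then show ?thesis by (simp add: b_def)
  qed
  moreover have "v - y \<noteq> 0" using v yS by auto
  ultimately show ?thesis by blast
qed

lemma riesz_real:
  fixes f :: "'a::{real_inner,complete_space} \<Rightarrow> real"
  assumes f: "bounded_linear f"
  shows "\<exists>y. \<forall>x. f x = inner y x"
proof (cases "\<forall>x. f x = 0")
  case False
  interpret f: bounded_linear f by fact
  obtain v where v: "f v \<noteq> 0" using False by blast
  have "subspace {x. f x = 0}" by (auto simp: subspace_def f.add f.scaleR f.zero)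
  moreover have "closed {x. f x = 0}"
    by (intro closed_Collect_eq f.continuous_on continuous_on_const continuous_on_id)
  ultimately obtain w where w: "w \<noteq> 0" "\<And>z. f z = 0 \<Longrightarrow> inner w z = 0"
    using closed_subspace_orthogonal[of "{x. f x = 0}" v] v by auto
  have fw: "f w \<noteq> 0" using w by (metis inner_eq_zero_iff)
  have "f x = inner ((f w / (norm w)\<^sup>2) *\<^sub>R w) x" for x
  proof -
    have "inner w (x - (f x / f w) *\<^sub>R w) = 0"
      using fw by (intro w) (simp add: f.diff f.scaleR)
    then show ?thesis
      using fw w(1) by (simp add: inner_diff_right power2_norm_eq_inner field_simps)
  qed
  then show ?thesis by blast
qed auto

lemma bop_norm_le:
  assumes "T \<in> bop" obtains K where "0 < K" "\<And>v. norm (T v) \<le> norm v * K"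
  using bounded_linear.pos_bounded[OF bop_bounded_linear[OF assms]] by blast

lemma adjoint_ex1:
  fixes T :: "'a::{complex_inner,complete_space} \<Rightarrow> 'a"
  assumes T: "T \<in> bop"
  shows "\<exists>!T'. T' \<in> bop \<and> (\<forall>v w. cinner (T v) w = cinner v (T' w))"
proof (rule ex_ex1I)
  obtain K where K: "0 < K" "\<And>v. norm (T v) \<le> norm v * K" using bop_norm_le[OF T] by blast
  have "\<exists>y. \<forall>v. cinner (T v) w = cinner v y" for w
  proof -
    have "bounded_linear (\<lambda>v. inner (T v) w)"
      using bounded_linear_compose[OF bounded_linear_inner_left bop_bounded_linear[OF T]] .
    then obtain y where y: "\<And>v. inner (T v) w = inner y v" using riesz_real by blast
    have R: "Re (cinner (T v) w) = Re (cinner v y)" for v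
      using y[of v] by (simp add: inner_commute flip: inner_eq_Re_cinner)
    have "cinner (T v) w = cinner v y" for v
      using R[of v] R[of "\<i> *\<^sub>C v"]
      by (simp add: bop_scaleC[OF T] cinner_scaleC_left complex_eq_iff)
    then show ?thesis by blast
  qed
  then obtain T' where T': "\<And>v w. cinner (T v) w = cinner v (T' w)" by metis
  have T'2: "cinner (T' w) v = cinner w (T v)" for v w
    by (subst (1 2) cinner_commute) (simp add: T')
  have "T' \<in> bop"
  proof (rule bopI)
    show "T' (v + w) = T' v + T' w" for v w
      by (rule cinner_eqI) (simp add: T'2 cinner_add_left)
    show "T' (c *\<^sub>C v) = c *\<^sub>C T' v" for c v
      by (rule cinner_eqI) (simp add: T'2 cinner_scaleC_left)
    fix v
    have "(norm (T' v))\<^sup>2 = cmod (cinner (T' v) (T' v))" by (simp add: cinner_self norm_power)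
    also have "\<dots> = cmod (cinner v (T (T' v)))" by (simp add: T'2)
    also have "\<dots> \<le> norm v * (norm (T' v) * K)"
      by (rule order_trans[OF norm_cinner_le]) (intro mult_left_mono K norm_ge_zero)
    finally have "norm (T' v) * norm (T' v) \<le> norm (T' v) * (norm v * K)"
      by (simp add: power2_eq_square mult.left_commute)
    then show "norm (T' v) \<le> norm v * K"
      using K(1) by (cases "norm (T' v) = 0") auto
  qed
  with T' show "\<exists>T'. T' \<in> bop \<and> (\<forall>v w. cinner (T v) w = cinner v (T' w))" by blast
next
  fix A B assume A: "A \<in> bop \<and> (\<forall>v w. cinner (T v) w = cinner v (A w))"
    and B: "B \<in> bop \<and> (\<forall>v w. cinner (T v) w = cinner v (B w))"
  show "A = B"
  proof
    fix w
    have "cinner (A w) z = cinner (B w) z" for z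
    proof -
      have "cinner z (A w) = cinner z (B w)" using A B by metis
      then show ?thesis by (subst (1 2) cinner_commute) simp
    qed
    then show "A w = B w" by (rule cinner_eqI)
  qed
qed

lemma
  fixes T :: "'a::{complex_inner,complete_space} \<Rightarrow> 'a"
  assumes "T \<in> bop"
  shows adj_bop: "adj T \<in> bop" and cinner_adj: "cinner (T v) w = cinner v (adj T w)"
  using theI'[OF adjoint_ex1[OF assms]] unfolding adj_def by blast+

lemma adj_eqI:
  fixes T :: "'a::{complex_inner,complete_space} \<Rightarrow> 'a"
  assumes "T \<in> bop" "T' \<in> bop" "\<And>v w. cinner (T v) w = cinner v (T' w)"
  shows "adj T = T'"
  unfolding adj_def by (rule the1_equality[OF adjoint_ex1[OF assms(1)]]) (use assms in blast)

subsection \<open>Isometric extension\<close>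

text \<open>Density of the linear span, phrased so that it is an induction principle.\<close>

definition span_dense :: "'a::complex_inner set \<Rightarrow> bool" where
  "span_dense X \<longleftrightarrow> (\<forall>Z. csubspace Z \<longrightarrow> closed Z \<longrightarrow> X \<subseteq> Z \<longrightarrow> Z = UNIV)"

lemma span_dense_induct [consumes 1, case_names base zero add scaleC lim]:
  assumes "span_dense X" and "\<And>x. x \<in> X \<Longrightarrow> Q x" and "Q 0"
    and "\<And>v w. Q v \<Longrightarrow> Q w \<Longrightarrow> Q (v + w)" and "\<And>c v. Q v \<Longrightarrow> Q (c *\<^sub>C v)"
    and "\<And>f v. (\<And>n. Q (f n)) \<Longrightarrow> f \<longlonglongrightarrow> v \<Longrightarrow> Q v"
  shows "Q v"
proof -
  have "closed {v. Q v}" unfolding closed_sequential_limits using assms(6) by blast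
  moreover have "csubspace {v. Q v}" using assms(3-5) by (auto simp: csubspace_def)
  ultimately have "{v. Q v} = UNIV" using assms(1,2) unfolding span_dense_def by blast
  then show ?thesis by blast
qed

lemma span_denseI:
  fixes X :: "'a::{complex_inner,complete_space} set"
  assumes X: "\<And>v. (\<And>x. x \<in> X \<Longrightarrow> cinner x v = 0) \<Longrightarrow> v = 0"
  shows "span_dense X"
  unfolding span_dense_def
proof (intro allI impI, rule ccontr)
  fix Z :: "'a set" assume Z: "csubspace Z" "closed Z" "X \<subseteq> Z" "Z \<noteq> UNIV"
  then obtain v where "v \<notin> Z" by blast
  moreover have "subspace Z"
    using Z(1) by (auto simp: csubspace_def subspace_def scaleR_scaleC)
  ultimately obtain w where w: "w \<noteq> 0" "\<And>z. z \<in> Z \<Longrightarrow> inner w z = 0"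
    using closed_subspace_orthogonal Z(2) by blast
  have "cinner z w = 0" if z: "z \<in> Z" for z
  proof -
    have "inner z w = 0" "inner (\<i> *\<^sub>C z) w = 0"
      using w(2)[of z] w(2)[of "\<i> *\<^sub>C z"] z Z(1) by (auto simp: csubspace_def inner_commute)
    then show ?thesis by (simp add: inner_eq_Re_cinner cinner_scaleC_left complex_eq_iff)
  qed
  then have "w = 0" using Z(3) by (intro X) auto
  with w(1) show False by simp
qed

lemma cinner_eq_0_on_span_dense:
  assumes X: "span_dense X" and v: "\<And>x. x \<in> X \<Longrightarrow> cinner x v = 0"
  shows "v = 0"
proof -
  have "cinner v v = 0"
    using X
  proof (induction v rule: span_dense_induct[where Q = "\<lambda>u. cinner u v = 0"])
    case (lim f u)
    have "(\<lambda>n. cinner (f n) v) \<longlonglongrightarrow> cinner u v" by (intro tendsto_cinner lim tendsto_const)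
    then show ?case using lim(1) by (simp add: LIMSEQ_const_iff)
  qed (simp_all add: v cinner_add_left cinner_scaleC_left)
  then show ?thesis by simp
qed

lemma bop_eq_on_span_dense:
  assumes X: "span_dense X" and S: "S \<in> bop" and T: "T \<in> bop" and eq: "\<And>x. x \<in> X \<Longrightarrow> S x = T x"
  shows "S = T"
proof
  fix v show "S v = T v"
    using X
  proof (induction v rule: span_dense_induct)
    case (lim f v)
    have 1: "(\<lambda>n. T (f n)) \<longlonglongrightarrow> S v"
      using bounded_linear.tendsto[OF bop_bounded_linear[OF S] lim(2)] lim(1) by simp
    have 2: "(\<lambda>n. T (f n)) \<longlonglongrightarrow> T v"
      by (rule bounded_linear.tendsto[OF bop_bounded_linear[OF T] lim(2)])
    show ?case using 1 2 by (rule LIMSEQ_unique)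
  qed (simp_all add: eq bop_zero[OF S] bop_zero[OF T] bop_add[OF S] bop_add[OF T]
         bop_scaleC[OF S] bop_scaleC[OF T])
qed

text \<open>The closure of the linear span of the pairs \<open>(X i, Y i)\<close> is the graph of the operator: all
  its elements \<open>(v, w)\<close> satisfy \<open>norm v = norm w\<close>, which makes it single-valued, and makes its
  first projection closed.\<close>

lemma isometric_extension:
  fixes X Y :: "'i \<Rightarrow> 'a::{complex_inner,complete_space}"
  assumes tot: "span_dense (range X)" and gram: "\<And>i j. cinner (Y i) (Y j) = cinner (X i) (X j)"
  shows "\<exists>T\<in>bop. (\<forall>i. T (X i) = Y i) \<and> (\<forall>v. norm (T v) = norm v)"
proof -
  define comb where "comb Z S c = (\<Sum>i\<in>S. c i *\<^sub>C Z i)" for Z :: "'i \<Rightarrow> 'a" and S c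
  define G where "G = {(comb X S c, comb Y S c) | S c. finite S}"
  define H where "H = closure G"
  have nG: "norm v = norm w" if vw: "(v, w) \<in> G" for v w
  proof -
    obtain S c where Sc: "v = comb X S c" "w = comb Y S c" using vw unfolding G_def by blast
    have "cinner w w = cinner v v"
      by (simp add: Sc comb_def cinner_sum_left cinner_sum_right cinner_scaleC_left
          cinner_scaleC_right gram)
    then show ?thesis by (simp only: cinner_self of_real_eq_iff) simp
  qed
  have G_mem: "(X i, Y i) \<in> G" for i
    unfolding G_def mem_Collect_eq
    by (rule exI[of _ "{i}"], rule exI[of _ "\<lambda>_. 1"]) (simp add: comb_def)
  have G_zero: "(0, 0) \<in> G"
    unfolding G_def mem_Collect_eq by (rule exI[of _ "{}"]) (simp add: comb_def)
  have G_add: "(v + v', w + w') \<in> G" if vw: "(v, w) \<in> G" "(v', w') \<in> G" for v w v' w'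
  proof -
    obtain S c where 1: "finite S" "v = comb X S c" "w = comb Y S c" using vw unfolding G_def by blast
    obtain S' c' where 2: "finite S'" "v' = comb X S' c'" "w' = comb Y S' c'"
      using vw unfolding G_def by blast
    define d where "d i = (if i \<in> S then c i else 0) + (if i \<in> S' then c' i else 0)" for i
    have "comb Z (S \<union> S') d = comb Z S c + comb Z S' c'" for Z
    proof -
      have "comb Z (S \<union> S') d = (\<Sum>i\<in>S \<union> S'. if i \<in> S then c i *\<^sub>C Z i else 0)
          + (\<Sum>i\<in>S \<union> S'. if i \<in> S' then c' i *\<^sub>C Z i else 0)"
        unfolding comb_def sum.distrib[symmetric]
        by (intro sum.cong) (auto simp: d_def scaleC_add_left)
      also have "\<dots> = comb Z S c + comb Z S' c'"
        unfolding comb_def using 1(1) 2(1)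
        by (simp add: sum.If_cases Int_absorb1 Int_commute inf_sup_absorb)
      finally show ?thesis .
    qed
    then show ?thesis
      unfolding G_def mem_Collect_eq using 1 2
      by (intro exI[of _ "S \<union> S'"] exI[of _ d]) simp
  qed
  have G_scale: "(a *\<^sub>C v, a *\<^sub>C w) \<in> G" if vw: "(v, w) \<in> G" for a v w
  proof -
    obtain S c where 1: "finite S" "v = comb X S c" "w = comb Y S c" using vw unfolding G_def by blast
    have s: "a *\<^sub>C (\<Sum>i\<in>S. f i) = (\<Sum>i\<in>S. a *\<^sub>C f i)" for f :: "'i \<Rightarrow> 'a"
      by (induction S rule: infinite_finite_induct) (auto simp: scaleC_add_right)
    show ?thesis
      unfolding G_def mem_Collect_eq using 1
      by (intro exI[of _ S] exI[of _ "\<lambda>i. a * c i"]) (simp add: comb_def s scaleC_scaleC)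
  qed
  have H_seq: "(v, w) \<in> H \<longleftrightarrow> (\<exists>f g. (\<forall>n::nat. (f n, g n) \<in> G) \<and> f \<longlonglongrightarrow> v \<and> g \<longlonglongrightarrow> w)" for v w
  proof
    assume "(v, w) \<in> H"
    then obtain h where h: "\<And>n::nat. h n \<in> G" "h \<longlonglongrightarrow> (v, w)"
      unfolding H_def closure_sequential by blast
    then show "\<exists>f g. (\<forall>n::nat. (f n, g n) \<in> G) \<and> f \<longlonglongrightarrow> v \<and> g \<longlonglongrightarrow> w"
      using tendsto_fst[OF h(2)] tendsto_snd[OF h(2)]
      by (intro exI[of _ "fst \<circ> h"] exI[of _ "snd \<circ> h"]) (simp add: comp_def)
  next
    assume "\<exists>f g. (\<forall>n::nat. (f n, g n) \<in> G) \<and> f \<longlonglongrightarrow> v \<and> g \<longlonglongrightarrow> w"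
    then show "(v, w) \<in> H" unfolding H_def closure_sequential using tendsto_Pair by fast
  qed
  have H_add: "(v + v', w + w') \<in> H" if vw: "(v, w) \<in> H" "(v', w') \<in> H" for v w v' w'
  proof -
    obtain f g where "\<And>n::nat. (f n, g n) \<in> G" "f \<longlonglongrightarrow> v" "g \<longlonglongrightarrow> w" using vw H_seq by blast
    moreover obtain f' g' where "\<And>n::nat. (f' n, g' n) \<in> G" "f' \<longlonglongrightarrow> v'" "g' \<longlonglongrightarrow> w'"
      using vw H_seq by blast
    ultimately show ?thesis unfolding H_seq
      by (intro exI[of _ "\<lambda>n. f n + f' n"] exI[of _ "\<lambda>n. g n + g' n"]) (auto intro: G_add tendsto_add)
  qed
  have tendsto_scaleC: "(\<lambda>n. a *\<^sub>C f n) \<longlonglongrightarrow> a *\<^sub>C v" if fv: "f \<longlonglongrightarrow> v" for a f and v :: 'a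
    by (rule bounded_linear.tendsto[OF bop_bounded_linear fv])
      (rule bopI[of _ "cmod a"], auto simp: scaleC_add_right scaleC_scaleC norm_scaleC mult.commute)
  have H_scale: "(a *\<^sub>C v, a *\<^sub>C w) \<in> H" if vw: "(v, w) \<in> H" for a v w
  proof -
    obtain f g where "\<And>n::nat. (f n, g n) \<in> G" "f \<longlonglongrightarrow> v" "g \<longlonglongrightarrow> w" using vw H_seq by blast
    then show ?thesis unfolding H_seq
      by (intro exI[of _ "\<lambda>n. a *\<^sub>C f n"] exI[of _ "\<lambda>n. a *\<^sub>C g n"]) (auto intro: G_scale tendsto_scaleC)
  qed
  have nH: "norm v = norm w" if vw: "(v, w) \<in> H" for v w
  proof -
    obtain f g where fg: "\<And>n::nat. (f n, g n) \<in> G" "f \<longlonglongrightarrow> v" "g \<longlonglongrightarrow> w" using vw H_seq by blast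
    have "(\<lambda>n. norm (f n)) \<longlonglongrightarrow> norm v" "(\<lambda>n. norm (f n)) \<longlonglongrightarrow> norm w"
      using tendsto_norm[OF fg(2)] tendsto_norm[OF fg(3)] nG[OF fg(1)] by simp_all
    then show ?thesis by (rule LIMSEQ_unique)
  qed
  have H_diff: "(v - v', w - w') \<in> H" if vw: "(v, w) \<in> H" "(v', w') \<in> H" for v w v' w'
    using H_add[OF vw(1) H_scale[OF vw(2), of "-1"]] by (simp add: scaleC_minus1)
  have ex: "\<exists>w. (v, w) \<in> H" for v
    using tot
  proof (induction v rule: span_dense_induct)
    case (base x)
    then show ?case using G_mem closure_subset[of G] by (auto simp: H_def)
  next
    case zero
    then show ?case using G_zero closure_subset[of G] by (auto simp: H_def)
  next
    case (add v w)
    then show ?case using H_add by blast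
  next
    case (scaleC c v)
    then show ?case using H_scale by blast
  next
    case (lim f v)
    then obtain g where g: "\<And>n. (f n, g n) \<in> H" by metis
    have "dist (g i) (g j) = dist (f i) (f j)" for i j
      using nH[OF H_diff[OF g[of i] g[of j]]] by (simp add: dist_norm)
    then have "Cauchy g" using LIMSEQ_imp_Cauchy[OF lim(2)] by (simp add: Cauchy_def)
    then obtain w where w: "g \<longlonglongrightarrow> w" using Cauchy_convergent convergent_def by blast
    have "closed H" by (simp add: H_def)
    moreover have "(\<lambda>n. (f n, g n)) \<longlonglongrightarrow> (v, w)" using lim(2) w by (rule tendsto_Pair)
    ultimately have "(v, w) \<in> H" 
      unfolding closed_sequential_limits using g by (elim allE[of _ "\<lambda>n. (f n, g n)"]) blast
    then show ?case ..
  qed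
  then obtain T where T: "\<And>v. (v, T v) \<in> H" by metis
  have uni: "w = w'" if vw: "(v, w) \<in> H" "(v, w') \<in> H" for v w w'
    using nH[OF H_diff[OF vw]] by simp
  have "T \<in> bop"
  proof (rule bopI[of _ 1])
    show "T (v + w) = T v + T w" for v w using uni[OF T H_add[OF T T]] .
    show "T (c *\<^sub>C v) = c *\<^sub>C T v" for c v using uni[OF T H_scale[OF T]] .
    show "norm (T v) \<le> norm v * 1" for v using nH[OF T[of v]] by simp
  qed
  moreover have "T (X i) = Y i" for i
    using uni[OF T] G_mem closure_subset[of G] by (auto simp: H_def)
  ultimately show ?thesis using nH[OF T, symmetric] by blast
qed

section \<open>Completeness of the Fock space\<close>

text \<open>The increments \<open>d k\<close> satisfy \<open>\<bar>d k\<bar> \<le> (1/2)^k + 2^k * \<bar>d k\<bar>\<^sup>2\<close>, and the last terms are almost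
  everywhere summable because their integrals are.\<close>

lemma AE_convergent_if_fast_Cauchy:
  assumes F: "\<And>k. sqint M (F k)"
    and fast: "\<And>k. (LINT x|M. (cmod (F (Suc k) x - F k x))\<^sup>2) \<le> (1/8) ^ k"
  shows "AE x in M. convergent (\<lambda>k. F k x)"
proof -
  define d where "d k x = F (Suc k) x - F k x" for k x
  have d: "sqint M (d k)" for k unfolding d_def using F by (intro sqint_diff)
  have [measurable]: "d k \<in> borel_measurable M" for k using d by (simp add: sqint_def)
  have "(\<integral>\<^sup>+x. (\<Sum>k. ennreal (2 ^ k * (cmod (d k x))\<^sup>2)) \<partial>M)
      = (\<Sum>k. \<integral>\<^sup>+x. ennreal (2 ^ k * (cmod (d k x))\<^sup>2) \<partial>M)"
    by (rule nn_integral_suminf) simp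
  also have "\<dots> \<le> (\<Sum>k. ennreal ((1/4) ^ k))"
  proof (rule suminf_le)
    fix k
    have "(\<integral>\<^sup>+x. ennreal (2 ^ k * (cmod (d k x))\<^sup>2) \<partial>M) = ennreal (LINT x|M. 2 ^ k * (cmod (d k x))\<^sup>2)"
      using d[of k] by (intro nn_integral_eq_integral) (auto simp: sqint_def)
    also have "\<dots> \<le> ennreal (2 ^ k * (1/8) ^ k)"
      using fast[of k] by (intro ennreal_leI) (simp add: d_def)
    also have "(2::real) ^ k * (1/8) ^ k = (1/4) ^ k" by (simp flip: power_mult_distrib)
    finally show "(\<integral>\<^sup>+x. ennreal (2 ^ k * (cmod (d k x))\<^sup>2) \<partial>M) \<le> ennreal ((1/4) ^ k)" .
  qed auto
  also have "\<dots> = ennreal (\<Sum>k. (1/4) ^ k)"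
    by (rule suminf_ennreal2) (auto intro: summable_geometric)
  finally have "(\<integral>\<^sup>+x. (\<Sum>k. ennreal (2 ^ k * (cmod (d k x))\<^sup>2)) \<partial>M) \<noteq> \<infinity>"
    using le_less_trans[OF _ ennreal_less_top] by fastforce
  then have "AE x in M. (\<Sum>k. ennreal (2 ^ k * (cmod (d k x))\<^sup>2)) \<noteq> \<infinity>"
    by (intro nn_integral_PInf_AE) auto
  then show ?thesis
  proof eventually_elim
    case (elim x)
    then have s: "summable (\<lambda>k. 2 ^ k * (cmod (d k x))\<^sup>2)"
      by (intro summable_suminf_not_top) auto
    have "summable (\<lambda>k. d k x)"
    proof (rule summable_comparison_test)
      show "summable (\<lambda>k. (1/2) ^ k + 2 ^ k * (cmod (d k x))\<^sup>2)"
        by (intro summable_add s summable_geometric) simp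
      have "norm (d k x) \<le> (1/2) ^ k + 2 ^ k * (cmod (d k x))\<^sup>2" for k
      proof -
        have "0 \<le> (1 - 2 ^ k * cmod (d k x))\<^sup>2" by simp
        then have "2 * (2 ^ k * cmod (d k x)) \<le> 1 + (2 ^ k)\<^sup>2 * (cmod (d k x))\<^sup>2"
          unfolding power2_diff power_mult_distrib by simp
        moreover have "0 \<le> 2 ^ k * cmod (d k x)" by simp
        ultimately have "2 ^ k * cmod (d k x) \<le> 1 + (2 ^ k)\<^sup>2 * (cmod (d k x))\<^sup>2"
          by linarith
        then have "(1/2) ^ k * (2 ^ k * cmod (d k x)) \<le> (1/2) ^ k * (1 + (2 ^ k)\<^sup>2 * (cmod (d k x))\<^sup>2)"
          by (rule mult_left_mono) simp
        also have "(1/2) ^ k * (2 ^ k * cmod (d k x)) = cmod (d k x)"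
          by (simp add: power_one_over)
        also have "(1/2) ^ k * (1 + (2 ^ k)\<^sup>2 * (cmod (d k x))\<^sup>2) = (1/2) ^ k + 2 ^ k * (cmod (d k x))\<^sup>2"
          by (simp add: power_one_over field_simps power2_eq_square)
        finally show ?thesis by simp
      qed
      then show "\<exists>N. \<forall>k\<ge>N. norm (d k x) \<le> (1/2) ^ k + 2 ^ k * (cmod (d k x))\<^sup>2" by blast
    qed
    then have "convergent (\<lambda>n. \<Sum>k<n. d k x)" by (simp add: summable_iff_convergent)
    moreover have "(\<Sum>k<n. d k x) = F n x - F 0 x" for n
      unfolding d_def by (rule sum_lessThan_telescope)
    ultimately have "convergent (\<lambda>n. F n x - F 0 x)" by simp
    then have "convergent (\<lambda>n. (F n x - F 0 x) + F 0 x)" by (intro convergent_add convergent_const)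
    then show ?case by simp
  qed
qed

lemma fock_rep_rep_fock: "fock_rep (rep_fock v)"
  using Quotient3_rep_reflp[OF Quotient3_fock] by simp

lemma abs_rep_fock [simp]: "abs_fock (rep_fock v) = v"
  by (rule Quotient3_abs_rep[OF Quotient3_fock])

lemma cinner_abs_fock:
  "fock_rep F \<Longrightarrow> fock_rep G \<Longrightarrow>
    cinner (abs_fock F) (abs_fock G) = (\<Sum>n. LINT x|particles n. F n x * cnj (G n x))"
  by (rule cinner_fock.abs_eq) simp_all

lemma minus_abs_fock:
  "fock_rep F \<Longrightarrow> fock_rep G \<Longrightarrow> abs_fock F - abs_fock G = abs_fock (\<lambda>n x. F n x - G n x)"
  by (rule minus_fock.abs_eq) simp_all

lemma norm_abs_fock:
  assumes F: "fock_rep F"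
  shows "(norm (abs_fock F))\<^sup>2 = (\<Sum>n. LINT x|particles n. (cmod (F n x))\<^sup>2)"
proof -
  have "of_real ((norm (abs_fock F))\<^sup>2) = (\<Sum>n. complex_of_real (LINT x|particles n. (cmod (F n x))\<^sup>2))"
    using cinner_abs_fock[OF F F] by (simp add: cinner_integral_self cinner_self)
  also have "\<dots> = of_real (\<Sum>n. LINT x|particles n. (cmod (F n x))\<^sup>2)"
    using F by (intro suminf_of_real[symmetric]) (simp add: fock_rep_def)
  finally show ?thesis by (simp only: of_real_eq_iff)
qed

lemma nn_norm_abs_fock:
  assumes F: "fock_rep F"
  shows "(\<Sum>n. \<integral>\<^sup>+x. ennreal ((cmod (F n x))\<^sup>2) \<partial>particles n) = ennreal ((norm (abs_fock F))\<^sup>2)"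
proof -
  have "(\<integral>\<^sup>+x. ennreal ((cmod (F n x))\<^sup>2) \<partial>particles n) = ennreal (LINT x|particles n. (cmod (F n x))\<^sup>2)" for n
    using fock_rep_sqint[OF F, of n] by (intro nn_integral_eq_integral) (auto simp: sqint_def)
  then show ?thesis
    using F unfolding norm_abs_fock[OF F]
    by (simp add: fock_rep_def suminf_ennreal2 Bochner_Integration.integral_nonneg)
qed

lemma component_norm_le:
  assumes F: "fock_rep F"
  shows "(LINT x|particles n. (cmod (F n x))\<^sup>2) \<le> (norm (abs_fock F))\<^sup>2"
proof -
  have "(\<Sum>k\<in>{n}. LINT x|particles k. (cmod (F k x))\<^sup>2) \<le> (\<Sum>k. LINT x|particles k. (cmod (F k x))\<^sup>2)"
    using F by (intro sum_le_suminf) (auto simp: fock_rep_def Bochner_Integration.integral_nonneg)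
  then show ?thesis by (simp add: norm_abs_fock[OF F])
qed

lemma fock_repI:
  assumes meas: "\<And>n. F n \<in> borel_measurable (particles n)"
    and sym: "\<And>n p. p permutes {..<n} \<Longrightarrow> AE x in particles n. F n (x \<circ> p) = F n x"
    and fin: "(\<Sum>n. \<integral>\<^sup>+x. ennreal ((cmod (F n x))\<^sup>2) \<partial>particles n) \<noteq> \<infinity>"
  shows "fock_rep F"
proof -
  have "(\<integral>\<^sup>+x. ennreal ((cmod (F n x))\<^sup>2) \<partial>particles n) \<le> (\<Sum>n. \<integral>\<^sup>+x. ennreal ((cmod (F n x))\<^sup>2) \<partial>particles n)" for n
    using sum_le_suminf[of "\<lambda>n. \<integral>\<^sup>+x. ennreal ((cmod (F n x))\<^sup>2) \<partial>particles n" "{n}"] by simp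
  from le_less_trans[OF this] have f: "(\<integral>\<^sup>+x. ennreal ((cmod (F n x))\<^sup>2) \<partial>particles n) < \<infinity>" for n
    using fin by (simp add: less_top)
  have sq: "sqint (particles n) (F n)" for n
    unfolding sqint_def using meas[of n] f[of n] by (auto intro!: integrableI_bounded)
  have "(\<integral>\<^sup>+x. ennreal ((cmod (F n x))\<^sup>2) \<partial>particles n) = ennreal (LINT x|particles n. (cmod (F n x))\<^sup>2)" for n
    using sq[of n] by (intro nn_integral_eq_integral) (auto simp: sqint_def)
  then have "summable (\<lambda>n. LINT x|particles n. (cmod (F n x))\<^sup>2)"
    using fin by (intro summable_suminf_not_top) (auto simp: Bochner_Integration.integral_nonneg)
  then show ?thesis using sq sym by (simp add: fock_rep_def)
qed

text \<open>In each particle number a fast Cauchy sequence converges almost everywhere; the pointwise limit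
  is symmetric, and Fatou's lemma, applied to the integral and to the sum over the particle numbers,
  shows that it is also the limit in norm.\<close>

lemma fast_Cauchy_fock_convergent:
  fixes Y :: "nat \<Rightarrow> fock"
  assumes fast: "\<And>i j. i \<le> j \<Longrightarrow> (norm (Y i - Y j))\<^sup>2 \<le> (1/8) ^ i"
  shows "convergent Y"
proof -
  define F where "F k = rep_fock (Y k)" for k
  have F: "fock_rep (F k)" and Y: "Y k = abs_fock (F k)" for k
    by (simp_all add: F_def fock_rep_rep_fock)
  have [measurable]: "F k n \<in> borel_measurable (particles n)" for k n
    using fock_rep_sqint[OF F] by (simp add: sqint_def)
  have FF: "fock_rep (\<lambda>n x. F i n x - F j n x)" for i j using F by (intro fock_rep_diff)
  have conv: "AE x in particles n. convergent (\<lambda>k. F k n x)" for n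
  proof (rule AE_convergent_if_fast_Cauchy)
    show "sqint (particles n) (F k n)" for k by (rule fock_rep_sqint[OF F])
    show "(LINT x|particles n. (cmod (F (Suc k) n x - F k n x))\<^sup>2) \<le> (1/8) ^ k" for k
      using component_norm_le[OF FF[of k "Suc k"], of n] fast[of k "Suc k"]
      by (simp add: Y minus_abs_fock[OF F F] norm_minus_commute)
  qed
  define G where "G n x = lim (\<lambda>k. F k n x)" for n x
  have [measurable]: "G n \<in> borel_measurable (particles n)" for n
    unfolding G_def by measurable
  have symG: "AE x in particles n. G n (x \<circ> p) = G n x" if p: "p permutes {..<n}" for n p
  proof -
    have "AE x in particles n. F k n (x \<circ> p) = F k n x" for k
      using F[of k] p by (simp add: fock_rep_def)
    then have "AE x in particles n. \<forall>k. F k n (x \<circ> p) = F k n x" by (simp add: AE_all_countable)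
    then show ?thesis by eventually_elim (simp add: G_def)
  qed
  have bound: "(\<Sum>n. \<integral>\<^sup>+x. ennreal ((cmod (F i n x - G n x))\<^sup>2) \<partial>particles n) \<le> ennreal ((1/8) ^ i)" for i
  proof -
    define I where "I k n = (\<integral>\<^sup>+x. ennreal ((cmod (F i n x - F k n x))\<^sup>2) \<partial>particles n)" for k n
    have "(\<integral>\<^sup>+x. ennreal ((cmod (F i n x - G n x))\<^sup>2) \<partial>particles n) \<le> liminf (\<lambda>k. I k n)" for n
    proof -
      have "AE x in particles n. ennreal ((cmod (F i n x - G n x))\<^sup>2)
          = liminf (\<lambda>k. ennreal ((cmod (F i n x - F k n x))\<^sup>2))"
        using conv[of n]
      proof eventually_elim
        case (elim x)
        then have "(\<lambda>k. F k n x) \<longlonglongrightarrow> G n x" by (simp add: G_def convergent_LIMSEQ_iff)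
        then have "(\<lambda>k. ennreal ((cmod (F i n x - F k n x))\<^sup>2)) \<longlonglongrightarrow> ennreal ((cmod (F i n x - G n x))\<^sup>2)"
          by (intro tendsto_intros)
        from lim_imp_Liminf[OF _ this] show ?case by simp
      qed
      then have "(\<integral>\<^sup>+x. ennreal ((cmod (F i n x - G n x))\<^sup>2) \<partial>particles n)
          = (\<integral>\<^sup>+x. liminf (\<lambda>k. ennreal ((cmod (F i n x - F k n x))\<^sup>2)) \<partial>particles n)"
        by (rule nn_integral_cong_AE)
      also have "\<dots> \<le> liminf (\<lambda>k. I k n)"
        unfolding I_def by (rule nn_integral_liminf) simp
      finally show ?thesis .
    qed
    then have "(\<Sum>n. \<integral>\<^sup>+x. ennreal ((cmod (F i n x - G n x))\<^sup>2) \<partial>particles n) \<le> (\<Sum>n. liminf (\<lambda>k. I k n))"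
      by (intro suminf_le) auto
    also have "\<dots> = (\<integral>\<^sup>+n. liminf (\<lambda>k. I k n) \<partial>count_space UNIV)"
      by (simp add: nn_integral_count_space_nat)
    also have "\<dots> \<le> liminf (\<lambda>k. \<integral>\<^sup>+n. I k n \<partial>count_space UNIV)"
      by (rule nn_integral_liminf) simp
    also have "\<dots> = liminf (\<lambda>k. \<Sum>n. I k n)" by (simp add: nn_integral_count_space_nat)
    also have "\<dots> = liminf (\<lambda>k. ennreal ((norm (Y i - Y k))\<^sup>2))"
      unfolding I_def by (simp add: nn_norm_abs_fock[OF FF] Y minus_abs_fock[OF F F])
    also have "\<dots> \<le> liminf (\<lambda>k. ennreal ((1/8) ^ i))"
      by (intro Liminf_mono eventually_sequentiallyI[of i] ennreal_leI fast)
    finally show ?thesis by (simp add: Liminf_const)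
  qed
  have FG: "fock_rep (\<lambda>n x. F i n x - G n x)" for i
  proof (rule fock_repI)
    show "AE x in particles n. F i n (x \<circ> p) - G n (x \<circ> p) = F i n x - G n x"
      if p: "p permutes {..<n}" for n p
    proof -
      have "AE x in particles n. F i n (x \<circ> p) = F i n x" using F[of i] p by (simp add: fock_rep_def)
      with symG[OF p] show ?thesis by eventually_elim simp
    qed
    show "(\<Sum>n. \<integral>\<^sup>+x. ennreal ((cmod (F i n x - G n x))\<^sup>2) \<partial>particles n) \<noteq> \<infinity>"
      using bound[of i] by (auto simp: top_unique)
  qed simp
  have G: "fock_rep G" using fock_rep_diff[OF F FG, of 0 0] by simp
  have nYG: "(norm (Y i - abs_fock G))\<^sup>2 \<le> (1/8) ^ i" for i
  proof -
    have "ennreal ((norm (Y i - abs_fock G))\<^sup>2) \<le> ennreal ((1/8) ^ i)"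
      using bound[of i] by (simp add: nn_norm_abs_fock[OF FG] Y minus_abs_fock[OF F G])
    then show ?thesis by (simp add: ennreal_le_iff)
  qed
  have "(\<lambda>i. (norm (Y i - abs_fock G))\<^sup>2) \<longlonglongrightarrow> 0"
    by (rule tendsto_sandwich[OF _ _ tendsto_const LIMSEQ_realpow_zero[of "1/8"]])
      (auto simp: nYG)
  then have "(\<lambda>i. sqrt ((norm (Y i - abs_fock G))\<^sup>2)) \<longlonglongrightarrow> sqrt 0" by (rule tendsto_real_sqrt)
  then have "(\<lambda>i. norm (Y i - abs_fock G)) \<longlonglongrightarrow> 0" by simp
  then have "(\<lambda>i. Y i - abs_fock G) \<longlonglongrightarrow> 0" by (rule tendsto_norm_zero_cancel)
  then have "Y \<longlonglongrightarrow> abs_fock G" by (simp add: LIM_zero_iff)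
  then show ?thesis by (rule convergentI)
qed

instance fock :: complete_space
proof
  fix X :: "nat \<Rightarrow> fock" assume X: "Cauchy X"
  have "\<exists>N. \<forall>i\<ge>N. \<forall>j\<ge>N. (norm (X i - X j))\<^sup>2 \<le> (1/8) ^ k" for k
  proof -
    have "0 < sqrt ((1/8) ^ k)" by simp
    then obtain N where N: "\<And>i j. i \<ge> N \<Longrightarrow> j \<ge> N \<Longrightarrow> dist (X i) (X j) < sqrt ((1/8) ^ k)"
      using X unfolding Cauchy_def by blast
    have "(norm (X i - X j))\<^sup>2 \<le> (1/8) ^ k" if "i \<ge> N" "j \<ge> N" for i j
      using power_mono[OF less_imp_le[OF N[OF that]], of 2] by (simp add: dist_norm)
    then show ?thesis by blast
  qed
  then obtain N where N: "\<And>k i j. i \<ge> N k \<Longrightarrow> j \<ge> N k \<Longrightarrow> (norm (X i - X j))\<^sup>2 \<le> (1/8) ^ k"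
    by metis
  define r where "r k = k + (\<Sum>i\<le>k. N i)" for k
  have r: "strict_mono r" by (rule strict_monoI_Suc) (simp add: r_def)
  have "N k \<le> r k" for k
    using member_le_sum[of k "{..k}" N] by (simp add: r_def)
  then have "N i \<le> r i" "N i \<le> r j" if "i \<le> j" for i j
    using that strict_mono_less_eq[OF r, of i j] order_trans by blast+
  then have "convergent (X \<circ> r)"
    by (intro fast_Cauchy_fock_convergent) (simp add: N)
  then obtain L where "(X \<circ> r) \<longlonglongrightarrow> L" by (auto simp: convergent_def)
  then have "X \<longlonglongrightarrow> L" by (rule Cauchy_converges_subseq[OF X r])
  then show "convergent X" by (rule convergentI)
qed

section \<open>Exponential vectors\<close>

lemma rep_l2: obtains f where "sqint halfline f" "\<xi> = abs_l2 f"
proof -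
  have "l2_eq (rep_l2 \<xi>) (rep_l2 \<xi>)" by (rule Quotient3_rep_reflp[OF Quotient3_l2])
  then have "sqint halfline (rep_l2 \<xi>)" by (simp add: l2_eq_def)
  moreover have "\<xi> = abs_l2 (rep_l2 \<xi>)" by (simp add: Quotient3_abs_rep[OF Quotient3_l2])
  ultimately show ?thesis by (rule that)
qed

lemma l2_eq_refl_iff [simp]: "l2_eq f f \<longleftrightarrow> sqint halfline f"
  by (simp add: l2_eq_def)

text \<open>The \<open>n\<close>-particle component of \<open>expvec (z * f)\<close> is homogeneous of degree \<open>n\<close> in \<open>z\<close>.\<close>

lemma expvec_power_series:
  assumes f: "sqint halfline f" and F: "fock_rep F"
  shows "(\<lambda>n. (LINT x|particles n. exp_rep f n x * cnj (F n x)) * z ^ n) sums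
    cinner (expvec (z *\<^sub>C abs_l2 f)) (abs_fock F)"
proof -
  have zf: "sqint halfline (\<lambda>x. z * f x)" using f by (rule sqint_cmult)
  have rep: "fock_rep (exp_rep (\<lambda>x. z * f x))" by (rule fock_rep_exp[OF zf])
  have "expvec (z *\<^sub>C abs_l2 f) = abs_fock (exp_rep (\<lambda>x. z * f x))"
    using f zf by (simp add: scaleC_l2.abs_eq expvec.abs_eq)
  then have "cinner (expvec (z *\<^sub>C abs_l2 f)) (abs_fock F) =
      (\<Sum>n. LINT x|particles n. exp_rep (\<lambda>x. z * f x) n x * cnj (F n x))"
    by (simp add: cinner_abs_fock[OF rep F])
  moreover have "(LINT x|particles n. exp_rep (\<lambda>x. z * f x) n x * cnj (F n x)) =
      (LINT x|particles n. exp_rep f n x * cnj (F n x)) * z ^ n" for n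
  proof -
    have "exp_rep (\<lambda>x. z * f x) n x = exp_rep f n x * z ^ n" for x
      by (simp add: exp_rep_def prod.distrib)
    then show ?thesis by (simp add: mult.assoc mult.left_commute[of _ "z ^ n"])
  qed
  ultimately show ?thesis
    using summable_sums[OF fock_rep_summable_cinner[OF rep F]] by simp
qed

lemma power_series_eq_0:
  fixes c :: "nat \<Rightarrow> complex"
  assumes c: "\<And>z. (\<lambda>n. c n * z ^ n) sums 0"
  shows "c n = 0"
proof -
  have "conv_radius c = \<infinity>"
    using c by (intro conv_radius_inftyI'') (auto simp: sums_iff)
  then have r: "fps_conv_radius (Abs_fps c) > 0" by (simp add: fps_conv_radius_def)
  have "Abs_fps c = 0"
  proof (rule eval_fps_eqD[OF r])
    show "eventually (\<lambda>z. eval_fps (Abs_fps c) z = eval_fps 0 z) (nhds 0)"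
      using c by (simp add: eval_fps_def sums_iff)
  qed simp
  then show ?thesis by (metis fps_nth_Abs_fps fps_zero_nth)
qed

text \<open>Polarization: expanding each product of sums over maps \<open>h\<close>, inclusion--exclusion keeps only the
  maps that are onto.\<close>

lemma sum_surjections_inclusion_exclusion:
  fixes y :: "'a \<Rightarrow> 'a \<Rightarrow> 'b::comm_ring_1"
  assumes N: "finite N"
  shows "(\<Sum>h | h \<in> N \<rightarrow>\<^sub>E N \<and> h ` N = N. \<Prod>i\<in>N. y i (h i))
    = (-1) ^ card N * (\<Sum>S\<in>Pow N. (-1) ^ card S * (\<Prod>i\<in>N. \<Sum>j\<in>S. y i j))"
proof -
  define t where "t h = (\<Prod>i\<in>N. y i (h i))" for h
  define f where "f T = (-1) ^ card T * (\<Sum>h | h \<in> N \<rightarrow>\<^sub>E T \<and> h ` N = T. t h)" for T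
  define g where "g S = (\<Prod>i\<in>N. \<Sum>j\<in>S. y i j)" for S
  have "g S = (\<Sum>T\<in>Pow S. (-1) ^ card T * f T)" if S: "finite S" for S
  proof -
    have fin: "finite (N \<rightarrow>\<^sub>E S)" using N S by (simp add: finite_PiE)
    have "g S = (\<Sum>h\<in>N \<rightarrow>\<^sub>E S. t h)"
      unfolding g_def t_def using N S by (intro prod_sum_PiE) auto
    also have "\<dots> = (\<Sum>T\<in>Pow S. \<Sum>h | h \<in> N \<rightarrow>\<^sub>E S \<and> h ` N = T. t h)"
      using fin S by (intro sum.group[symmetric]) (auto simp: PiE_iff)
    also have "\<dots> = (\<Sum>T\<in>Pow S. (-1) ^ card T * f T)"
    proof (rule sum.cong[OF refl])
      fix T assume "T \<in> Pow S"
      then have "{h. h \<in> N \<rightarrow>\<^sub>E S \<and> h ` N = T} = {h. h \<in> N \<rightarrow>\<^sub>E T \<and> h ` N = T}"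
        by (auto simp: PiE_iff)
      then show "(\<Sum>h | h \<in> N \<rightarrow>\<^sub>E S \<and> h ` N = T. t h) = (-1) ^ card T * f T"
        by (simp add: f_def flip: mult.assoc power_add)
    qed
    finally show ?thesis .
  qed
  then have "f N = (\<Sum>S\<in>Pow N. (-1) ^ card S * g S)"
    using N by (rule inclusion_exclusion_symmetric)
  then have "(-1) ^ card N * f N = (-1) ^ card N * (\<Sum>S\<in>Pow N. (-1) ^ card S * g S)" by simp
  then show ?thesis by (simp add: f_def g_def t_def flip: mult.assoc power_add)
qed

lemma measurable_particles_permute:
  assumes p: "p permutes {..<n}"
  shows "(\<lambda>x. x \<circ> p) \<in> measurable (particles n) (particles n)"
proof (rule measurable_PiM_single')
  show "(\<lambda>x. (x \<circ> p) i) \<in> measurable (particles n) halfline" if "i \<in> {..<n}" for i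
  proof -
    have "p i \<in> {..<n}" using permutes_in_image[OF p] that by blast
    then show ?thesis unfolding comp_def by (rule measurable_component_singleton)
  qed
  show "(\<lambda>x. x \<circ> p) \<in> space (particles n) \<rightarrow> (\<Pi>\<^sub>E i\<in>{..<n}. space halfline)"
  proof
    fix x assume x: "x \<in> space (particles n)"
    have x1: "x i \<in> space halfline" if "i < n" for i
      using x that by (auto simp: space_PiM PiE_iff simp del: space_restrict_space2)
    have x2: "x i = undefined" if "\<not> i < n" for i
      using x that by (auto simp: space_PiM PiE_iff extensional_def)
    show "x \<circ> p \<in> (\<Pi>\<^sub>E i\<in>{..<n}. space halfline)"
    proof (rule PiE_I)
      fix i assume "i \<in> {..<n}"
      then have "p i < n" using permutes_in_image[OF p, of i] by simp
      then show "(x \<circ> p) i \<in> space halfline" using x1 by simp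
    next
      fix i assume i: "i \<notin> {..<n}"
      then show "(x \<circ> p) i = undefined" using permutes_not_in[OF p i] x2 by simp
    qed
  qed
qed

lemma distr_particles_permute:
  assumes p: "p permutes {..<n}"
  shows "distr (particles n) (particles n) (\<lambda>x. x \<circ> p) = particles n"
proof (rule particles.PiM_eqI)
  fix A assume A: "\<And>i. i \<in> {..<n} \<Longrightarrow> A i \<in> sets halfline"
  have q: "inv p permutes {..<n}" using p by (rule permutes_inv)
  have qA: "A (inv p i) \<in> sets halfline" if "i \<in> {..<n}" for i
    using A permutes_in_image[OF q] that by blast
  have box: "Pi\<^sub>E {..<n} A \<in> sets (particles n)" using A by (intro sets_PiM_I_finite) auto
  have "(\<lambda>x. x \<circ> p) -` Pi\<^sub>E {..<n} A \<inter> space (particles n) = Pi\<^sub>E {..<n} (\<lambda>i. A (inv p i))"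
  proof (intro set_eqI iffI)
    fix x assume x: "x \<in> (\<lambda>x. x \<circ> p) -` Pi\<^sub>E {..<n} A \<inter> space (particles n)"
    show "x \<in> Pi\<^sub>E {..<n} (\<lambda>i. A (inv p i))"
    proof (rule PiE_I)
      fix i assume "i \<in> {..<n}"
      then have "inv p i \<in> {..<n}" using permutes_in_image[OF q] by blast
      then have "(x \<circ> p) (inv p i) \<in> A (inv p i)" using x by blast
      then show "x i \<in> A (inv p i)" by (simp add: permutes_inverses[OF p])
    next
      fix i assume "i \<notin> {..<n}"
      then show "x i = undefined" using x by (auto simp: space_PiM PiE_iff extensional_def)
    qed
  next
    fix x assume x: "x \<in> Pi\<^sub>E {..<n} (\<lambda>i. A (inv p i))"
    then have "x \<in> space (particles n)"
      using qA[THEN sets.sets_into_space] unfolding space_PiM PiE_iff by blast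
    moreover have "x \<circ> p \<in> Pi\<^sub>E {..<n} A"
    proof (rule PiE_I)
      fix i assume "i \<in> {..<n}"
      then have "p i \<in> {..<n}" using permutes_in_image[OF p] by blast
      then have "x (p i) \<in> A (inv p (p i))" using x by blast
      then show "(x \<circ> p) i \<in> A i" by (simp add: permutes_inverses[OF p])
    next
      fix i assume i: "i \<notin> {..<n}"
      then show "(x \<circ> p) i = undefined"
        using permutes_not_in[OF p i] x by (auto simp: PiE_iff extensional_def)
    qed
    ultimately show "x \<in> (\<lambda>x. x \<circ> p) -` Pi\<^sub>E {..<n} A \<inter> space (particles n)" by simp
  qed
  then have "emeasure (distr (particles n) (particles n) (\<lambda>x. x \<circ> p)) (Pi\<^sub>E {..<n} A)
      = emeasure (particles n) (Pi\<^sub>E {..<n} (\<lambda>i. A (inv p i)))"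
    by (simp add: emeasure_distr[OF measurable_particles_permute[OF p] box])
  also have "\<dots> = (\<Prod>i<n. emeasure halfline (A (inv p i)))"
    using qA by (intro particles.emeasure_PiM) auto
  also have "\<dots> = (\<Prod>i<n. emeasure halfline (A i))"
    using prod.permute[OF q, of "\<lambda>i. emeasure halfline (A i)"] by (simp add: comp_def)
  finally show "emeasure (distr (particles n) (particles n) (\<lambda>x. x \<circ> p)) (Pi\<^sub>E {..<n} A)
      = (\<Prod>i<n. emeasure halfline (A i))" .
qed simp_all

lemma sqint_prod_particles:
  assumes f: "\<And>i. i < n \<Longrightarrow> sqint halfline (f i)"
  shows "sqint (particles n) (\<lambda>x. \<Prod>i<n. f i (x i))"
proof -
  have [measurable]: "f i \<in> borel_measurable halfline" if "i \<in> {..<n}" for i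
    using f that by (simp add: sqint_def)
  have "integrable (particles n) (\<lambda>x. \<Prod>i<n. (cmod (f i (x i)))\<^sup>2)"
    using f by (intro particles.product_integrable_prod) (auto simp: sqint_def)
  then show ?thesis
    unfolding sqint_def by (auto simp: prod_norm[symmetric] prod_power_distrib)
qed

text \<open>The powers of the partial sums of \<open>f\<close> combine to the sum over all permutations of the product, and
  by the symmetry of \<open>G\<close> all these permutations contribute the same integral.\<close>

lemma polarization:
  assumes G: "sqint (particles n) G"
    and sym: "\<And>p. p permutes {..<n} \<Longrightarrow> AE x in particles n. G (x \<circ> p) = G x"
    and pow: "\<And>f. sqint halfline f \<Longrightarrow> (LINT x|particles n. (\<Prod>i<n. f (x i)) * cnj (G x)) = 0"
    and f: "\<And>i. i < n \<Longrightarrow> sqint halfline (f i)"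
  shows "(LINT x|particles n. (\<Prod>i<n. f i (x i)) * cnj (G x)) = 0"
proof -
  define I where "I h = (LINT x|particles n. (\<Prod>i<n. f (h i) (x i)) * cnj (G x))" for h
  let ?H = "{h. h \<in> {..<n} \<rightarrow>\<^sub>E {..<n} \<and> h ` {..<n} = {..<n}}"
  have finH: "finite ?H" by (rule finite_subset[of _ "{..<n} \<rightarrow>\<^sub>E {..<n}"]) (auto intro: finite_PiE)
  have int: "integrable (particles n) (\<lambda>x. (\<Prod>i<n. f (h i) (x i)) * cnj (G x))"
    if h: "h \<in> {..<n} \<rightarrow>\<^sub>E {..<n}" for h
    using h f by (intro sqint_mult_integrable sqint_prod_particles G) (auto simp: PiE_iff)
  have intS: "sqint halfline (\<lambda>y. \<Sum>j\<in>S. f j y)" if S: "S \<subseteq> {..<n}" for S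
  proof -
    have "finite S" using S by (rule finite_subset) simp
    then show ?thesis using S by (induction S) (auto intro!: sqint_add f)
  qed
  have "(\<Sum>h\<in>?H. I h) = (LINT x|particles n. (\<Sum>h\<in>?H. (\<Prod>i<n. f (h i) (x i)) * cnj (G x)))"
    unfolding I_def using int by (intro Bochner_Integration.integral_sum[symmetric]) auto
  also have "\<dots> = (LINT x|particles n. (\<Sum>S\<in>Pow {..<n}. (-1) ^ n * (-1) ^ card S * ((\<Prod>i<n. \<Sum>j\<in>S. f j (x i)) * cnj (G x))))"
    unfolding sum_distrib_right[symmetric]
    by (subst sum_surjections_inclusion_exclusion[where y = "\<lambda>i j. f j (x i)" for x])
       (simp_all add: sum_distrib_left sum_distrib_right mult.assoc)
  also have "\<dots> = (\<Sum>S\<in>Pow {..<n}. LINT x|particles n. (-1) ^ n * (-1) ^ card S * ((\<Prod>i<n. \<Sum>j\<in>S. f j (x i)) * cnj (G x)))"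
    by (intro Bochner_Integration.integral_sum integrable_mult_right sqint_mult_integrable
        sqint_prod_particles G intS) auto
  also have "\<dots> = 0"
    using pow[OF intS] by (intro sum.neutral) simp
  finally have sum0: "(\<Sum>h\<in>?H. I h) = 0" .
  have "I h = (LINT x|particles n. (\<Prod>i<n. f i (x i)) * cnj (G x))" if h: "h \<in> ?H" for h
  proof -
    define p where "p i = (if i < n then h i else i)" for i
    have "inj_on h {..<n}" using h by (intro eq_card_imp_inj_on) auto
    then have "bij_betw p {..<n} {..<n}"
      using h by (auto simp: p_def bij_betw_def inj_on_def image_iff set_eq_iff)
    then have p: "p permutes {..<n}"
      by (rule bij_imp_permutes) (simp add: p_def)
    have fp: "f (h i) (x i) = f (p i) (x i)" if "i \<in> {..<n}" for i x
      using that by (simp add: p_def)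
    have meas: "(\<lambda>x. (\<Prod>i<n. f (h i) (x i)) * cnj (G x)) \<in> borel_measurable (particles n)"
      by (rule borel_measurable_integrable, rule int) (use h in simp)
    have "I h = (LINT x|distr (particles n) (particles n) (\<lambda>x. x \<circ> p). (\<Prod>i<n. f (h i) (x i)) * cnj (G x))"
      by (simp add: I_def distr_particles_permute[OF p])
    also have "\<dots> = (LINT x|particles n. (\<Prod>i<n. f (h i) ((x \<circ> p) i)) * cnj (G (x \<circ> p)))"
      by (rule integral_distr[OF measurable_particles_permute[OF p] meas])
    also have "\<dots> = (LINT x|particles n. (\<Prod>i<n. f i (x i)) * cnj (G x))"
    proof (rule integral_cong_AE)
      show "(\<lambda>x. (\<Prod>i<n. f (h i) ((x \<circ> p) i)) * cnj (G (x \<circ> p))) \<in> borel_measurable (particles n)"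
        by (rule measurable_compose[OF measurable_particles_permute[OF p] meas])
      show "(\<lambda>x. (\<Prod>i<n. f i (x i)) * cnj (G x)) \<in> borel_measurable (particles n)"
        by (rule borel_measurable_integrable, intro sqint_mult_integrable sqint_prod_particles G f)
      have "(\<Prod>i<n. f (h i) ((x \<circ> p) i)) = (\<Prod>i<n. f i (x i))" for x
      proof -
        have "(\<Prod>i<n. f (h i) ((x \<circ> p) i)) = (\<Prod>i<n. f (p i) (x (p i)))"
          using fp by (intro prod.cong) simp_all
        also have "\<dots> = (\<Prod>i<n. f i (x i))"
          using prod.permute[OF p, of "\<lambda>i. f i (x i)"] by (simp add: comp_def)
        finally show ?thesis .
      qed
      note prod_eq = this
      show "AE x in particles n. (\<Prod>i<n. f (h i) ((x \<circ> p) i)) * cnj (G (x \<circ> p)) =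
          (\<Prod>i<n. f i (x i)) * cnj (G x)"
        using sym[OF p] by eventually_elim (simp only: prod_eq)
    qed
    finally show ?thesis .
  qed
  then have "(\<Sum>h\<in>?H. I h) = of_nat (card ?H) * (LINT x|particles n. (\<Prod>i<n. f i (x i)) * cnj (G x))"
    by simp
  moreover have "card ?H \<noteq> 0"
  proof -
    have "restrict id {..<n} \<in> ?H" by auto
    then show ?thesis using finH card_gt_0_iff[of ?H] by blast
  qed
  ultimately show ?thesis using sum0 by simp
qed

text \<open>On a cube \<open>G\<close> is integrable, and the boxes are an intersection-stable generator, so its integral over
  every measurable subset of the cube vanishes.\<close>

lemma AE_zero_if_orthogonal_to_boxes:
  assumes G: "sqint (particles n) G"
    and box: "\<And>A. (\<And>i. i < n \<Longrightarrow> A i \<in> sets halfline \<and> emeasure halfline (A i) < \<infinity>) \<Longrightarrow>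
      (LINT x|particles n. indicator (Pi\<^sub>E {..<n} A) x * cnj (G x)) = 0"
  shows "AE x in particles n. G x = 0"
proof -
  interpret S: sigma_finite_measure "particles n" by (rule particles.sigma_finite) simp
  have cube: "AE x in particles n. x \<in> Pi\<^sub>E {..<n} (\<lambda>_. {0<..<real k}) \<longrightarrow> G x = 0" for k
  proof -
    define C where "C = Pi\<^sub>E {..<n} (\<lambda>_. {0<..<real k})"
    define H where "H x = indicator C x * cnj (G x)" for x
    have k: "{0<..<real k} \<in> sets halfline" by (auto simp: sets_restrict_space_iff)
    have ek: "emeasure halfline {0<..<real k} < \<infinity>"
      by (subst emeasure_restrict_space) auto
    have C: "C \<in> sets (particles n)" unfolding C_def using k by (intro sets_PiM_I_finite) auto
    have "emeasure (particles n) C = (\<Prod>i<n. emeasure halfline {0<..<real k})"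
      unfolding C_def using k by (intro particles.emeasure_PiM) auto
    also have "\<dots> < \<infinity>" using ek by (simp add: power_less_top_ennreal)
    finally have eC: "emeasure (particles n) C < \<infinity>" .
    have "sqint (particles n) (indicator C)"
    proof -
      have "(\<lambda>x. (cmod (indicator C x))\<^sup>2) = (indicator C :: _ \<Rightarrow> real)"
        by (auto simp: indicator_def)
      then show ?thesis using C eC by (simp add: sqint_def borel_measurable_indicator)
    qed
    then have H: "integrable (particles n) H"
      unfolding H_def using G by (rule sqint_mult_integrable)
    have zero: "(LINT x|particles n. indicator B x *\<^sub>R H x) = 0" if B: "B \<in> sets (particles n)" for B
    proof -
      let ?\<Omega> = "\<Pi>\<^sub>E i\<in>{..<n}. space halfline"
      let ?E = "{Pi\<^sub>E {..<n} A | A. \<forall>i\<in>{..<n}. A i \<in> sets halfline}"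
      have int: "integrable (particles n) (\<lambda>x. indicator D x *\<^sub>R H x)" if "D \<in> sets (particles n)" for D
        using integrable_mult_indicator[OF that H] .
      have eq: "sets (particles n) = sigma_sets ?\<Omega> ?E"
      proof -
        have "prod_algebra {..<n} (\<lambda>_. halfline) = ?E"
          by (subst prod_algebra_eq_finite) (auto simp: Pi_iff image_def)
        then show ?thesis by (simp only: sets_PiM)
      qed
      have box0: "(LINT x|particles n. indicator (Pi\<^sub>E {..<n} A) x *\<^sub>R H x) = 0"
        if A: "\<forall>i\<in>{..<n}. A i \<in> sets halfline" for A
      proof -
        have "indicator (Pi\<^sub>E {..<n} A) x *\<^sub>R H x
            = indicator (Pi\<^sub>E {..<n} (\<lambda>i. A i \<inter> {0<..<real k})) x * cnj (G x)" for x
          by (auto simp: H_def C_def indicator_def PiE_iff)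
        moreover have "A i \<inter> {0<..<real k} \<in> sets halfline \<and> emeasure halfline (A i \<inter> {0<..<real k}) < \<infinity>"
          if "i < n" for i
        proof
          show "A i \<inter> {0<..<real k} \<in> sets halfline" using A k that by (intro sets.Int) auto
          show "emeasure halfline (A i \<inter> {0<..<real k}) < \<infinity>"
            by (rule le_less_trans[OF emeasure_mono[OF _ k] ek]) simp
        qed
        ultimately show ?thesis using box by simp
      qed
      have full: "(LINT x|particles n. H x) = 0"
      proof -
        have "(LINT x|particles n. indicator (Pi\<^sub>E {..<n} (\<lambda>_. space halfline)) x *\<^sub>R H x) = 0"
          by (rule box0) (blast intro: sets.top)
        also have "(LINT x|particles n. indicator (Pi\<^sub>E {..<n} (\<lambda>_. space halfline)) x *\<^sub>R H x)
            = (LINT x|particles n. H x)"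
          by (rule Bochner_Integration.integral_cong) (auto simp: space_PiM)
        finally show ?thesis .
      qed
      have "Int_stable ?E" by (rule Int_stable_PiE)
      moreover have "?E \<subseteq> Pow ?\<Omega>"
      proof clarify
        fix A x assume A: "\<forall>i\<in>{..<n}. A i \<in> sets halfline" and x: "x \<in> Pi\<^sub>E {..<n} A"
        have "Pi\<^sub>E {..<n} A \<subseteq> ?\<Omega>"
          using A by (intro PiE_mono sets.sets_into_space) blast
        then show "x \<in> ?\<Omega>" using x by blast
      qed
      moreover have "B \<in> sigma_sets ?\<Omega> ?E" using B eq by simp
      ultimately show ?thesis
      proof (induction rule: sigma_sets_induct_disjoint)
        case (basic A)
        then show ?case using box0 by auto
      next
        case empty
        show ?case by simp
      next
        case (compl A)
        have A: "A \<in> sets (particles n)" using compl(1) eq by simp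
        have "(LINT x|particles n. indicator (?\<Omega> - A) x *\<^sub>R H x)
            = (LINT x|particles n. H x - indicator A x *\<^sub>R H x)"
          by (rule Bochner_Integration.integral_cong) (auto simp: space_PiM indicator_def)
        also have "\<dots> = 0" using H int[OF A] full compl(2) by simp
        finally show ?case .
      next
        case (union A)
        have A: "A i \<in> sets (particles n)" for i using union(2) eq by auto
        have "(LINT x:(\<Union>i. A i)|particles n. H x) = (\<Sum>i. (LINT x:(A i)|particles n. H x))"
        proof (rule lebesgue_integral_countable_add)
          show "A i \<inter> A j = {}" if "i \<noteq> j" for i j
            using union(1) that by (auto simp: disjoint_family_on_def)
          have "(\<Union>i. A i) \<in> sets (particles n)" using A by blast
          then show "set_integrable (particles n) (\<Union>i. A i) H"
            unfolding set_integrable_def by (rule int)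
        qed (rule A)
        then show ?case using union(3) by (simp add: set_lebesgue_integral_def)
      qed
    qed
    have "AE x in particles n. H x = 0"
      by (rule S.density_zero[OF H]) (simp add: set_lebesgue_integral_def zero)
    then show ?thesis
      unfolding C_def[symmetric] by eventually_elim (simp add: H_def indicator_eq_0_iff)
  qed
  then have "AE x in particles n. \<forall>k. x \<in> Pi\<^sub>E {..<n} (\<lambda>_. {0<..<real k}) \<longrightarrow> G x = 0"
    unfolding AE_all_countable by blast
  then show ?thesis
  proof (rule AE_mp, intro AE_I2 impI)
    fix x assume x: "x \<in> space (particles n)"
      and 0: "\<forall>k. x \<in> Pi\<^sub>E {..<n} (\<lambda>_. {0<..<real k}) \<longrightarrow> G x = 0"
    obtain k where k: "(\<Sum>i<n. \<bar>x i\<bar>) < real k" using reals_Archimedean2 by blast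
    have "x i < real k" if "i < n" for i
      using member_le_sum[of i "{..<n}" "\<lambda>i. \<bar>x i\<bar>"] that k by auto
    then have "x \<in> Pi\<^sub>E {..<n} (\<lambda>_. {0<..<real k})"
      using x by (auto simp: space_PiM PiE_iff)
    then show "G x = 0" using 0 by blast
  qed
qed

text \<open>A vector orthogonal to all \<open>expvec (z * f)\<close> has, by comparison of the coefficients of \<open>z^n\<close>, an
  \<open>n\<close>-particle component orthogonal to all powers \<open>f(x\<^sub>1) \<cdots> f(x\<^sub>n)\<close>, hence by polarization to the
  indicator functions of boxes.\<close>

theorem span_dense_expvec: "span_dense (range expvec)"
proof (rule span_denseI)
  fix v :: fock assume v: "\<And>x. x \<in> range expvec \<Longrightarrow> cinner x v = 0"
  define F where "F = rep_fock v"
  have F: "fock_rep F" and vF: "v = abs_fock F" by (simp_all add: F_def fock_rep_rep_fock)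
  have pow: "(LINT x|particles n. (\<Prod>i<n. f (x i)) * cnj (F n x)) = 0"
    if f: "sqint halfline f" for f n
  proof -
    have "(LINT x|particles n. exp_rep f n x * cnj (F n x)) = 0"
    proof (rule power_series_eq_0)
      show "(\<lambda>n. (LINT x|particles n. exp_rep f n x * cnj (F n x)) * z ^ n) sums 0" for z
        using expvec_power_series[OF f F, of z] v by (simp add: vF)
    qed
    moreover have "exp_rep f n x * cnj (F n x)
        = (\<Prod>i<n. f (x i)) * cnj (F n x) / of_real (sqrt (fact n))" for x
      by (simp add: exp_rep_def)
    ultimately show ?thesis by simp
  qed
  have "AE x in particles n. F n x = 0" for n
  proof (rule AE_zero_if_orthogonal_to_boxes)
    show "sqint (particles n) (F n)" by (rule fock_rep_sqint[OF F])
    fix A :: "nat \<Rightarrow> real set"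
    assume A: "\<And>i. i < n \<Longrightarrow> A i \<in> sets halfline \<and> emeasure halfline (A i) < \<infinity>"
    have ind: "sqint halfline (indicator (A i))" if "i < n" for i
    proof -
      have "(\<lambda>x. (cmod (indicator (A i) x))\<^sup>2) = (indicator (A i) :: _ \<Rightarrow> real)"
        by (auto simp: indicator_def)
      then show ?thesis
        using A[OF that] by (simp add: sqint_def borel_measurable_indicator)
    qed
    have "(LINT x|particles n. (\<Prod>i<n. indicator (A i) (x i)) * cnj (F n x)) = 0"
    proof (rule polarization[OF fock_rep_sqint[OF F]])
      show "AE x in particles n. F n (x \<circ> p) = F n x" if "p permutes {..<n}" for p
        using F that by (simp add: fock_rep_def)
    qed (fact pow ind)+
    also have "(LINT x|particles n. (\<Prod>i<n. indicator (A i) (x i)) * cnj (F n x)) =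
        (LINT x|particles n. indicator (Pi\<^sub>E {..<n} A) x * cnj (F n x))"
    proof (rule Bochner_Integration.integral_cong[OF refl])
      fix x assume x: "x \<in> space (particles n)"
      have "(\<Prod>i<n. indicator (A i) (x i)) = (indicator (Pi\<^sub>E {..<n} A) x :: complex)"
      proof (cases "\<forall>i<n. x i \<in> A i")
        case True
        then have "x \<in> Pi\<^sub>E {..<n} A" using x by (auto simp: space_PiM PiE_iff)
        with True show ?thesis by (simp add: indicator_def)
      next
        case False
        then obtain i where i: "i < n" "x i \<notin> A i" by blast
        then have "x \<notin> Pi\<^sub>E {..<n} A" by blast
        moreover have "(\<Prod>i<n. indicator (A i) (x i)) = (0 :: complex)"
          using i by (intro prod_zero) (auto intro!: bexI[of _ i])
        ultimately show ?thesis by simp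
      qed
      then show "(\<Prod>i<n. indicator (A i) (x i)) * cnj (F n x) = indicator (Pi\<^sub>E {..<n} A) x * cnj (F n x)"
        by simp
    qed
    finally show "(LINT x|particles n. indicator (Pi\<^sub>E {..<n} A) x * cnj (F n x)) = 0" .
  qed
  then have "fock_eq F (\<lambda>_ _. 0)" using F by (simp add: fock_eq_def fock_rep_zero)
  then show "v = 0"
    unfolding vF zero_fock_def using Quotient3_rel_abs[OF Quotient3_fock] by blast
qed

section \<open>Weyl operators\<close>

lemma cinner_weyl_on_expvec:
  fixes \<xi> :: l2
  shows "cinner (exp (- of_real ((norm \<xi>)\<^sup>2 / 2) - cinner \<eta> \<xi>) *\<^sub>C expvec (\<xi> + \<eta>))
      (exp (- of_real ((norm \<xi>)\<^sup>2 / 2) - cinner \<zeta> \<xi>) *\<^sub>C expvec (\<xi> + \<zeta>))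
    = cinner (expvec \<eta>) (expvec \<zeta>)"
proof -
  have "cnj (cinner \<zeta> \<xi>) = cinner \<xi> \<zeta>" by (rule cinner_commute[symmetric])
  then show ?thesis
    by (simp add: cinner_scaleC_left cinner_scaleC_right cinner_expvec cinner_add_left
        cinner_add_right cinner_self exp_cnj exp_add[symmetric])
qed

lemma weyl_ex:
  "\<exists>T\<in>bop. (\<forall>\<eta>. T (expvec \<eta>) =
      exp (- of_real ((norm \<xi>)\<^sup>2 / 2) - cinner \<eta> \<xi>) *\<^sub>C expvec (\<xi> + \<eta>)) \<and> (\<forall>v. norm (T v) = norm v)"
  using span_dense_expvec cinner_weyl_on_expvec by (rule isometric_extension)

lemma
  shows weyl_bop: "weyl \<xi> \<in> bop"
    and weyl_expvec: "weyl \<xi> (expvec \<eta>) =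
      exp (- of_real ((norm \<xi>)\<^sup>2 / 2) - cinner \<eta> \<xi>) *\<^sub>C expvec (\<xi> + \<eta>)"
    and norm_weyl: "norm (weyl \<xi> v) = norm v"
proof -
  obtain T where T: "T \<in> bop" "\<And>\<eta>. T (expvec \<eta>) =
      exp (- of_real ((norm \<xi>)\<^sup>2 / 2) - cinner \<eta> \<xi>) *\<^sub>C expvec (\<xi> + \<eta>)" "\<And>v. norm (T v) = norm v"
    using weyl_ex[of \<xi>] by blast
  have "weyl \<xi> = T"
    unfolding weyl_def
  proof (rule the_equality)
    fix T' assume T': "T' \<in> bop \<and> (\<forall>\<eta>. T' (expvec \<eta>) =
      exp (- of_real ((norm \<xi>)\<^sup>2 / 2) - cinner \<eta> \<xi>) *\<^sub>C expvec (\<xi> + \<eta>))"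
    show "T' = T"
      by (rule bop_eq_on_span_dense[OF span_dense_expvec]) (use T T' in auto)
  qed (use T in auto)
  with T show "weyl \<xi> \<in> bop" "weyl \<xi> (expvec \<eta>) =
      exp (- of_real ((norm \<xi>)\<^sup>2 / 2) - cinner \<eta> \<xi>) *\<^sub>C expvec (\<xi> + \<eta>)" "norm (weyl \<xi> v) = norm v"
    by auto
qed

lemma cinner_weyl: "cinner (weyl \<xi> v) (weyl \<xi> w) = cinner v w"
  by (rule isometry_cinner[OF weyl_bop norm_weyl])

lemma norm_add_sq: "(norm (x + y))\<^sup>2 = (norm x)\<^sup>2 + (norm y)\<^sup>2 + 2 * Re (cinner x y)"
  for x :: "'a::complex_inner"
  by (simp add: power2_norm_eq_inner inner_add_left inner_add_right inner_commute inner_eq_Re_cinner[symmetric])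

text \<open>In general the two sides differ by the phase \<open>exp (- \<i> * Im (cinner \<zeta> \<xi>))\<close>.\<close>

lemma weyl_comp:
  assumes "Im (cinner \<zeta> \<xi>) = 0"
  shows "weyl \<xi> \<circ> weyl \<zeta> = weyl (\<xi> + \<zeta>)"
proof (rule bop_eq_on_span_dense[OF span_dense_expvec])
  fix x assume "x \<in> range expvec"
  then obtain \<eta> where x: "x = expvec \<eta>" by blast
  have r: "complex_of_real (Re (cinner \<zeta> \<xi>)) = cinner \<zeta> \<xi>"
    using assms by (simp add: complex_eq_iff)
  have "(norm (\<xi> + \<zeta>))\<^sup>2 = (norm \<xi>)\<^sup>2 + (norm \<zeta>)\<^sup>2 + 2 * Re (cinner \<zeta> \<xi>)"
    by (subst add.commute, subst norm_add_sq) simp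
  then have n: "complex_of_real ((norm (\<xi> + \<zeta>))\<^sup>2 / 2)
      = of_real ((norm \<xi>)\<^sup>2 / 2) + of_real ((norm \<zeta>)\<^sup>2 / 2) + cinner \<zeta> \<xi>"
    by (simp add: add_divide_distrib r)
  show "(weyl \<xi> \<circ> weyl \<zeta>) x = weyl (\<xi> + \<zeta>) x"
    unfolding x comp_apply weyl_expvec bop_scaleC[OF weyl_bop] scaleC_scaleC n exp_add[symmetric]
      cinner_add_left cinner_add_right add.assoc
    by (rule arg_cong2[where f = scaleC], rule arg_cong[where f = exp]) (simp_all add: algebra_simps del: of_real_divide)
qed (intro comp_bop weyl_bop)+

text \<open>The derivatives \<open>D\<close> of \<open>f\<close> and \<open>E\<close> of \<open>g\<close> satisfy \<open>D * h = cnj (E * h)\<close> for all \<open>h\<close>; the directions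
  \<open>1\<close> and \<open>\<i>\<close> give \<open>D = cnj E = - D\<close>.\<close>

lemma constant_if_holomorphic_and_antiholomorphic:
  fixes a b :: "nat \<Rightarrow> complex"
  assumes a: "\<And>z. (\<lambda>n. a n * z ^ n) sums f z" and b: "\<And>z. (\<lambda>n. b n * z ^ n) sums g z"
    and fg: "\<And>z. f z = cnj (g z)"
  shows "f z = f 0"
proof -
  have "(f has_field_derivative 0) (at z)" for z
  proof -
    have "DERIV (\<lambda>z. \<Sum>n. a n * z ^ n) z :> (\<Sum>n. diffs a n * z ^ n)"
      using a by (intro termdiffs_strong_converges_everywhere) (simp add: sums_iff)
    moreover have "DERIV (\<lambda>z. \<Sum>n. b n * z ^ n) z :> (\<Sum>n. diffs b n * z ^ n)"
      using b by (intro termdiffs_strong_converges_everywhere) (simp add: sums_iff)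
    ultimately obtain D E where D: "DERIV f z :> D" and E: "DERIV g z :> E"
      using a b by (auto simp: sums_iff)
    have "((\<lambda>z. cnj (g z)) has_derivative (\<lambda>h. cnj (E * h))) (at z)"
      using E by (intro bounded_linear.has_derivative[OF bounded_linear_cnj])
        (simp add: has_field_derivative_def)
    moreover have "(f has_derivative (\<lambda>h. D * h)) (at z)"
      using D by (simp add: has_field_derivative_def)
    moreover have "f = (\<lambda>z. cnj (g z))" using fg by blast
    ultimately have "(\<lambda>h. D * h) = (\<lambda>h. cnj (E * h))"
      using has_derivative_unique by blast
    then have "D * 1 = cnj (E * 1)" "D * \<i> = cnj (E * \<i>)" by meson+
    then have "D = 0" by (simp add: complex_eq_iff)
    with D show ?thesis by simp
  qed
  then have "\<exists>c. \<forall>z\<in>UNIV. f z = c"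
    by (intro has_field_derivative_zero_constant) (auto simp: has_field_derivative_at_within)
  then show ?thesis by auto
qed

lemma expvec_analytic: "\<exists>a. \<forall>z. (\<lambda>n. a n * z ^ n) sums cinner (expvec (z *\<^sub>C \<xi>)) v"
proof -
  obtain f where f: "sqint halfline f" "\<xi> = abs_l2 f" by (rule rep_l2)
  show ?thesis
    by (rule exI, rule allI)
      (rule expvec_power_series[OF f(1) fock_rep_rep_fock, of v, folded f(2), unfolded abs_rep_fock])
qed

text \<open>Irreducibility of the Weyl operators; for \<open>S = id\<close> it says that their commutant is trivial. Invariance
  expresses \<open>cinner (S (expvec \<xi>)) (T (expvec \<eta>))\<close> through the value at the arguments \<open>\<xi> - \<eta>\<close> and \<open>0\<close>,
  or at \<open>0\<close> and \<open>\<eta> - \<xi>\<close>. This value is therefore both holomorphic and antiholomorphic in \<open>\<xi> - \<eta>\<close>,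
  hence constant.\<close>

lemma weyl_invariant_form:
  assumes S: "S \<in> bop" and T: "T \<in> bop"
    and inv: "\<And>\<xi> v w. cinner (S (weyl \<xi> v)) (T (weyl \<xi> w)) = cinner (S v) (T w)"
  shows "\<exists>k. \<forall>v w. cinner (S v) (T w) = k * cinner v w"
proof -
  define k where "k = cinner (S (expvec 0)) (T (expvec 0))"
  have shift: "cinner (S (expvec \<xi>)) (T (expvec \<eta>))
      = exp (- of_real ((norm \<zeta>)\<^sup>2) - cinner \<xi> \<zeta> - cinner \<zeta> \<eta>) *
        cinner (S (expvec (\<zeta> + \<xi>))) (T (expvec (\<zeta> + \<eta>)))" for \<xi> \<eta> \<zeta>
  proof -
    have "cnj (cinner \<eta> \<zeta>) = cinner \<zeta> \<eta>" by (rule cinner_commute[symmetric])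
    then show ?thesis
      by (subst inv[symmetric, of _ _ \<zeta>])
        (simp add: weyl_expvec bop_scaleC[OF S] bop_scaleC[OF T] cinner_scaleC_left
          cinner_scaleC_right exp_cnj exp_add[symmetric] algebra_simps)
  qed
  have const: "cinner (S (expvec \<xi>)) (T (expvec 0)) = k" for \<xi>
  proof -
    define f where "f z = cinner (S (expvec (z *\<^sub>C \<xi>))) (T (expvec 0))" for z
    define g where "g z = cinner (T (expvec (z *\<^sub>C (- \<xi>)))) (S (expvec 0))" for z
    obtain a where a: "\<And>z. (\<lambda>n. a n * z ^ n) sums f z"
      using expvec_analytic[of \<xi> "adj S (T (expvec 0))"] unfolding f_def cinner_adj[OF S] by blast
    obtain b where b: "\<And>z. (\<lambda>n. b n * z ^ n) sums g z"
      using expvec_analytic[of "- \<xi>" "adj T (S (expvec 0))"] unfolding g_def cinner_adj[OF T] by blast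
    have "f z = cnj (g z)" for z
    proof -
      have "f z = cinner (S (expvec 0)) (T (expvec (z *\<^sub>C (- \<xi>))))"
        unfolding f_def
        by (subst shift[of _ _ "- (z *\<^sub>C \<xi>)"])
          (simp add: scaleC_minus_right cinner_minus_right cinner_self)
      also have "\<dots> = cnj (g z)" unfolding g_def by (rule cinner_commute)
      finally show ?thesis .
    qed
    from constant_if_holomorphic_and_antiholomorphic[OF a b this, of 1] show ?thesis
      by (simp add: f_def k_def)
  qed
  have expo: "cinner (S (expvec \<xi>)) (T (expvec \<eta>)) = k * cinner (expvec \<xi>) (expvec \<eta>)" for \<xi> \<eta>
    by (subst shift[of _ _ "- \<eta>"])
      (simp add: cinner_expvec const cinner_minus_left cinner_minus_right cinner_self)
  have "cinner (S v) (T w) = k * cinner v w" for v w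
    using span_dense_expvec
  proof (induction v rule: span_dense_induct)
    case (base x)
    then obtain \<xi> where x: "x = expvec \<xi>" by blast
    show ?case
      using span_dense_expvec
    proof (induction w rule: span_dense_induct)
      case (base y)
      then show ?case using expo x by auto
    next
      case (lim f w)
      have "(\<lambda>n. k * cinner x (f n)) \<longlonglongrightarrow> k * cinner x w"
        by (intro tendsto_intros tendsto_cinner lim)
      moreover have "(\<lambda>n. cinner (S x) (T (f n))) \<longlonglongrightarrow> cinner (S x) (T w)"
        by (intro tendsto_cinner tendsto_const bounded_linear.tendsto[OF bop_bounded_linear[OF T]] lim)
      ultimately show ?case using lim(1) LIMSEQ_unique by auto
    qed (simp_all add: bop_zero[OF T] bop_add[OF T] bop_scaleC[OF T] cinner_add_right
           cinner_scaleC_right distrib_left)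
  next
    case (lim f v)
    have "(\<lambda>n. k * cinner (f n) w) \<longlonglongrightarrow> k * cinner v w"
      by (intro tendsto_intros tendsto_cinner lim)
    moreover have "(\<lambda>n. cinner (S (f n)) (T w)) \<longlonglongrightarrow> cinner (S v) (T w)"
      by (intro tendsto_cinner tendsto_const bounded_linear.tendsto[OF bop_bounded_linear[OF S]] lim)
    ultimately show ?case using lim(1) LIMSEQ_unique by auto
  qed (simp_all add: bop_zero[OF S] bop_add[OF S] bop_scaleC[OF S] cinner_add_left
         cinner_scaleC_left distrib_left)
  then show ?thesis by blast
qed

text \<open>\<open>weyl (n h)\<close> tends weakly to \<open>0\<close>, because its matrix coefficients at exponential vectors carry the
  factor \<open>exp (- n\<^sup>2 (norm h)\<^sup>2 / 2)\<close>.\<close>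

lemma weyl_weakly_null:
  assumes h: "h \<noteq> 0"
  shows "(\<lambda>n. cinner (weyl (real n *\<^sub>R h) v) (expvec \<zeta>)) \<longlonglongrightarrow> 0"
  using span_dense_expvec
proof (induction v rule: span_dense_induct)
  case (base x)
  then obtain \<eta> where x: "x = expvec \<eta>" by blast
  define q where "q n = - (of_real ((norm h)\<^sup>2 / 2) * of_nat n ^ 2) + (cinner h \<zeta> - cinner \<eta> h) * of_nat n
      + cinner \<eta> \<zeta>" for n
  have eq: "cinner (weyl (real n *\<^sub>R h) x) (expvec \<zeta>) = exp (q n)" for n
    by (simp add: x weyl_expvec cinner_scaleC_left cinner_expvec cinner_add_left cinner_scaleR_left
        cinner_scaleR_right q_def power_mult_distrib algebra_simps flip: exp_add)
  have "(\<lambda>n. exp (- ((norm h)\<^sup>2 / 2 * real n ^ 2) + Re (cinner h \<zeta> - cinner \<eta> h) * real n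
      + Re (cinner \<eta> \<zeta>))) \<longlonglongrightarrow> 0"
  proof -
    define a b c where "a = (norm h)\<^sup>2 / 2" and "b = Re (cinner h \<zeta> - cinner \<eta> h)"
      and "c = Re (cinner \<eta> \<zeta>)"
    have a: "0 < a" using h by (simp add: a_def)
    have "filterlim (\<lambda>n. - real n + c) at_bot sequentially"
      by (subst add.commute, subst filterlim_tendsto_add_at_bot_iff[OF tendsto_const])
        (simp add: filterlim_uminus_at_bot filterlim_real_sequentially)
    then have "filterlim (\<lambda>n. - (a * real n ^ 2) + b * real n + c) at_bot sequentially"
    proof (rule filterlim_at_bot_mono)
      obtain N where N: "(b + 1) / a < real N" using reals_Archimedean2 by blast
      show "\<forall>\<^sub>F n in sequentially. - (a * real n ^ 2) + b * real n + c \<le> - real n + c"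
      proof (rule eventually_sequentiallyI)
        fix n assume "N \<le> n"
        then have "(b + 1) / a \<le> real n" using N by linarith
        then have "b + 1 \<le> a * real n" using a by (simp add: field_simps)
        then have "(b + 1) * real n \<le> a * real n * real n" by (rule mult_right_mono) simp
        then show "- (a * real n ^ 2) + b * real n + c \<le> - real n + c"
          by (simp add: algebra_simps power2_eq_square)
      qed
    qed
    from filterlim_compose[OF exp_at_bot this] show ?thesis by (simp add: a_def b_def c_def)
  qed
  moreover have "norm (exp (q n)) = exp (- ((norm h)\<^sup>2 / 2 * real n ^ 2)
      + Re (cinner h \<zeta> - cinner \<eta> h) * real n + Re (cinner \<eta> \<zeta>))" for n
    by (simp add: q_def power2_eq_square)
  ultimately have "(\<lambda>n. norm (exp (q n))) \<longlonglongrightarrow> 0" by (simp only:)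
  then show ?case unfolding eq by (rule tendsto_norm_zero_cancel)
next
  case zero
  then show ?case by (simp add: bop_zero[OF weyl_bop])
next
  case (add v w)
  then show ?case using tendsto_add[OF add] by (simp add: bop_add[OF weyl_bop] cinner_add_left)
next
  case (scaleC c v)
  then show ?case using tendsto_mult_right_zero[OF scaleC, of c]
    by (simp add: bop_scaleC[OF weyl_bop] cinner_scaleC_left)
next
  case (lim f v)
  show ?case
  proof (rule LIMSEQ_I)
    fix e :: real assume e: "0 < e"
    define K where "K = norm (expvec \<zeta>) + 1"
    have K: "0 < K" by (simp add: K_def add_nonneg_pos)
    have "\<exists>m. norm (f m - v) < e / (2 * K)"
      using LIMSEQ_D[OF lim(2), of "e / (2 * K)"] e K by auto
    then obtain m where m: "norm (f m - v) < e / (2 * K)" by blast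
    obtain N where N: "\<And>n. n \<ge> N \<Longrightarrow> cmod (cinner (weyl (real n *\<^sub>R h) (f m)) (expvec \<zeta>)) < e / 2"
      using LIMSEQ_D[OF lim(1)[of m], of "e / 2"] e by auto
    have "cmod (cinner (weyl (real n *\<^sub>R h) v) (expvec \<zeta>) - 0) < e" if n: "n \<ge> N" for n
    proof -
      let ?W = "weyl (real n *\<^sub>R h)"
      have "cmod (cinner (?W (v - f m)) (expvec \<zeta>)) \<le> norm (v - f m) * norm (expvec \<zeta>)"
        using norm_cinner_le[of "?W (v - f m)" "expvec \<zeta>"] by (simp add: norm_weyl)
      also have "\<dots> \<le> norm (v - f m) * K" by (intro mult_left_mono) (simp_all add: K_def)
      also have "\<dots> < e / 2" using m K by (simp add: norm_minus_commute field_simps)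
      finally have "cmod (cinner (?W (v - f m)) (expvec \<zeta>)) < e / 2" .
      moreover have "cinner (?W v) (expvec \<zeta>) = cinner (?W (v - f m)) (expvec \<zeta>) + cinner (?W (f m)) (expvec \<zeta>)"
        by (simp add: bop_diff[OF weyl_bop] cinner_diff_left)
      ultimately show ?thesis
        using N[OF n] norm_triangle_ineq[of "cinner (?W (v - f m)) (expvec \<zeta>)" "cinner (?W (f m)) (expvec \<zeta>)"]
        by simp
    qed
    then show "\<exists>N. \<forall>n\<ge>N. cmod (cinner (weyl (real n *\<^sub>R h) v) (expvec \<zeta>) - 0) < e" by blast
  qed
qed

lemma weyl_zero: "weyl 0 = id"
  by (rule bop_eq_on_span_dense[OF span_dense_expvec weyl_bop id_bop]) (auto simp: weyl_expvec)

text \<open>A fixed vector of \<open>weyl h\<close> is fixed by every \<open>weyl (n h)\<close>, so it is orthogonal to all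
  exponential vectors.\<close>

lemma weyl_no_fixed_vector:
  assumes h: "h \<noteq> 0" and v: "weyl h v = v"
  shows "v = 0"
proof -
  have stays: "weyl (real n *\<^sub>R h) v = v" for n
  proof (induction n)
    case 0
    show ?case by (simp add: weyl_zero)
  next
    case (Suc n)
    have "weyl h \<circ> weyl (real n *\<^sub>R h) = weyl (h + real n *\<^sub>R h)"
      by (rule weyl_comp) (simp add: cinner_scaleR_left cinner_self)
    then have "weyl (h + real n *\<^sub>R h) v = weyl h (weyl (real n *\<^sub>R h) v)" by (metis comp_apply)
    then show ?case using Suc v by (simp add: algebra_simps)
  qed
  have "cinner x v = 0" if "x \<in> range expvec" for x
  proof -
    obtain \<zeta> where x: "x = expvec \<zeta>" using \<open>x \<in> range expvec\<close> by blast
    have "cinner v x = 0"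
      using weyl_weakly_null[OF h, of v \<zeta>] by (simp add: x stays LIMSEQ_const_iff)
    then show ?thesis by (subst cinner_commute) simp
  qed
  then show ?thesis by (rule cinner_eq_0_on_span_dense[OF span_dense_expvec])
qed

section \<open>Normal endomorphisms\<close>

definition rank_one :: "'a::complex_inner \<Rightarrow> 'a \<Rightarrow> 'a \<Rightarrow> 'a" where
  "rank_one v e w = cinner w e *\<^sub>C v"

lemma rank_one_bop: "rank_one v e \<in> bop"
  by (rule bopI[of _ "norm e * norm v"])
    (auto simp: rank_one_def cinner_add_left cinner_scaleC_left scaleC_add_left scaleC_scaleC
      norm_scaleC mult.assoc[symmetric] intro!: mult_right_mono norm_cinner_le)

lemma cinner_rank_one: "cinner (rank_one v e x) y = cinner x (rank_one e v y)"
proof -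
  have "cnj (cinner y v) = cinner v y" by (rule cinner_commute[symmetric])
  then show ?thesis by (simp add: rank_one_def cinner_scaleC_left cinner_scaleC_right)
qed

lemma comp_rank_one: "A \<in> bop \<Longrightarrow> A \<circ> rank_one v e = rank_one (A v) e"
  by (auto simp: rank_one_def bop_scaleC)

text \<open>Gram--Schmidt.\<close>

lemma orthonormal_span:
  assumes "finite X"
  shows "\<exists>B. finite B \<and> (\<forall>e\<in>B. \<forall>e'\<in>B. cinner e e' = (if e = e' then 1 else 0))
    \<and> (\<forall>x\<in>X. (\<Sum>e\<in>B. rank_one e e x) = (x :: 'a::complex_inner))"
  using assms
proof (induction X rule: finite_induct)
  case empty
  show ?case by (rule exI[of _ "{}"]) simp
next
  case (insert x X)
  then obtain B where B: "finite B" "\<And>e e'. e \<in> B \<Longrightarrow> e' \<in> B \<Longrightarrow> cinner e e' = (if e = e' then 1 else 0)"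
    "\<And>y. y \<in> X \<Longrightarrow> (\<Sum>e\<in>B. rank_one e e y) = y" by blast
  define s where "s = (\<Sum>e\<in>B. rank_one e e x)"
  define r where "r = x - s"
  have rB: "cinner r e = 0" if "e \<in> B" for e
  proof -
    have "cinner s e = (\<Sum>e'\<in>B. if e' = e then cinner x e' else 0)"
      using that by (auto simp: s_def rank_one_def cinner_sum_left cinner_scaleC_left B(2) intro!: sum.cong)
    also have "\<dots> = cinner x e" using that B(1) by simp
    finally show ?thesis by (simp add: r_def cinner_diff_left)
  qed
  then have Br: "cinner e r = 0" if "e \<in> B" for e
    using that by (subst cinner_commute) simp
  show ?case
  proof (cases "r = 0")
    case True
    then have "(\<Sum>e\<in>B. rank_one e e x) = x" by (simp add: r_def s_def)
    then show ?thesis using B by (intro exI[of _ B]) auto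
  next
    case False
    define f where "f = of_real (1 / norm r) *\<^sub>C r"
    have ff: "cinner f f = 1"
      using False by (simp add: cinner_self f_def norm_scaleC norm_divide)
    have Bf: "cinner e f = 0" "cinner f e = 0" if "e \<in> B" for e
      using that by (simp_all add: f_def cinner_scaleC_left cinner_scaleC_right rB Br)
    have fB: "f \<notin> B" using Bf(1)[of f] ff by auto
    have sum: "(\<Sum>e\<in>insert f B. rank_one e e y) = rank_one f f y + (\<Sum>e\<in>B. rank_one e e y)" for y
      using fB B(1) by simp
    have "(\<Sum>e\<in>insert f B. rank_one e e y) = y" if y: "y \<in> insert x X" for y
    proof (cases "y = x")
      case True
      have "cinner s r = 0"
        by (simp add: s_def rank_one_def cinner_sum_left cinner_scaleC_left Br)
      moreover have "x = s + r" by (simp add: r_def)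
      ultimately have "cinner x r = of_real ((norm r)\<^sup>2)"
        by (simp only: cinner_add_left cinner_self) simp
      then have "rank_one f f x = r"
        using \<open>r \<noteq> 0\<close> by (simp add: rank_one_def f_def cinner_scaleC_right scaleC_scaleC power2_eq_square)
      then show ?thesis unfolding sum using True by (simp add: s_def[symmetric] r_def)
    next
      case False
      then have yX: "y \<in> X" using y by simp
      have "cinner y f = cinner (\<Sum>e\<in>B. rank_one e e y) f" by (simp add: B(3)[OF yX])
      also have "\<dots> = 0" by (simp add: rank_one_def cinner_sum_left cinner_scaleC_left Bf)
      finally have "rank_one f f y = 0" by (simp add: rank_one_def)
      then show ?thesis unfolding sum using B(3)[OF yX] by simp
    qed
    then show ?thesis using B ff Bf fB by (intro exI[of _ "insert f B"]) auto
  qed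
qed

lemma norm_orthonormal_projection_le:
  assumes B: "finite B" "\<And>e e'. e \<in> B \<Longrightarrow> e' \<in> B \<Longrightarrow> cinner e e' = (if e = e' then 1 else 0)"
  shows "norm (\<Sum>e\<in>B. rank_one e e v) \<le> norm (v :: 'a::complex_inner)"
proof -
  define s where "s = (\<Sum>e\<in>B. rank_one e e v)"
  have "cinner s e = cinner v e" if "e \<in> B" for e
  proof -
    have "cinner s e = (\<Sum>e'\<in>B. if e' = e then cinner v e' else 0)"
      using that by (auto simp: s_def rank_one_def cinner_sum_left cinner_scaleC_left B(2) intro!: sum.cong)
    then show ?thesis using that B(1) by simp
  qed
  moreover have "cinner z s = (\<Sum>e\<in>B. cnj (cinner v e) * cinner z e)" for z
    by (simp add: s_def rank_one_def cinner_sum_right cinner_scaleC_right)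
  ultimately have "cinner s s = cinner v s" by simp
  then have "cmod (cinner v s) = cmod (of_real ((norm s)\<^sup>2))" by (simp only: cinner_self)
  then have "(norm s)\<^sup>2 = cmod (cinner v s)" by (simp only: norm_of_real) simp
  also have "\<dots> \<le> norm v * norm s" by (rule norm_cinner_le)
  finally show ?thesis
    unfolding s_def[symmetric] by (cases "norm s = 0") (auto simp: power2_eq_square)
qed

lemma sum_bop:
  assumes "\<And>i. i \<in> B \<Longrightarrow> f i \<in> bop"
  shows "(\<lambda>v. \<Sum>i\<in>B. f i v) \<in> (bop :: ('a::complex_inner \<Rightarrow> 'a) set)"
  using assms
proof (induction B rule: infinite_finite_induct)
  case (insert i B)
  then show ?case using add_bop[of "f i" "\<lambda>v. \<Sum>i\<in>B. f i v"] by simp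
qed (auto intro: bopI[of _ 0])

text \<open>Contractions that fix more and more vectors tend to the identity: all but finitely many terms of
  \<open>\<Sum>n. cinner (A (v n)) (w n)\<close> are uniformly small, and the others eventually do not change.\<close>

lemma eventually_in_sigma_weak_nbhd_of_id:
  fixes q :: "'a::complex_inner set \<Rightarrow> 'a \<Rightarrow> 'a"
  assumes q: "\<And>X. finite X \<Longrightarrow> q X \<in> bop" "\<And>X v. finite X \<Longrightarrow> norm (q X v) \<le> norm v"
      "\<And>X x. finite X \<Longrightarrow> x \<in> X \<Longrightarrow> q X x = x"
    and U: "openin sigma_weak_topology U" "id \<in> U"
  shows "eventually (\<lambda>X. q X \<in> U) (finite_subsets_at_top UNIV)"
proof -
  let ?S = "{{A \<in> bop. (\<Sum>n. cinner (A (v n)) (w n)) \<in> U} | (v :: nat \<Rightarrow> 'a) w U.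
        summable (\<lambda>n. (norm (v n))\<^sup>2) \<and> summable (\<lambda>n. (norm (w n))\<^sup>2) \<and> open U}"
  have "generate_topology_on ?S U"
    using U(1) by (simp add: sigma_weak_topology_def openin_topology_generated_by_iff)
  then show ?thesis using U(2)
  proof (induction rule: generate_topology_on.induct)
    case Empty
    then show ?case by simp
  next
    case (Int a b)
    then show ?case by (auto intro: eventually_conj)
  next
    case (UN K)
    then obtain k where "k \<in> K" "id \<in> k" by blast
    then have "eventually (\<lambda>X. q X \<in> k) (finite_subsets_at_top UNIV)" using UN by blast
    then show ?case by (rule eventually_mono) (use \<open>k \<in> K\<close> in blast)
  next
    case (Basis s)
    then obtain v w :: "nat \<Rightarrow> 'a" and V where s: "s = {A \<in> bop. (\<Sum>n. cinner (A (v n)) (w n)) \<in> V}"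
      and v: "summable (\<lambda>n. (norm (v n))\<^sup>2)" and w: "summable (\<lambda>n. (norm (w n))\<^sup>2)" and V: "open V"
      by blast
    define t where "t = (\<Sum>n. cinner (v n) (w n))"
    have "t \<in> V" using Basis(2) by (simp add: s t_def)
    then obtain e where e: "0 < e" "ball t e \<subseteq> V" using V open_contains_ball by blast
    define b where "b n = norm (v n) * norm (w n)" for n
    have b: "summable b"
    proof (rule summable_comparison_test)
      show "summable (\<lambda>n. (norm (v n))\<^sup>2 + (norm (w n))\<^sup>2)" using v w by (rule summable_add)
      have "norm (b n) \<le> (norm (v n))\<^sup>2 + (norm (w n))\<^sup>2" for n
      proof -
        have "0 \<le> b n" by (simp add: b_def)
        moreover have "2 * b n \<le> (norm (v n))\<^sup>2 + (norm (w n))\<^sup>2"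
          using sum_squares_bound[of "norm (v n)" "norm (w n)"] by (simp add: b_def)
        ultimately show ?thesis by simp
      qed
      then show "\<exists>N. \<forall>n\<ge>N. norm (b n) \<le> (norm (v n))\<^sup>2 + (norm (w n))\<^sup>2" by blast
    qed
    obtain N where N: "norm (\<Sum>i. b (i + N)) < e / 2"
      using suminf_exist_split[OF _ b, of "e / 2"] e(1) by auto
    have "q X \<in> s" if X: "finite X" "v ` {..<N} \<subseteq> X" for X
    proof -
      have cb: "norm (cinner (q X (v n)) (w n)) \<le> b n" for n
        unfolding b_def by (rule order_trans[OF norm_cinner_le]) (intro mult_right_mono q X norm_ge_zero)
      have cb': "norm (cinner (v n) (w n)) \<le> b n" for n
        unfolding b_def by (rule norm_cinner_le)
      have sm: "summable (\<lambda>n. cinner (q X (v n)) (w n))" "summable (\<lambda>n. cinner (v n) (w n))"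
        by (rule summable_comparison_test[OF _ b], use cb cb' in blast)+
      define d where "d n = cinner (q X (v n)) (w n) - cinner (v n) (w n)" for n
      have sd: "summable d" unfolding d_def using sm by (rule summable_diff)
      have d0: "d n = 0" if "n < N" for n using q(3)[OF X(1), of "v n"] X(2) that by (auto simp: d_def)
      have db: "norm (d n) \<le> 2 * b n" for n
        unfolding d_def using norm_triangle_ineq4[of "cinner (q X (v n)) (w n)" "cinner (v n) (w n)"] cb[of n] cb'[of n]
        by simp
      have "(\<Sum>n. cinner (q X (v n)) (w n)) - t = (\<Sum>n. d n)"
        unfolding d_def t_def using sm by (rule suminf_diff)
      also have "\<dots> = (\<Sum>n. d (n + N))" using suminf_split_initial_segment[OF sd, of N] d0 by simp
      finally have "norm ((\<Sum>n. cinner (q X (v n)) (w n)) - t) = norm (\<Sum>n. d (n + N))" by simp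
      also have "\<dots> \<le> (\<Sum>n. 2 * b (n + N))"
      proof (rule norm_suminf_le)
        show "norm (d (n + N)) \<le> 2 * b (n + N)" for n by (rule db)
        show "summable (\<lambda>n. 2 * b (n + N))"
          using b by (intro summable_mult) (simp add: summable_iff_shift)
      qed
      also have "\<dots> = 2 * (\<Sum>n. b (n + N))"
        using b by (intro suminf_mult) (simp add: summable_iff_shift)
      also have "\<dots> < e" using N by simp
      finally have "(\<Sum>n. cinner (q X (v n)) (w n)) \<in> ball t e" by (simp add: dist_norm norm_minus_commute)
      then show ?thesis using e(2) q(1)[OF X(1)] by (auto simp: s)
    qed
    then show ?case
      unfolding eventually_finite_subsets_at_top by (intro exI[of _ "v ` {..<N}"]) auto
  qed
qed

lemma
  fixes \<theta> :: "('a::complex_inner \<Rightarrow> 'a) \<Rightarrow> 'a \<Rightarrow> 'a"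
  assumes "unital_normal_star_endomorphism \<theta>"
  shows endo_bop: "A \<in> bop \<Longrightarrow> \<theta> A \<in> bop"
    and endo_add: "A \<in> bop \<Longrightarrow> B \<in> bop \<Longrightarrow> \<theta> (\<lambda>v. A v + B v) = (\<lambda>v. \<theta> A v + \<theta> B v)"
    and endo_scaleC: "A \<in> bop \<Longrightarrow> \<theta> (\<lambda>v. c *\<^sub>C A v) = (\<lambda>v. c *\<^sub>C \<theta> A v)"
    and endo_comp: "A \<in> bop \<Longrightarrow> B \<in> bop \<Longrightarrow> \<theta> (A \<circ> B) = \<theta> A \<circ> \<theta> B"
    and endo_adj: "A \<in> bop \<Longrightarrow> \<theta> (adj A) = adj (\<theta> A)"
    and endo_id: "\<theta> id = id"
    and endo_continuous: "continuous_map sigma_weak_topology sigma_weak_topology \<theta>"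
  using assms by (auto simp: unital_normal_star_endomorphism_def)

text \<open>This is where normality enters: the identity is a \<open>\<sigma>\<close>-weak limit of finite rank projections, so the
  images of the rank one operators cannot have a common null vector.\<close>

lemma normal_endo_rank_one_nondegenerate:
  fixes \<theta> :: "('a::complex_inner \<Rightarrow> 'a) \<Rightarrow> 'a \<Rightarrow> 'a"
  assumes \<theta>: "unital_normal_star_endomorphism \<theta>"
    and x: "\<And>e. cinner (\<theta> (rank_one e e) x) x = 0"
  shows "x = 0"
proof (rule ccontr)
  assume x0: "x \<noteq> 0"
  define B :: "'a set \<Rightarrow> 'a set" where "B X = (SOME B. finite B
      \<and> (\<forall>e\<in>B. \<forall>e'\<in>B. cinner e e' = (if e = e' then 1 else 0))
      \<and> (\<forall>x\<in>X. (\<Sum>e\<in>B. rank_one e e x) = x))" for X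
  have B: "finite (B X)" "\<forall>e\<in>B X. \<forall>e'\<in>B X. cinner e e' = (if e = e' then 1 else 0)"
    "\<forall>x\<in>X. (\<Sum>e\<in>B X. rank_one e e x) = x" if "finite X" for X
    using someI_ex[OF orthonormal_span[OF that]] unfolding B_def by blast+
  define q where "q X v = (\<Sum>e\<in>B X. rank_one e e v)" for X v
  define v where "v n = (if n = 0 then x else 0)" for n :: nat
  define O' where "O' = {A \<in> bop. (\<Sum>n. cinner (A (v n)) (v n)) \<in> - {0}}"
  have O'_iff: "A \<in> O' \<longleftrightarrow> A \<in> bop \<and> cinner (A x) x \<noteq> 0" for A
  proof -
    have "(\<Sum>n. cinner (A (v n)) (v n)) = (\<Sum>n\<in>{0}. cinner (A (v n)) (v n))"
      by (rule suminf_finite) (auto simp: v_def)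
    then show ?thesis by (simp add: O'_def v_def)
  qed
  have "summable (\<lambda>n. (norm (v n))\<^sup>2)"
    by (rule summable_finite[of "{0}"]) (auto simp: v_def)
  then have "openin sigma_weak_topology O'"
    unfolding sigma_weak_topology_def openin_topology_generated_by_iff O'_def
    by (intro generate_topology_on.Basis) blast
  then have U: "openin sigma_weak_topology {A \<in> topspace sigma_weak_topology. \<theta> A \<in> O'}"
    using endo_continuous[OF \<theta>] by (simp add: continuous_map_def)
  have "id \<in> O'" using x0 id_bop by (simp add: O'_iff)
  moreover have "O' \<subseteq> topspace sigma_weak_topology"
    using \<open>openin sigma_weak_topology O'\<close> by (rule openin_subset)
  ultimately have "id \<in> {A \<in> topspace sigma_weak_topology. \<theta> A \<in> O'}"
    by (auto simp: endo_id[OF \<theta>])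
  then have "eventually (\<lambda>X. q X \<in> {A \<in> topspace sigma_weak_topology. \<theta> A \<in> O'}) (finite_subsets_at_top UNIV)"
  proof (rule eventually_in_sigma_weak_nbhd_of_id[OF _ _ _ U, rotated -1])
    show "q X \<in> bop" for X unfolding q_def by (intro sum_bop rank_one_bop)
    show "norm (q X v) \<le> norm v" if "finite X" for X v
      unfolding q_def using B that by (intro norm_orthonormal_projection_le) blast+
    show "q X x = x" if "finite X" "x \<in> X" for X x
      unfolding q_def using B(3) that by blast
  qed
  then obtain X where X: "finite X" "\<theta> (q X) \<in> O'"
    unfolding eventually_finite_subsets_at_top by blast
  have "\<theta> (\<lambda>v. \<Sum>e\<in>C. rank_one e e v) = (\<lambda>v. \<Sum>e\<in>C. \<theta> (rank_one e e) v)" for C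
  proof (induction C rule: infinite_finite_induct)
    case (insert e C)
    then show ?case
      using endo_add[OF \<theta> rank_one_bop[of e e] sum_bop[of C "\<lambda>e. rank_one e e"]]
      by (simp add: rank_one_bop)
  qed (use endo_scaleC[OF \<theta> id_bop, of 0] in simp_all)
  then have "cinner (\<theta> (q X) x) x = 0" by (simp add: q_def[abs_def] cinner_sum_left x)
  with X(2) show False by (simp add: O'_iff)
qed

text \<open>Linearity is clear; the bound comes from \<open>\<theta> (rank_one w e)\<^sup>* \<circ> \<theta> (rank_one w e) = (norm w)\<^sup>2 \<theta> (rank_one e e)\<close>.\<close>

lemma endo_rank_one_bop:
  fixes \<theta> :: "('a::{complex_inner,complete_space} \<Rightarrow> 'a) \<Rightarrow> 'a \<Rightarrow> 'a"
  assumes \<theta>: "unital_normal_star_endomorphism \<theta>"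
  shows "(\<lambda>w. \<theta> (rank_one w e) y) \<in> bop"
proof (rule bopI)
  have "rank_one (v + w) e = (\<lambda>x. rank_one v e x + rank_one w e x)" for v w :: 'a
    by (auto simp: rank_one_def scaleC_add_right)
  then show "\<theta> (rank_one (v + w) e) y = \<theta> (rank_one v e) y + \<theta> (rank_one w e) y" for v w
    by (simp add: endo_add[OF \<theta> rank_one_bop rank_one_bop])
  have sc: "rank_one (c *\<^sub>C v) e = (\<lambda>x. c *\<^sub>C rank_one v e x)" for c and v e :: 'a
    by (auto simp: rank_one_def scaleC_scaleC mult.commute)
  show s: "\<theta> (rank_one (c *\<^sub>C v) e) y = c *\<^sub>C \<theta> (rank_one v e) y" for c v
    by (simp add: sc endo_scaleC[OF \<theta> rank_one_bop])
  fix w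
  define C where "C = cmod (cinner y (\<theta> (rank_one e e) y))"
  have adj: "adj (rank_one w e) = rank_one e w"
    by (rule adj_eqI[OF rank_one_bop rank_one_bop cinner_rank_one])
  have "cinner (\<theta> (rank_one w e) y) (\<theta> (rank_one w e) y)
      = cinner y (adj (\<theta> (rank_one w e)) (\<theta> (rank_one w e) y))"
    by (rule cinner_adj[OF endo_bop[OF \<theta> rank_one_bop]])
  also have "adj (\<theta> (rank_one w e)) = \<theta> (rank_one e w)"
    using endo_adj[OF \<theta> rank_one_bop, of w e] adj by simp
  also have "\<theta> (rank_one e w) (\<theta> (rank_one w e) y) = \<theta> (rank_one e w \<circ> rank_one w e) y"
    by (simp add: endo_comp[OF \<theta> rank_one_bop rank_one_bop])
  also have "rank_one e w \<circ> rank_one w e = rank_one (rank_one e w w) e"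
    by (rule comp_rank_one[OF rank_one_bop])
  also have "\<theta> (rank_one (rank_one e w w) e) y = cinner w w *\<^sub>C \<theta> (rank_one e e) y"
    unfolding rank_one_def[of e w w] by (rule s)
  finally have "cmod (of_real ((norm (\<theta> (rank_one w e) y))\<^sup>2)) = (norm w)\<^sup>2 * C"
    by (simp add: cinner_self cinner_scaleC_right norm_mult norm_power C_def)
  then have "(norm (\<theta> (rank_one w e) y))\<^sup>2 = (norm w * sqrt C)\<^sup>2"
    by (simp add: power_mult_distrib C_def norm_power)
  then show "norm (\<theta> (rank_one w e) y) \<le> norm w * sqrt C"
    by (rule power2_le_imp_le[OF eq_refl]) (simp add: C_def)
qed

text \<open>The operators \<open>\<lambda>w. \<theta> (rank_one w e) y\<close> intertwine \<open>\<theta>\<close> with the identity representation, and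
  their ranges have dense span. By irreducibility of the Weyl operators the form
  \<open>cinner (u v) (\<theta> (rank_one w e) y)\<close> is a multiple of \<open>cinner v w\<close>; hence \<open>\<theta> A (u v)\<close> and \<open>u (A v)\<close>
  have the same inner products with these ranges.\<close>

lemma weyl_intertwiner_in_fibre:
  assumes \<theta>: "unital_normal_star_endomorphism \<theta>" and \<theta>W: "\<And>\<xi>. \<theta> (weyl \<xi>) = weyl (V \<xi>)"
    and u: "u \<in> bop" and uW: "\<And>\<xi> v. u (weyl \<xi> v) = weyl (V \<xi>) (u v)" and A: "A \<in> bop"
  shows "\<theta> A \<circ> u = u \<circ> A"
proof
  fix v
  define x where "x = \<theta> A (u v) - u (A v)"
  have "cinner x (\<theta> (rank_one w e) y) = 0" for w e y
  proof -
    define T where "T w = \<theta> (rank_one w e) y" for w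
    have T: "T \<in> bop" unfolding T_def by (rule endo_rank_one_bop[OF \<theta>])
    have \<theta>T: "\<theta> B (T w) = T (B w)" if "B \<in> bop" for B w
      using that by (simp add: T_def comp_rank_one[symmetric] endo_comp[OF \<theta> _ rank_one_bop])
    have "cinner (u (weyl \<xi> v)) (T (weyl \<xi> w)) = cinner (u v) (T w)" for \<xi> v w
      by (simp add: uW \<theta>T[OF weyl_bop, symmetric] \<theta>W cinner_weyl)
    then obtain k where k: "\<And>v w. cinner (u v) (T w) = k * cinner v w"
      using weyl_invariant_form[OF u T] by blast
    have "cinner (\<theta> A (u v)) (T w) = cinner (u v) (adj (\<theta> A) (T w))"
      by (rule cinner_adj[OF endo_bop[OF \<theta> A]])
    also have "\<dots> = cinner (u v) (T (adj A w))"
      by (simp add: endo_adj[OF \<theta> A, symmetric] \<theta>T[OF adj_bop[OF A]])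
    also have "\<dots> = cinner (u (A v)) (T w)" by (simp add: k cinner_adj[OF A])
    finally show ?thesis by (simp add: x_def cinner_diff_left T_def)
  qed
  then have "cinner (\<theta> (rank_one e e) x) x = 0" for e by (subst cinner_commute) simp
  then have "x = 0" by (rule normal_endo_rank_one_nondegenerate[OF \<theta>])
  then show "(\<theta> A \<circ> u) v = (u \<circ> A) v" by (simp add: x_def)
qed

section \<open>Shifts and ramps\<close>

definition zero_extend :: "(real \<Rightarrow> complex) \<Rightarrow> real \<Rightarrow> complex" where
  "zero_extend f x = (if 0 < x then f x else 0)"

lemma zero_extend_measurable: "sqint halfline f \<Longrightarrow> zero_extend f \<in> borel_measurable borel"
  using sqint_halfline_iff[of f] by (simp add: sqint_def zero_extend_def[abs_def])

lemma cinner_abs_l2: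
  assumes "sqint halfline f" "sqint halfline g"
  shows "cinner (abs_l2 f) (abs_l2 g) = (LINT x|lborel. zero_extend f x * cnj (zero_extend g x))"
proof -
  have "cinner (abs_l2 f) (abs_l2 g) = (LINT x|halfline. f x * cnj (g x))"
    using assms by (simp add: cinner_l2.abs_eq)
  also have "\<dots> = (LINT x|lborel. indicator {0<..} x *\<^sub>R (f x * cnj (g x)))"
    by (rule integral_restrict_space) simp
  also have "\<dots> = (LINT x|lborel. zero_extend f x * cnj (zero_extend g x))"
    by (rule Bochner_Integration.integral_cong) (auto simp: zero_extend_def indicator_def)
  finally show ?thesis .
qed

lemma abs_l2_eqI:
  assumes "sqint halfline f" "sqint halfline g" "AE x in halfline. f x = g x"
  shows "abs_l2 f = abs_l2 g"
  by (rule Quotient3_rel_abs[OF Quotient3_l2]) (use assms in \<open>simp add: l2_eq_def\<close>)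

lemma zero_extend_shift: "0 \<le> t \<Longrightarrow> zero_extend (\<lambda>x. if t < x then f (x - t) else 0) x = zero_extend f (x - t)"
  by (simp add: zero_extend_def)

lemma cinner_shift_left:
  assumes "sqint halfline f" "sqint halfline g" "0 \<le> t"
  shows "cinner (shift t (abs_l2 f)) (abs_l2 g) = (LINT x|lborel. zero_extend f (x - t) * cnj (zero_extend g x))"
  using assms by (simp add: shift.abs_eq cinner_abs_l2 sqint_shift zero_extend_shift)

lemma cinner_shift_shift:
  assumes t: "0 \<le> t"
  shows "cinner (shift t \<xi>) (shift t \<eta>) = cinner \<xi> \<eta>"
proof -
  obtain f where f: "sqint halfline f" "\<xi> = abs_l2 f" by (rule rep_l2)
  obtain g where g: "sqint halfline g" "\<eta> = abs_l2 g" by (rule rep_l2)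
  have "cinner (shift t \<xi>) (shift t \<eta>) = (LINT x|lborel. zero_extend f (x - t) * cnj (zero_extend g (x - t)))"
    using f g t by (simp add: shift.abs_eq cinner_abs_l2 sqint_shift zero_extend_shift)
  also have "\<dots> = (LINT x|lborel. zero_extend f x * cnj (zero_extend g x))"
    using lborel_integral_real_affine[of 1 "\<lambda>x. zero_extend f x * cnj (zero_extend g x)" "- t"] by simp
  finally show ?thesis using f g by (simp add: cinner_abs_l2)
qed

lemma norm_shift: "0 \<le> t \<Longrightarrow> norm (shift t \<xi>) = norm \<xi>"
  using cinner_shift_shift[of t \<xi> \<xi>] unfolding cinner_self by (simp only: of_real_eq_iff) simp

lemma shift_add: "shift t (\<xi> + \<eta>) = shift t \<xi> + shift t \<eta>"
proof -
  obtain f where f: "sqint halfline f" "\<xi> = abs_l2 f" by (rule rep_l2)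
  obtain g where g: "sqint halfline g" "\<eta> = abs_l2 g" by (rule rep_l2)
  show ?thesis
    unfolding f g using f g sqint_shift[OF f(1)] sqint_shift[OF g(1)]
    by (simp add: plus_l2.abs_eq shift.abs_eq sqint_add if_distrib[of "\<lambda>x. x + _"] cong: if_cong)
qed

lemma shift_shift: "0 \<le> s \<Longrightarrow> 0 \<le> t \<Longrightarrow> shift s (shift t \<xi>) = shift (s + t) \<xi>"
proof -
  assume st: "0 \<le> s" "0 \<le> t"
  obtain f where f: "sqint halfline f" "\<xi> = abs_l2 f" by (rule rep_l2)
  have "(\<lambda>x. if s < x then if t < x - s then f (x - s - t) else 0 else 0)
      = (\<lambda>x. if s + t < x then f (x - (s + t)) else 0)"
    using st by (auto simp: algebra_simps fun_eq_iff)
  then show ?thesis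
    using f(1) sqint_shift[OF f(1), of t] by (simp add: f(2) shift.abs_eq)
qed

lemma sqint_ramp: "sqint halfline (\<lambda>x. of_real (c * x) * indicator {0<..<t} x)"
proof -
  have "integrable lborel (\<lambda>x. (cmod (if 0 < x then of_real (c * x) * indicator {0<..<t} x else 0))\<^sup>2)"
  proof (rule Bochner_Integration.integrable_bound)
    have "integrable lborel (indicator {0<..<t} :: real \<Rightarrow> real)"
      using emeasure_bounded_finite[of "{0<..<t}"]
      by (intro integrable_real_indicator) (simp_all add: less_top)
    then show "integrable lborel (\<lambda>x. (c * t)\<^sup>2 * indicator {0<..<t} x)"
      by (rule integrable_mult_right)
    have "(c * x)\<^sup>2 \<le> (c * t)\<^sup>2" if "0 < x" "x < t" for x
      using that unfolding power_mult_distrib by (intro mult_left_mono power_mono) auto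
    then show "AE x in lborel. norm ((cmod (if 0 < x then of_real (c * x) * indicator {0<..<t} x else 0))\<^sup>2)
        \<le> norm ((c * t)\<^sup>2 * indicator {0<..<t} x)"
      by (intro AE_I2) (auto simp: indicator_def norm_power norm_mult power_mult_distrib)
  qed measurable
  then show ?thesis unfolding sqint_halfline_iff by (simp add: sqint_def)
qed

text \<open>The solution of the cocycle equation \<open>r (s + t) = r s + shift s (c * s * interval_ind t + r t)\<close>, which
  is the condition for the Weyl operators of \<open>r\<close> to absorb the twist of the product.\<close>

lift_definition ramp :: "real \<Rightarrow> real \<Rightarrow> l2" is "\<lambda>c t x. of_real (c * x) * indicator {0<..<t} x"
  using sqint_ramp by simp

lemma ramp_abs: "ramp c t = abs_l2 (\<lambda>x. of_real (c * x) * indicator {0<..<t} x)"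
  by (simp add: ramp_def)

lemma sqint_interval_ind: "sqint halfline (indicator {0<..<t})"
  using interval_ind.rsp by (simp add: rel_fun_def)

lemma interval_ind_abs: "interval_ind t = abs_l2 (indicator {0<..<t})"
  by (simp add: interval_ind_def)

lemma ramp_add:
  assumes st: "0 \<le> s" "0 \<le> t"
  shows "ramp c (s + t) = ramp c s + shift s ((c * s) *\<^sub>R interval_ind t + ramp c t)"
proof -
  let ?r = "\<lambda>t x. complex_of_real (c * x) * indicator {0<..<t} x"
  let ?g = "\<lambda>x. complex_of_real (c * s) * indicator {0<..<t} x + ?r t x"
  have g: "sqint halfline ?g" by (intro sqint_add sqint_cmult sqint_interval_ind sqint_ramp)
  have ci: "sqint halfline (\<lambda>x. complex_of_real (c * s) * indicator {0<..<t} x)"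
    by (intro sqint_cmult sqint_interval_ind)
  have sg: "sqint halfline (\<lambda>x. if s < x then ?g (x - s) else 0)" by (rule sqint_shift[OF g])
  have "(c * s) *\<^sub>R interval_ind t + ramp c t = abs_l2 ?g"
    unfolding ramp_abs interval_ind_abs scaleR_scaleC using ci sqint_ramp[of c t] sqint_interval_ind[of t]
    by (simp add: scaleC_l2.abs_eq plus_l2.abs_eq)
  then have "ramp c s + shift s ((c * s) *\<^sub>R interval_ind t + ramp c t)
      = abs_l2 (\<lambda>x. ?r s x + (if s < x then ?g (x - s) else 0))"
    unfolding ramp_abs using g sg sqint_ramp[of c s] by (simp only: shift.abs_eq l2_eq_refl_iff plus_l2.abs_eq)
  also have "\<dots> = ramp c (s + t)"
    unfolding ramp_abs
  proof (rule abs_l2_eqI)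
    \<comment> \<open>at the junction \<open>x = s\<close> the two sides may differ\<close>
    have "AE x in lborel. x \<noteq> s" by (rule AE_lborel_singleton)
    then show "AE x in halfline. ?r s x + (if s < x then ?g (x - s) else 0) = ?r (s + t) x"
      unfolding AE_halfline_iff
    proof eventually_elim
      case (elim x)
      then show ?case using st by (auto simp: indicator_def algebra_simps simp flip: of_real_add of_real_mult)
    qed
  qed (intro sqint_add sqint_ramp sg)+
  finally show ?thesis ..
qed

lemma cinner_shift_ramp: "0 \<le> t \<Longrightarrow> cinner (shift t \<xi>) (ramp c t) = 0"
proof -
  assume t: "0 \<le> t"
  obtain f where f: "sqint halfline f" "\<xi> = abs_l2 f" by (rule rep_l2)
  have "cinner (shift t \<xi>) (ramp c t) = integral\<^sup>L lborel (\<lambda>x::real. 0)"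
    unfolding f(2) ramp_abs cinner_shift_left[OF f(1) sqint_ramp t]
    by (rule Bochner_Integration.integral_cong) (auto simp: zero_extend_def indicator_def)
  then show ?thesis by simp
qed

lemma cinner_shift_interval_ind: "0 \<le> t \<Longrightarrow> cinner (shift t \<xi>) (interval_ind t) = 0"
proof -
  assume t: "0 \<le> t"
  obtain f where f: "sqint halfline f" "\<xi> = abs_l2 f" by (rule rep_l2)
  have "cinner (shift t \<xi>) (interval_ind t) = integral\<^sup>L lborel (\<lambda>x::real. 0)"
    unfolding f(2) interval_ind_abs cinner_shift_left[OF f(1) sqint_interval_ind t]
    by (rule Bochner_Integration.integral_cong) (auto simp: zero_extend_def indicator_def)
  then show ?thesis by simp
qed

lemma cinner_ramp_shift: "0 \<le> t \<Longrightarrow> cinner (ramp c t) (shift t \<xi>) = 0"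
  by (subst cinner_commute) (simp add: cinner_shift_ramp)

lemma Im_cinner_ramp_interval_ind: "Im (cinner (ramp c s) (interval_ind t)) = 0"
proof -
  have "cinner (ramp c s) (interval_ind t)
      = (LINT x|lborel. complex_of_real (c * x * indicator {0<..<s} x * indicator {0<..<t} x))"
    unfolding ramp_abs interval_ind_abs cinner_abs_l2[OF sqint_ramp sqint_interval_ind]
    by (rule Bochner_Integration.integral_cong) (auto simp: zero_extend_def indicator_def)
  then show ?thesis by (simp only: integral_complex_of_real Im_complex_of_real)
qed

lemma interval_ind_neq_0:
  assumes t: "0 < t"
  shows "interval_ind t \<noteq> 0"
proof
  assume "interval_ind t = 0"
  then have "(LINT x|lborel. zero_extend (indicator {0<..<t}) x * cnj (zero_extend (indicator {0<..<t}) x)) = 0"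
    using cinner_abs_l2[OF sqint_interval_ind sqint_interval_ind, of t t]
    unfolding interval_ind_abs[symmetric] by simp
  also have "(LINT x|lborel. zero_extend (indicator {0<..<t}) x * cnj (zero_extend (indicator {0<..<t}) x))
      = (LINT x|lborel. complex_of_real (indicator {0<..<t} x))"
    by (rule Bochner_Integration.integral_cong) (auto simp: zero_extend_def indicator_def)
  also have "\<dots> = of_real t" using t by (simp only: integral_complex_of_real) simp
  finally show False using t by simp
qed

lemma cnj_borel_measurable: "f \<in> borel_measurable M \<Longrightarrow> (\<lambda>x. cnj (f x)) \<in> borel_measurable M"
  by (rule borel_measurable_continuous_on[of cnj]) (auto intro: continuous_intros)

lemma measurable_cinner_shift: "(\<lambda>t. cinner (shift (max 0 t) \<xi>) \<zeta>) \<in> borel_measurable borel"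
proof -
  obtain f where f: "sqint halfline f" "\<xi> = abs_l2 f" by (rule rep_l2)
  obtain g where g: "sqint halfline g" "\<zeta> = abs_l2 g" by (rule rep_l2)
  note [measurable] = zero_extend_measurable[OF f(1)] cnj_borel_measurable[OF zero_extend_measurable[OF g(1)]]
  have "(\<lambda>t. LINT x|lborel. zero_extend f (x - max 0 t) * cnj (zero_extend g x)) \<in> borel_measurable borel"
    by measurable
  then show ?thesis using f g by (simp add: cinner_shift_left)
qed

lemma measurable_cinner_ramp:
  shows "(\<lambda>t. cinner (ramp c t) \<zeta>) \<in> borel_measurable borel"
    and "(\<lambda>t. norm (ramp c t)) \<in> borel_measurable borel"
proof -
  let ?r = "\<lambda>t x. complex_of_real (c * x) * indicator {0<..<t} x"
  have r: "zero_extend (?r t) x = of_real (c * x) * (if 0 < x \<and> x < t then 1 else 0)" for t x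
    by (simp add: zero_extend_def indicator_def)
  obtain g where g: "sqint halfline g" "\<zeta> = abs_l2 g" by (rule rep_l2)
  note [measurable] = cnj_borel_measurable[OF zero_extend_measurable[OF g(1)]]
  have "(\<lambda>t. LINT x|lborel. zero_extend (?r t) x * cnj (zero_extend g x)) \<in> borel_measurable borel"
    unfolding r by measurable
  then show "(\<lambda>t. cinner (ramp c t) \<zeta>) \<in> borel_measurable borel"
    unfolding ramp_abs g(2) cinner_abs_l2[OF sqint_ramp g(1)] .
  have "(\<lambda>t. LINT x|lborel. (c * x)\<^sup>2 * (if 0 < x \<and> x < t then 1 else 0)) \<in> borel_measurable borel"
    by measurable
  moreover have "(LINT x|lborel. (c * x)\<^sup>2 * (if 0 < x \<and> x < t then 1 else 0)) = (norm (ramp c t))\<^sup>2" for t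
  proof -
    have "complex_of_real ((norm (ramp c t))\<^sup>2) = (LINT x|lborel. zero_extend (?r t) x * cnj (zero_extend (?r t) x))"
      unfolding cinner_self[symmetric] ramp_abs by (rule cinner_abs_l2[OF sqint_ramp sqint_ramp])
    also have "\<dots> = (LINT x|lborel. complex_of_real ((c * x)\<^sup>2 * (if 0 < x \<and> x < t then 1 else 0)))"
      unfolding r by (rule Bochner_Integration.integral_cong) (auto simp: power2_eq_square)
    finally show ?thesis by (simp only: integral_complex_of_real of_real_eq_iff)
  qed
  ultimately have "(\<lambda>t. (norm (ramp c t))\<^sup>2) \<in> borel_measurable borel" by simp
  then have "(\<lambda>t. sqrt ((norm (ramp c t))\<^sup>2)) \<in> borel_measurable borel" by measurable
  then show "(\<lambda>t. norm (ramp c t)) \<in> borel_measurable borel" by simp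
qed

section \<open>The unit for proportional functionals\<close>

text \<open>The product of the Weyl operator of \<open>ramp c t\<close> and the second quantization of the shift by \<open>t\<close>.\<close>

definition ramp_unit :: "real \<Rightarrow> real \<Rightarrow> fock \<Rightarrow> fock" where
  "ramp_unit c t = (SOME T. T \<in> bop \<and> (\<forall>\<eta>. T (expvec \<eta>) =
      exp (- of_real ((norm (ramp c t))\<^sup>2 / 2)) *\<^sub>C expvec (ramp c t + shift t \<eta>)) \<and> (\<forall>v. norm (T v) = norm v))"

lemma
  assumes t: "0 \<le> t"
  shows ramp_unit_bop: "ramp_unit c t \<in> bop"
    and ramp_unit_expvec: "ramp_unit c t (expvec \<eta>) =
      exp (- of_real ((norm (ramp c t))\<^sup>2 / 2)) *\<^sub>C expvec (ramp c t + shift t \<eta>)"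
    and norm_ramp_unit: "norm (ramp_unit c t v) = norm v"
proof -
  have "\<exists>T\<in>bop. (\<forall>\<eta>. T (expvec \<eta>) = exp (- of_real ((norm (ramp c t))\<^sup>2 / 2)) *\<^sub>C expvec (ramp c t + shift t \<eta>))
      \<and> (\<forall>v. norm (T v) = norm v)"
    using span_dense_expvec
  proof (rule isometric_extension)
    fix \<eta> \<zeta>
    show "cinner (exp (- of_real ((norm (ramp c t))\<^sup>2 / 2)) *\<^sub>C expvec (ramp c t + shift t \<eta>))
        (exp (- of_real ((norm (ramp c t))\<^sup>2 / 2)) *\<^sub>C expvec (ramp c t + shift t \<zeta>))
        = cinner (expvec \<eta>) (expvec \<zeta>)"
      using t by (simp add: cinner_scaleC_left cinner_scaleC_right cinner_expvec cinner_add_left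
          cinner_add_right cinner_shift_ramp cinner_ramp_shift cinner_shift_shift cinner_self
          exp_cnj exp_add[symmetric])
  qed
  from someI_ex[OF this[unfolded Bex_def], folded ramp_unit_def]
  show "ramp_unit c t \<in> bop" "ramp_unit c t (expvec \<eta>) =
      exp (- of_real ((norm (ramp c t))\<^sup>2 / 2)) *\<^sub>C expvec (ramp c t + shift t \<eta>)"
    "norm (ramp_unit c t v) = norm v" by blast+
qed

lemma ramp_unit_weyl:
  assumes t: "0 \<le> t"
  shows "ramp_unit c t (weyl \<xi> v) = weyl (shift t \<xi>) (ramp_unit c t v)"
proof -
  have "ramp_unit c t \<circ> weyl \<xi> = weyl (shift t \<xi>) \<circ> ramp_unit c t"
  proof (rule bop_eq_on_span_dense[OF span_dense_expvec])
    fix x assume "x \<in> range expvec"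
    then obtain \<eta> where x: "x = expvec \<eta>" by blast
    show "(ramp_unit c t \<circ> weyl \<xi>) x = (weyl (shift t \<xi>) \<circ> ramp_unit c t) x"
      using t by (simp add: x weyl_expvec ramp_unit_expvec bop_scaleC[OF weyl_bop]
          bop_scaleC[OF ramp_unit_bop] scaleC_scaleC shift_add norm_shift cinner_add_left
          cinner_ramp_shift cinner_shift_shift add.left_commute mult.commute)
  qed (intro comp_bop weyl_bop ramp_unit_bop t)+
  then show ?thesis by (metis comp_apply)
qed

text \<open>Both sides send \<open>expvec \<eta>\<close> to a positive multiple of \<open>expvec (ramp c (s + t) + shift (s + t) \<eta>)\<close>: no
  phase arises because \<open>ramp\<close> and \<open>interval_ind\<close> are real, and both sides are isometric.\<close>

lemma ramp_unit_mult:
  assumes s: "0 \<le> s" and t: "0 \<le> t"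
  shows "ramp_unit c s \<circ> weyl ((c * s) *\<^sub>R interval_ind t) \<circ> ramp_unit c t = ramp_unit c (s + t)"
proof (rule bop_eq_on_span_dense[OF span_dense_expvec])
  fix x assume "x \<in> range expvec"
  then obtain \<eta> where x: "x = expvec \<eta>" by blast
  define z where "z = (c * s) *\<^sub>R interval_ind t"
  have zS: "cinner (shift t \<eta>) z = 0"
    using t by (simp add: z_def cinner_scaleR_right cinner_shift_interval_ind)
  have "Im (cinner (ramp c t) z) = 0"
    by (simp add: z_def cinner_scaleR_right Im_cinner_ramp_interval_ind)
  then have zr: "cinner (ramp c t) z = of_real (Re (cinner (ramp c t) z))" by (simp add: complex_eq_iff)
  have ra: "ramp c (s + t) = ramp c s + shift s (z + ramp c t)"
    unfolding z_def by (rule ramp_add[OF s t])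
  have "Re (cinner z (ramp c t)) = Re (cinner (ramp c t) z)" by (subst cinner_commute) simp
  then have n: "(norm (ramp c (s + t)))\<^sup>2 = (norm (ramp c s))\<^sup>2 + (norm z)\<^sup>2 + (norm (ramp c t))\<^sup>2
      + 2 * Re (cinner (ramp c t) z)"
    using s by (simp add: ra norm_add_sq cinner_ramp_shift norm_shift)
  have v: "ramp c s + shift s (z + (ramp c t + shift t \<eta>)) = ramp c (s + t) + shift (s + t) \<eta>"
    using s t by (simp add: ra shift_add shift_shift add.assoc)
  have e: "- complex_of_real ((norm (ramp c (s + t)))\<^sup>2 / 2) = - of_real ((norm (ramp c t))\<^sup>2 / 2)
      + (- of_real ((norm z)\<^sup>2 / 2) - cinner (ramp c t) z + - of_real ((norm (ramp c s))\<^sup>2 / 2))"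
    unfolding n by (subst zr) (simp add: add_divide_distrib)
  show "(ramp_unit c s \<circ> weyl ((c * s) *\<^sub>R interval_ind t) \<circ> ramp_unit c t) x = ramp_unit c (s + t) x"
    unfolding z_def[symmetric] x comp_apply ramp_unit_expvec[OF s] ramp_unit_expvec[OF t]
      ramp_unit_expvec[OF add_nonneg_nonneg[OF s t]] weyl_expvec bop_scaleC[OF weyl_bop]
      bop_scaleC[OF ramp_unit_bop[OF s]] v scaleC_scaleC cinner_add_left zS e exp_add by (simp add: mult.assoc)
qed (intro comp_bop weyl_bop ramp_unit_bop add_nonneg_nonneg s t)+

text \<open>The operator \<open>ramp_unit c t\<close> is specified for \<open>0 \<le> t\<close> only, whence the maximum.\<close>

lemma measurable_ramp_unit: "(\<lambda>t. cinner (ramp_unit c (max 0 t) v) w) \<in> borel_measurable borel"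
  using span_dense_expvec
proof (induction w rule: span_dense_induct)
  case (base y)
  then obtain \<zeta> where y: "y = expvec \<zeta>" by blast
  show ?case
    using span_dense_expvec
  proof (induction v rule: span_dense_induct)
    case (base x)
    then obtain \<eta> where x: "x = expvec \<eta>" by blast
    have max: "(\<lambda>t :: real. max 0 t) \<in> borel_measurable borel" by measurable
    note [measurable] = measurable_cinner_shift[of \<eta> \<zeta>]
      measurable_compose[OF max measurable_cinner_ramp(1)[of c \<zeta>]]
      measurable_compose[OF max measurable_cinner_ramp(2)[of c]]
    have "(\<lambda>t. exp (- of_real ((norm (ramp c (max 0 t)))\<^sup>2 / 2)) *
        exp (cinner (ramp c (max 0 t)) \<zeta> + cinner (shift (max 0 t) \<eta>) \<zeta>)) \<in> borel_measurable borel"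
      by measurable
    then show ?case
      by (simp add: x y ramp_unit_expvec cinner_scaleC_left cinner_expvec cinner_add_left)
  next
    case (lim f v)
    have "(\<lambda>n. cinner (ramp_unit c (max 0 t) (f n)) y) \<longlonglongrightarrow> cinner (ramp_unit c (max 0 t) v) y" for t
      by (rule tendsto_cinner[OF bounded_linear.tendsto[OF bop_bounded_linear[OF ramp_unit_bop] lim(2)]
          tendsto_const]) simp
    with lim(1) show ?case by (rule borel_measurable_LIMSEQ_metric)
  qed (simp_all add: bop_zero[OF ramp_unit_bop] bop_add[OF ramp_unit_bop] bop_scaleC[OF ramp_unit_bop]
         cinner_add_left cinner_scaleC_left)
next
  case (lim f w)
  have "(\<lambda>n. cinner (ramp_unit c (max 0 t) v) (f n)) \<longlonglongrightarrow> cinner (ramp_unit c (max 0 t) v) w" for t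
    by (rule tendsto_cinner[OF tendsto_const lim(2)])
  with lim(1) show ?case by (rule borel_measurable_LIMSEQ_metric)
qed (simp_all add: cinner_add_right cinner_scaleC_right)

section \<open>Proportionality from a unit\<close>

text \<open>By irreducibility the three forms \<open>cinner (u v) (u w)\<close>, \<open>cinner (u' v) (u' w)\<close> and
  \<open>cinner (u v) (u' w)\<close> are \<open>a\<close>, \<open>b\<close>, \<open>k\<close> times \<open>cinner v w\<close>. Pairing the commutation relation with the
  ranges of \<open>u\<close> and of \<open>u'\<close> gives \<open>a * b = k * cnj k\<close>, so \<open>u\<close> and \<open>u'\<close> are proportional, and the common
  factor cancels from the relation.\<close>

lemma twisted_commuting_intertwiners:
  assumes u: "u \<in> bop" "\<And>\<xi> v. u (weyl \<xi> v) = weyl (V \<xi>) (u v)" "u v0 \<noteq> 0"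
    and u': "u' \<in> bop" "\<And>\<xi> v. u' (weyl \<xi> v) = weyl (V \<xi>) (u' v)" "u' v0' \<noteq> 0"
    and comm: "\<And>v. u (weyl z (u' v)) = u' (weyl z' (u v))"
  shows "weyl z (u' v) = weyl z' (u' v)"
proof -
  have inv: "cinner (S (weyl \<xi> v)) (T (weyl \<xi> w)) = cinner (S v) (T w)"
    if "S \<in> {u, u'}" "T \<in> {u, u'}" for S T \<xi> v w
    using that u(2) u'(2) by (auto simp: cinner_weyl)
  obtain a where a: "\<And>v w. cinner (u v) (u w) = a * cinner v w"
    using weyl_invariant_form[OF u(1) u(1) inv] by blast
  obtain b where b: "\<And>v w. cinner (u' v) (u' w) = b * cinner v w"
    using weyl_invariant_form[OF u'(1) u'(1) inv] by blast
  obtain k where k: "\<And>v w. cinner (u v) (u' w) = k * cinner v w"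
    using weyl_invariant_form[OF u(1) u'(1) inv] by blast
  have k': "cinner (u' v) (u w) = cnj k * cinner v w" for v w
    by (subst (1 2) cinner_commute) (simp add: k)
  have a0: "a \<noteq> 0" using a[of v0 v0] u(3) by auto
  have b0: "b \<noteq> 0" using b[of v0' v0'] u'(3) by auto
  define X where "X v = weyl z (u' v)" for v
  define Y where "Y v = weyl z' (u v)" for v
  have uX: "u (X v) = u' (Y v)" for v unfolding X_def Y_def by (rule comm)
  have X0: "X v0' \<noteq> 0" using norm_weyl[of z "u' v0'"] u'(3) by (auto simp: X_def)
  have 1: "a *\<^sub>C X v = cnj k *\<^sub>C Y v" for v
  proof (rule cinner_eqI)
    fix w
    have "cinner (u (X v)) (u w) = cinner (u' (Y v)) (u w)" by (simp add: uX)
    then show "cinner (a *\<^sub>C X v) w = cinner (cnj k *\<^sub>C Y v) w"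
      by (simp add: a k' cinner_scaleC_left)
  qed
  have 2: "k *\<^sub>C X v = b *\<^sub>C Y v" for v
  proof (rule cinner_eqI)
    fix w
    have "cinner (u (X v)) (u' w) = cinner (u' (Y v)) (u' w)" by (simp add: uX)
    then show "cinner (k *\<^sub>C X v) w = cinner (b *\<^sub>C Y v) w"
      by (simp add: b k cinner_scaleC_left)
  qed
  \<comment> \<open>equality in the Cauchy--Schwarz inequality for \<open>u\<close> and \<open>u'\<close>\<close>
  have "(a * b - k * cnj k) *\<^sub>C X v0' = 0"
  proof -
    have "(a * b) *\<^sub>C X v0' = b *\<^sub>C (a *\<^sub>C X v0')" by (simp add: scaleC_scaleC mult.commute)
    also have "\<dots> = cnj k *\<^sub>C (b *\<^sub>C Y v0')" by (simp add: 1 scaleC_scaleC mult.commute)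
    also have "\<dots> = (k * cnj k) *\<^sub>C X v0'" by (simp add: 2[symmetric] scaleC_scaleC mult.commute)
    finally have "(a * b) *\<^sub>C X v0' + (- (k * cnj k)) *\<^sub>C X v0' = 0"
      by (simp flip: scaleC_add_left)
    then show ?thesis by (simp flip: scaleC_add_left)
  qed
  then have "cmod (a * b - k * cnj k) * norm (X v0') = 0" by (simp flip: norm_scaleC)
  then have ab: "a * b = k * cnj k" using X0 by simp
  have k0: "k \<noteq> 0" using ab a0 b0 by auto
  have uu': "b *\<^sub>C u v = k *\<^sub>C u' v" for v
  proof -
    have "cinner (b *\<^sub>C u v - k *\<^sub>C u' v) (b *\<^sub>C u v - k *\<^sub>C u' v)
        = (b * cnj b * a - b * cnj k * k - k * cnj b * cnj k + k * cnj k * b) * cinner v v"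
      by (simp add: cinner_diff_left cinner_diff_right cinner_scaleC_left cinner_scaleC_right a b k k'
          algebra_simps)
    also have "b * cnj b * a - b * cnj k * k - k * cnj b * cnj k + k * cnj k * b = 0"
      using ab by (simp add: algebra_simps)
    finally show ?thesis by simp
  qed
  \<comment> \<open>\<open>u = (k / b) u'\<close> and \<open>X = (b / k) Y\<close>: the factors cancel\<close>
  have "k *\<^sub>C X v = k *\<^sub>C weyl z' (u' v)"
    unfolding 2 Y_def bop_scaleC[OF weyl_bop, symmetric] uu' ..
  then have "(1 / k) *\<^sub>C k *\<^sub>C X v = (1 / k) *\<^sub>C k *\<^sub>C weyl z' (u' v)" by (rule arg_cong)
  then show ?thesis using k0 by (simp add: scaleC_scaleC X_def)
qed

text \<open>The Weyl operators of the real multiples of \<open>h\<close> form a one-parameter group, so \<open>v\<close> is fixed by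
  \<open>weyl ((q - p) h)\<close>.\<close>

lemma weyl_scaleR_eq_imp_eq:
  assumes h: "h \<noteq> 0" and v: "v \<noteq> 0" and eq: "weyl (p *\<^sub>R h) v = weyl (q *\<^sub>R h) v"
  shows "p = q"
proof (rule ccontr)
  assume "p \<noteq> q"
  then have h': "(q - p) *\<^sub>R h \<noteq> 0" using h by simp
  have comp: "weyl (r *\<^sub>R h) (weyl (s *\<^sub>R h) x) = weyl ((r + s) *\<^sub>R h) x" for r s x
  proof -
    have "weyl (r *\<^sub>R h) \<circ> weyl (s *\<^sub>R h) = weyl (r *\<^sub>R h + s *\<^sub>R h)"
      by (rule weyl_comp) (simp add: cinner_scaleR_left cinner_scaleR_right cinner_self)
    then show ?thesis by (metis comp_apply scaleR_add_left)
  qed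
  have "weyl ((q - p) *\<^sub>R h) v = v"
    using weyl_zero comp[of "- p" q v] comp[of "- p" p v] eq by (simp add: add.commute)
  then have "v = 0" by (rule weyl_no_fixed_vector[OF h'])
  with v show False by simp
qed

text \<open>Each nonzero point of \<open>P\<close> can be scaled to the level of \<open>m\<close> of one fixed point \<open>a\<close>, so \<open>l = c m\<close> on \<open>P\<close>
  with \<open>c = (l \<bullet> a) / (m \<bullet> a)\<close>, and \<open>P\<close> spans the space.\<close>

lemma proportional_if_constant_on_level_sets:
  fixes P :: "'a::euclidean_space set"
  assumes P: "cone P" and span: "{x - y | x y. x \<in> P \<and> y \<in> P} = UNIV"
    and l: "\<And>x. x \<in> P - {0} \<Longrightarrow> 0 < l \<bullet> x" and m: "\<And>x. x \<in> P - {0} \<Longrightarrow> 0 < m \<bullet> x"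
    and eq: "\<And>a b. a \<in> P - {0} \<Longrightarrow> b \<in> P - {0} \<Longrightarrow> m \<bullet> a = m \<bullet> b \<Longrightarrow> l \<bullet> a = l \<bullet> b"
  shows "\<exists>c>0. l = c *\<^sub>R m"
proof -
  obtain z :: 'a where "z \<noteq> 0" using nonempty_Basis nonzero_Basis by blast
  moreover obtain x y where "x \<in> P" "y \<in> P" "z = x - y" using span by blast
  ultimately obtain a where a: "a \<in> P - {0}" by (cases "x = 0") auto
  define c where "c = (l \<bullet> a) / (m \<bullet> a)"
  have c: "0 < c" using l[OF a] m[OF a] by (simp add: c_def)
  have onP: "l \<bullet> x = c * (m \<bullet> x)" if x: "x \<in> P" for x
  proof (cases "x = 0")
    case False
    define r where "r = (m \<bullet> a) / (m \<bullet> x)"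
    have r: "0 < r" using m[OF a] m[of x] x False by (simp add: r_def)
    have "r *\<^sub>R x \<in> P" using P x r by (simp add: cone_def)
    then have "l \<bullet> a = l \<bullet> (r *\<^sub>R x)"
      using a r False m[of x] x by (intro eq) (auto simp: r_def)
    then show ?thesis using m[OF a] m[of x] x False by (simp add: c_def r_def field_simps)
  qed simp
  have "(l - c *\<^sub>R m) \<bullet> z = 0" for z
  proof -
    obtain x y where "x \<in> P" "y \<in> P" "z = x - y" using span by blast
    then show ?thesis using onP[of x] onP[of y]
      by (simp only: inner_diff_left inner_diff_right inner_scaleR_left)
  qed
  from this[of "l - c *\<^sub>R m"] have "l = c *\<^sub>R m" by simp
  with c show ?thesis by blast
qed

theorem proposition4p6:
  fixes P :: "(real^'d) set" and l m :: "real^'d"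
    and \<alpha> :: "real^'d \<Rightarrow> (fock \<Rightarrow> fock) \<Rightarrow> (fock \<Rightarrow> fock)"
  assumes "closed P" and "convex_cone P"
    and "{x - y | x y. x \<in> P \<and> y \<in> P} = UNIV"
    and "P \<inter> uminus ` P = {0}"
    and "l \<in> dual_interior P" and "m \<in> dual_interior P"
    and "ccr_flow P (\<lambda>a. shift (m \<bullet> a)) \<alpha>"
  shows "(\<exists>u. system_unit P (fibre \<alpha>) (twisted_mult l m) u) \<longleftrightarrow> (\<exists>c>0. l = c *\<^sub>R m)"
proof -
  have l: "0 < l \<bullet> x" and m: "0 < m \<bullet> x" if "x \<in> P - {0}" for x
    using assms(5,6) that by (auto simp: dual_interior_def)
  have \<alpha>W: "\<alpha> x (weyl \<xi>) = weyl (shift (m \<bullet> x) \<xi>)" if "x \<in> P" for x \<xi>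
    using assms(7) that by (simp add: ccr_flow_def)
  show ?thesis
  proof
    assume "\<exists>u. system_unit P (fibre \<alpha>) (twisted_mult l m) u"
    then obtain u where u: "system_unit P (fibre \<alpha>) (twisted_mult l m) u" ..
    have ub: "u a \<in> bop" and u0: "\<exists>v. u a v \<noteq> 0"
      and uW: "u a (weyl \<xi> v) = weyl (shift (m \<bullet> a) \<xi>) (u a v)" if a: "a \<in> P" for a \<xi> v
    proof -
      have ua: "u a \<in> fibre \<alpha> a" "u a \<noteq> (\<lambda>_. 0)" using u a by (auto simp: system_unit_def)
      then show "u a \<in> bop" "\<exists>v. u a v \<noteq> 0" by (auto simp: fibre_def)
      have "\<alpha> a (weyl \<xi>) \<circ> u a = u a \<circ> weyl \<xi>" using ua(1) weyl_bop by (simp add: fibre_def)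
      then show "u a (weyl \<xi> v) = weyl (shift (m \<bullet> a) \<xi>) (u a v)"
        by (simp add: \<alpha>W[OF a] fun_eq_iff)
    qed
    show "\<exists>c>0. l = c *\<^sub>R m"
    proof (rule proportional_if_constant_on_level_sets[OF _ assms(3) l m])
      show "cone P" using assms(2) by (simp add: convex_cone_def cone_def conic_def)
      fix a b assume a: "a \<in> P - {0}" and b: "b \<in> P - {0}" and mab: "m \<bullet> a = m \<bullet> b"
      \<comment> \<open>\<open>u a\<close> and \<open>u b\<close> intertwine the same shift, since \<open>m \<bullet> a = m \<bullet> b\<close>\<close>
      have aP: "a \<in> P" and bP: "b \<in> P" using a b by auto
      define h where "h = interval_ind (m \<bullet> a)"
      have h: "h \<noteq> 0" unfolding h_def by (rule interval_ind_neq_0[OF m[OF a]])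
      have "twisted_mult l m a b (u a) (u b) = twisted_mult l m b a (u b) (u a)"
        using u aP bP by (simp add: system_unit_def add.commute)
      then have comm: "u a (weyl ((l \<bullet> a) *\<^sub>R h) (u b v)) = u b (weyl ((l \<bullet> b) *\<^sub>R h) (u a v))" for v
        by (simp add: twisted_mult_def h_def mab fun_eq_iff)
      obtain va vb where v: "u a va \<noteq> 0" "u b vb \<noteq> 0" using u0 aP bP by blast
      have "weyl ((l \<bullet> a) *\<^sub>R h) (u b vb) = weyl ((l \<bullet> b) *\<^sub>R h) (u b vb)"
        by (rule twisted_commuting_intertwiners[where V = "shift (m \<bullet> a)", OF ub[OF aP] uW[OF aP] v(1)
              ub[OF bP] _ v(2) comm]) (simp add: uW[OF bP] mab)
      then show "l \<bullet> a = l \<bullet> b" by (rule weyl_scaleR_eq_imp_eq[OF h v(2)])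
    qed
  next
    assume "\<exists>c>0. l = c *\<^sub>R m"
    then obtain c where lc: "l = c *\<^sub>R m" by blast
    have m0: "0 \<le> m \<bullet> a" if "a \<in> P" for a using m[of a] that by (cases "a = 0") auto
    define u where "u a = ramp_unit c (m \<bullet> a)" for a
    have "system_unit P (fibre \<alpha>) (twisted_mult l m) u"
      unfolding system_unit_def
    proof (intro conjI ballI allI)
      fix a assume a: "a \<in> P"
      have "unital_normal_star_endomorphism (\<alpha> a)" using assms(7) a by (simp add: ccr_flow_def)
      then have "\<alpha> a A \<circ> u a = u a \<circ> A" if "A \<in> bop" for A
        unfolding u_def using \<alpha>W[OF a] ramp_unit_bop[OF m0[OF a]] ramp_unit_weyl[OF m0[OF a]] that
        by (rule weyl_intertwiner_in_fibre)
      then show "u a \<in> fibre \<alpha> a"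
        using ramp_unit_bop[OF m0[OF a], of c] by (simp add: fibre_def u_def)
      have "u a (expvec 0) \<noteq> 0"
      proof
        assume "u a (expvec 0) = 0"
        then have "expvec 0 = 0" using norm_ramp_unit[OF m0[OF a], of c "expvec 0"] by (simp add: u_def)
        then show False using cinner_expvec[of 0 0] by simp
      qed
      then show "u a \<noteq> (\<lambda>_. 0)" by metis
    next
      fix a b assume a: "a \<in> P" and b: "b \<in> P"
      show "twisted_mult l m a b (u a) (u b) = u (a + b)"
        using ramp_unit_mult[OF m0[OF a] m0[OF b], of c]
        by (simp add: twisted_mult_def u_def lc inner_add_right)
    next
      fix v w
      have "(\<lambda>a. cinner (ramp_unit c (max 0 (m \<bullet> a)) v) w) \<in> borel_measurable borel"
        by (rule measurable_compose[OF _ measurable_ramp_unit]) measurable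
      then have "(\<lambda>a. cinner (ramp_unit c (max 0 (m \<bullet> a)) v) w) \<in> borel_measurable (restrict_space borel P)"
        by (rule measurable_restrict_space1)
      also have "?this \<longleftrightarrow> (\<lambda>a. cinner (u a v) w) \<in> borel_measurable (restrict_space borel P)"
        by (rule measurable_cong) (simp add: space_restrict_space u_def m0 max_def)
      finally show "(\<lambda>a. cinner (u a v) w) \<in> borel_measurable (restrict_space borel P)" .
    qed
    then show "\<exists>u. system_unit P (fibre \<alpha>) (twisted_mult l m) u" by blast
  qed
qed

end
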